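(* Let $\Omega\subset\mathbb R^2$ be a bounded domain and $U[X]=\int_\Omega\big(\tfrac{\varrho^2}2-\varrho b\big)dx$. Newton's equations with potential $\frac1{\varepsilon^2}U$ on $\mathsf{Diff}_{\varrho_0,\rm GN}(\Omega)$ are $$\begin{cases}\nabla_{\dot X}\dot X=-\frac1{\varepsilon^2}\,\eta\circ X,\\ A_\varrho\eta=\nabla(\varrho-b).\end{cases}$$ The Eulerian velocity field $u=\dot X\circ X^{-1}$ satisfies the Green–Naghdi equations $$\begin{cases}\partial_tv+\nabla_uv+(\nabla u)v+\nabla\Big(\frac1{\varepsilon^2}(\varrho-b)-\frac12|u|^2-\frac12(\varrho\,\mathrm{div}u+\langle u,\nabla b\rangle)^2\Big)=0,\\ v=A_\varrho u,\\ \partial_t\varrho+\mathrm{div}(\varrho u)=0.\end{cases}$$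
   Context: $b$ is a fixed smooth positive function on $\Omega$, $\varrho_0$ a smooth positive function. $\mathsf{Diff}(\Omega)$ is the group of smooth diffeomorphisms leaving the boundary invariant, with $T_X\mathsf{Diff}(\Omega)=\{\zeta\circ X:\zeta$ smooth, tangent to the boundary$\}$; $\varrho=\varrho_X=\frac{\varrho_0}{\det\nabla X}\circ X^{-1}$. $\mathsf{Diff}_{\varrho_0,\rm GN}(\Omega)$ is $\mathsf{Diff}(\Omega)$ with the metric $$(\xi\circ X,\eta\circ X)_{\varrho_0,\rm GN}=\int_\Omega\varrho\langle\xi,\eta\rangle+\tfrac13\varrho^3\,\mathrm{div}\xi\,\mathrm{div}\eta+\tfrac12\varrho^2\,\mathrm{div}\xi\,\langle\eta,\nabla b\rangle+\tfrac12\varrho^2\,\mathrm{div}\eta\,\langle\xi,\nabla b\rangle+\varrho\langle\xi,\nabla b\rangle\langle\eta,\nabla b\rangle=\int_\Omega\varrho\langle\xi,A_\varrho\eta\rangle,$$ $$A_\varrho\eta=\eta-\frac13\frac{\nabla(\varrho^3\mathrm{div}\eta)}\varrho-\frac12\frac{\nabla(\varrho^2\langle\eta,\nabla b\rangle)}\varrho+\frac12\varrho\,\mathrm{div}\eta\,\nabla b+\langle\eta,\nabla b\rangle\nabla b,$$ and $A_\varrho$ is regarded as invertible on smooth vector fields tangent to the boundary. Newton's equation with potential $F$ is $\nabla_{\dot X}\dot X=-\operatorname{grad}F[X]$, with the Levi-Civita connection and gradient of this metric. In the Eulerian equations, $\nabla_uv=(u\cdot\nabla)v$ and $(\nabla u)v$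 is the vector field with components $((\nabla u)v)_j=\sum_i(\partial_ju_i)v_i$. *)

theory Defs
  imports "HOL-Analysis.Analysis"
begin

type_synonym plane = "real ^ 2"

section \<open>Smooth functions and smooth domains\<close>

primrec ck_on :: "nat \<Rightarrow> 'a::euclidean_space set \<Rightarrow> ('a \<Rightarrow> 'b::real_normed_vector) \<Rightarrow> bool" where
  "ck_on 0 S f \<longleftrightarrow> continuous_on S f"
| "ck_on (Suc n) S f \<longleftrightarrow>
     (\<forall>x\<in>S. f differentiable (at x)) \<and> (\<forall>v. ck_on n S (\<lambda>x. frechet_derivative f (at x) v))"

text \<open>Only meaningful for open \<open>S\<close>.\<close>
definition smooth_on :: "'a::euclidean_space set \<Rightarrow> ('a \<Rightarrow> 'b::real_normed_vector) \<Rightarrow> bool" where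
  "smooth_on S f \<longleftrightarrow> (\<forall>n. ck_on n S f)"

text \<open>Smoothness up to the boundary: \<open>f\<close> agrees on \<open>S\<close> with a function that is smooth on an
  open neighbourhood of \<open>S\<close>. The values of \<open>f\<close> outside \<open>S\<close> are irrelevant throughout:
  functions on \<open>closure \<Omega>\<close> are modelled by total functions whose values elsewhere are arbitrary.\<close>
definition smooth_upto :: "'a::euclidean_space set \<Rightarrow> ('a \<Rightarrow> 'b::real_normed_vector) \<Rightarrow> bool" where
  "smooth_upto S f \<longleftrightarrow> (\<exists>U g. open U \<and> S \<subseteq> U \<and> smooth_on U g \<and> (\<forall>x\<in>S. g x = f x))"

definition grad :: "(plane \<Rightarrow> real) \<Rightarrow> plane \<Rightarrow> plane" where
  "grad f x = (\<chi> j. frechet_derivative f (at x) (axis j 1))"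

definition divg :: "(plane \<Rightarrow> plane) \<Rightarrow> plane \<Rightarrow> real" where
  "divg F x = trace (jacobian F (at x))"

definition defining_function :: "plane set \<Rightarrow> (plane \<Rightarrow> real) \<Rightarrow> bool" where
  "defining_function \<Omega> d \<longleftrightarrow>
     smooth_on UNIV d \<and> \<Omega> = {x. d x < 0} \<and> (\<forall>x. d x = 0 \<longrightarrow> grad d x \<noteq> 0)"

text \<open>Bounded domain with smooth boundary; the boundary is \<open>{x. d x = 0}\<close> for any defining
  function \<open>d\<close>, with normal direction \<open>grad d\<close>.\<close>
definition smooth_bounded_domain :: "plane set \<Rightarrow> bool" where
  "smooth_bounded_domain \<Omega> \<longleftrightarrow>
     open \<Omega> \<and> connected \<Omega> \<and> \<Omega> \<noteq> {} \<and> bounded \<Omega> \<and> (\<exists>d. defining_function \<Omega> d)"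

definition tangent_field :: "plane set \<Rightarrow> (plane \<Rightarrow> plane) \<Rightarrow> bool" where
  "tangent_field \<Omega> \<zeta> \<longleftrightarrow> smooth_upto (closure \<Omega>) \<zeta> \<and>
     (\<forall>d. defining_function \<Omega> d \<longrightarrow> (\<forall>x\<in>frontier \<Omega>. \<zeta> x \<bullet> grad d x = 0))"


section \<open>The diffeomorphism group, its curves and tangent vectors\<close>

definition inverse_map :: "plane set \<Rightarrow> (plane \<Rightarrow> plane) \<Rightarrow> plane \<Rightarrow> plane" where
  "inverse_map \<Omega> X = inv_into (closure \<Omega>) X"

definition Diff :: "plane set \<Rightarrow> (plane \<Rightarrow> plane) set" where
  "Diff \<Omega> = {X. bij_betw X (closure \<Omega>) (closure \<Omega>) \<and> X ` frontier \<Omega> = frontier \<Omega> \<and>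
     smooth_upto (closure \<Omega>) X \<and> smooth_upto (closure \<Omega>) (inverse_map \<Omega> X)}"

definition tangent_space :: "plane set \<Rightarrow> (plane \<Rightarrow> plane) \<Rightarrow> (plane \<Rightarrow> plane) set" where
  "tangent_space \<Omega> X = {V. \<exists>\<zeta>. tangent_field \<Omega> \<zeta> \<and> (\<forall>x\<in>closure \<Omega>. V x = \<zeta> (X x))}"

text \<open>Right translation to the identity, \<open>V \<circ> X\<inverse>\<close>.\<close>
definition eulerian :: "plane set \<Rightarrow> (plane \<Rightarrow> plane) \<Rightarrow> (plane \<Rightarrow> plane) \<Rightarrow> plane \<Rightarrow> plane" where
  "eulerian \<Omega> X V x = V (inverse_map \<Omega> X x)"

definition mass_density :: "plane set \<Rightarrow> (plane \<Rightarrow> real) \<Rightarrow> (plane \<Rightarrow> plane) \<Rightarrow> plane \<Rightarrow> real" where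
  "mass_density \<Omega> \<rho>0 X x =
     (let y = inverse_map \<Omega> X x in \<rho>0 y / det (jacobian X (at y)))"

definition open_interval :: "real set \<Rightarrow> bool" where
  "open_interval I \<longleftrightarrow> open I \<and> is_interval I"

definition smooth_curve :: "plane set \<Rightarrow> real set \<Rightarrow> (real \<Rightarrow> plane \<Rightarrow> plane) \<Rightarrow> bool" where
  "smooth_curve \<Omega> I X \<longleftrightarrow> open_interval I \<and>
     smooth_upto (I \<times> closure \<Omega>) (\<lambda>(t, x). X t x) \<and> (\<forall>t\<in>I. X t \<in> Diff \<Omega>)"

definition smooth_surface ::
  "plane set \<Rightarrow> real set \<Rightarrow> real set \<Rightarrow> (real \<Rightarrow> real \<Rightarrow> plane \<Rightarrow> plane) \<Rightarrow> bool" where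
  "smooth_surface \<Omega> J I X \<longleftrightarrow> open_interval J \<and> open_interval I \<and>
     smooth_upto (J \<times> I \<times> closure \<Omega>) (\<lambda>(s, t, x). X s t x) \<and>
     (\<forall>s\<in>J. \<forall>t\<in>I. X s t \<in> Diff \<Omega>)"

definition velocity :: "(real \<Rightarrow> plane \<Rightarrow> plane) \<Rightarrow> real \<Rightarrow> plane \<Rightarrow> plane" where
  "velocity X t x = vector_derivative (\<lambda>s. X s x) (at t)"

definition field_along ::
  "plane set \<Rightarrow> real set \<Rightarrow> (real \<Rightarrow> plane \<Rightarrow> plane) \<Rightarrow> (real \<Rightarrow> plane \<Rightarrow> plane) \<Rightarrow> bool" where
  "field_along \<Omega> I X V \<longleftrightarrow>
     smooth_upto (I \<times> closure \<Omega>) (\<lambda>(t, x). V t x) \<and> (\<forall>t\<in>I. V t \<in> tangent_space \<Omega> (X t))"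


section \<open>Gradient, Levi-Civita connection and Newton's equation\<close>

text \<open>A metric is a function \<open>g X V W\<close> of a diffeomorphism \<open>X\<close> and two tangent vectors at \<open>X\<close>.\<close>
type_synonym riem_metric = "(plane \<Rightarrow> plane) \<Rightarrow> (plane \<Rightarrow> plane) \<Rightarrow> (plane \<Rightarrow> plane) \<Rightarrow> real"

text \<open>\<open>G\<close> represents the differential of \<open>F\<close> at \<open>X\<close>, the latter being computed along smooth
  curves through \<open>X\<close>.\<close>
definition has_gradient ::
  "plane set \<Rightarrow> riem_metric \<Rightarrow> ((plane \<Rightarrow> plane) \<Rightarrow> real) \<Rightarrow> (plane \<Rightarrow> plane) \<Rightarrow> (plane \<Rightarrow> plane) \<Rightarrow> bool"
where
  "has_gradient \<Omega> g F X G \<longleftrightarrow> G \<in> tangent_space \<Omega> X \<and>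
     (\<forall>J c. \<forall>t\<in>J. smooth_curve \<Omega> J c \<and> (\<forall>x\<in>closure \<Omega>. c t x = X x) \<longrightarrow>
        ((\<lambda>r. F (c r)) has_real_derivative g X G (velocity c t)) (at t))"

text \<open>A connection is given by its covariant derivatives along curves: \<open>D I X V t\<close> is
  \<open>\<nabla>\<^bsub>X'(t)\<^esub> V\<close> for a vector field \<open>V\<close> along the curve \<open>X\<close> with parameter interval \<open>I\<close>.
  The conditions are, in order: values are smooth vector fields along the curve, additivity,
  Leibniz rule, chain rule (including locality, and independence of irrelevant values),
  vanishing torsion, compatibility with the metric.\<close>
type_synonym connection =
  "real set \<Rightarrow> (real \<Rightarrow> plane \<Rightarrow> plane) \<Rightarrow> (real \<Rightarrow> plane \<Rightarrow> plane) \<Rightarrow> real \<Rightarrow> plane \<Rightarrow> plane"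

definition affine_connection :: "plane set \<Rightarrow> connection \<Rightarrow> bool" where
  "affine_connection \<Omega> D \<longleftrightarrow>
     (\<forall>I X V. smooth_curve \<Omega> I X \<and> field_along \<Omega> I X V \<longrightarrow> field_along \<Omega> I X (D I X V)) \<and>
     (\<forall>I X V W. smooth_curve \<Omega> I X \<and> field_along \<Omega> I X V \<and> field_along \<Omega> I X W \<longrightarrow>
        (\<forall>t\<in>I. \<forall>x\<in>closure \<Omega>.
           D I X (\<lambda>s y. V s y + W s y) t x = D I X V t x + D I X W t x)) \<and>
     (\<forall>I X V f. smooth_curve \<Omega> I X \<and> field_along \<Omega> I X V \<and> smooth_on I f \<longrightarrow>
        (\<forall>t\<in>I. \<forall>x\<in>closure \<Omega>.
           D I X (\<lambda>s y. f s *\<^sub>R V s y) t x = deriv f t *\<^sub>R V t x + f t *\<^sub>R D I X V t x)) \<and>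
     (\<forall>I J X V X' V' \<phi>. smooth_curve \<Omega> I X \<and> field_along \<Omega> I X V \<and>
          open_interval J \<and> smooth_on J \<phi> \<and> \<phi> ` J \<subseteq> I \<and>
          (\<forall>t\<in>J. \<forall>x\<in>closure \<Omega>. X' t x = X (\<phi> t) x \<and> V' t x = V (\<phi> t) x) \<longrightarrow>
        (\<forall>t\<in>J. \<forall>x\<in>closure \<Omega>. D J X' V' t x = deriv \<phi> t *\<^sub>R D I X V (\<phi> t) x))"

definition torsion_free :: "plane set \<Rightarrow> connection \<Rightarrow> bool" where
  "torsion_free \<Omega> D \<longleftrightarrow>
     (\<forall>J I X. smooth_surface \<Omega> J I X \<longrightarrow>
        (\<forall>s\<in>J. \<forall>t\<in>I. \<forall>x\<in>closure \<Omega>.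
           D I (X s) (\<lambda>t'. velocity (\<lambda>s'. X s' t') s) t x =
           D J (\<lambda>s'. X s' t) (\<lambda>s'. velocity (X s') t) s x))"

definition metric_compatible :: "plane set \<Rightarrow> riem_metric \<Rightarrow> connection \<Rightarrow> bool" where
  "metric_compatible \<Omega> g D \<longleftrightarrow>
     (\<forall>I X V W. smooth_curve \<Omega> I X \<and> field_along \<Omega> I X V \<and> field_along \<Omega> I X W \<longrightarrow>
        (\<forall>t\<in>I. ((\<lambda>s. g (X s) (V s) (W s)) has_real_derivative
            g (X t) (D I X V t) (W t) + g (X t) (V t) (D I X W t)) (at t)))"

definition levi_civita :: "plane set \<Rightarrow> riem_metric \<Rightarrow> connection \<Rightarrow> bool" where
  "levi_civita \<Omega> g D \<longleftrightarrow> affine_connection \<Omega> D \<and> torsion_free \<Omega> D \<and> metric_compatible \<Omega> g D"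

definition newton_equation ::
  "plane set \<Rightarrow> riem_metric \<Rightarrow> connection \<Rightarrow> ((plane \<Rightarrow> plane) \<Rightarrow> real) \<Rightarrow>
   real set \<Rightarrow> (real \<Rightarrow> plane \<Rightarrow> plane) \<Rightarrow> bool"
where
  "newton_equation \<Omega> g D F I X \<longleftrightarrow>
     (\<forall>t\<in>I. \<exists>G. has_gradient \<Omega> g F (X t) G \<and>
        (\<forall>x\<in>closure \<Omega>. D I X (velocity X) t x = - G x))"


section \<open>The Green--Naghdi metric and equations\<close>

definition gn_metric :: "plane set \<Rightarrow> (plane \<Rightarrow> real) \<Rightarrow> (plane \<Rightarrow> real) \<Rightarrow> riem_metric" where
  "gn_metric \<Omega> b \<rho>0 X V W =
     (let \<rho> = mass_density \<Omega> \<rho>0 X; \<xi> = eulerian \<Omega> X V; \<eta> = eulerian \<Omega> X W in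
      LINT x:\<Omega>|lborel.
          \<rho> x * (\<xi> x \<bullet> \<eta> x)
        + 1/3 * \<rho> x ^ 3 * divg \<xi> x * divg \<eta> x
        + 1/2 * \<rho> x ^ 2 * divg \<xi> x * (\<eta> x \<bullet> grad b x)
        + 1/2 * \<rho> x ^ 2 * divg \<eta> x * (\<xi> x \<bullet> grad b x)
        + \<rho> x * (\<xi> x \<bullet> grad b x) * (\<eta> x \<bullet> grad b x))"

definition gn_operator ::
  "(plane \<Rightarrow> real) \<Rightarrow> (plane \<Rightarrow> real) \<Rightarrow> (plane \<Rightarrow> plane) \<Rightarrow> plane \<Rightarrow> plane" where
  "gn_operator b \<rho> \<eta> x =
       \<eta> x
     - (1/3) *\<^sub>R (grad (\<lambda>y. \<rho> y ^ 3 * divg \<eta> y) x /\<^sub>R \<rho> x)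
     - (1/2) *\<^sub>R (grad (\<lambda>y. \<rho> y ^ 2 * (\<eta> y \<bullet> grad b y)) x /\<^sub>R \<rho> x)
     + (1/2 * \<rho> x * divg \<eta> x) *\<^sub>R grad b x
     + (\<eta> x \<bullet> grad b x) *\<^sub>R grad b x"

text \<open>Invertibility of \<open>A\<^sub>\<rho>\<close> with domain the smooth fields tangent to the boundary. Note that
  \<open>A\<^sub>\<rho> \<eta>\<close> need not be tangent to the boundary, so the target is all smooth fields.\<close>
definition gn_operator_invertible :: "plane set \<Rightarrow> (plane \<Rightarrow> real) \<Rightarrow> (plane \<Rightarrow> real) \<Rightarrow> bool" where
  "gn_operator_invertible \<Omega> b \<rho> \<longleftrightarrow>
     (\<forall>w. smooth_upto (closure \<Omega>) w \<longrightarrow>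
        (\<exists>\<eta>. tangent_field \<Omega> \<eta> \<and> (\<forall>x\<in>\<Omega>. gn_operator b \<rho> \<eta> x = w x) \<and>
           (\<forall>\<zeta>. tangent_field \<Omega> \<zeta> \<and> (\<forall>x\<in>\<Omega>. gn_operator b \<rho> \<zeta> x = w x) \<longrightarrow>
              (\<forall>x\<in>closure \<Omega>. \<zeta> x = \<eta> x))))"

definition potential_energy ::
  "plane set \<Rightarrow> (plane \<Rightarrow> real) \<Rightarrow> (plane \<Rightarrow> real) \<Rightarrow> (plane \<Rightarrow> plane) \<Rightarrow> real" where
  "potential_energy \<Omega> b \<rho>0 X =
     (let \<rho> = mass_density \<Omega> \<rho>0 X in LINT x:\<Omega>|lborel. \<rho> x ^ 2 / 2 - \<rho> x * b x)"

text \<open>Classical solutions. With \<open>(jacobian u)\<^sub>i\<^sub>j = \<partial>\<^sub>j u\<^sub>i\<close>, the transposed Jacobian applied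
  to \<open>v\<close> has components \<open>\<Sum>i. (\<partial>\<^sub>j u\<^sub>i) v\<^sub>i\<close>.\<close>
definition green_naghdi ::
  "real \<Rightarrow> (plane \<Rightarrow> real) \<Rightarrow> plane set \<Rightarrow> real set \<Rightarrow> (real \<Rightarrow> plane \<Rightarrow> plane) \<Rightarrow>
   (real \<Rightarrow> plane \<Rightarrow> plane) \<Rightarrow> (real \<Rightarrow> plane \<Rightarrow> real) \<Rightarrow> bool"
where
  "green_naghdi \<epsilon> b \<Omega> I u v \<rho> \<longleftrightarrow>
     smooth_on (I \<times> \<Omega>) (\<lambda>(t, x). u t x) \<and> smooth_on (I \<times> \<Omega>) (\<lambda>(t, x). \<rho> t x) \<and>
     (\<forall>t\<in>I. \<forall>x\<in>\<Omega>.
        vector_derivative (\<lambda>s. v s x) (at t)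
          + jacobian (v t) (at x) *v u t x
          + transpose (jacobian (u t) (at x)) *v v t x
          + grad (\<lambda>y. 1 / \<epsilon>\<^sup>2 * (\<rho> t y - b y) - 1/2 * (norm (u t y))\<^sup>2
                     - 1/2 * (\<rho> t y * divg (u t) y + u t y \<bullet> grad b y)\<^sup>2) x = 0
        \<and> v t x = gn_operator b (\<rho> t) (u t) x
        \<and> vector_derivative (\<lambda>s. \<rho> s x) (at t) + divg (\<lambda>y. \<rho> t y *\<^sub>R u t y) x = 0)"

end

theory Submission
  imports Defs
begin

text \<open>
  Everything is done in Eulerian variables on the fixed domain. Along a smooth curve of
  diffeomorphisms, the density and the velocity extend smoothly across the boundary, locally in time,
  because the inverse of the flow does. The divergence theorem is only needed for fields tangent to
  the boundary; it turns the metric into \<open>\<integral>\<rho> \<langle>\<xi>, A\<^sub>\<rho> \<eta>\<rangle>\<close> and the differential of the potential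
  into \<open>\<integral>\<rho> \<langle>\<nabla>(\<rho> - b), \<xi>\<rangle>\<close>.

  For the dynamics, a solution \<open>X\<close> is varied by \<open>(id + s \<phi>) \<circ> X\<close>. Koszul's formula gives
  \<open>d/dt \<integral>\<rho> \<langle>v, \<phi>\<rangle> = - 1/\<epsilon>\<^sup>2 \<integral>\<rho> \<langle>\<nabla>(\<rho> - b), \<phi>\<rangle> + 1/2 d/ds (u\<^sub>s, u\<^sub>s)\<close>. Writing the kinetic
  energy density as a function of \<open>\<rho>\<close> and \<open>u\<close>, its derivative in \<open>\<rho>\<close> is
  \<open>H = 1/2 |u|\<^sup>2 + 1/2 (\<rho> div u + \<langle>u, \<nabla>b\<rangle>)\<^sup>2\<close>; with \<open>\<partial>\<^sub>s \<rho> = - div (\<rho> \<phi>)\<close> and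
  \<open>\<partial>\<^sub>s u = \<nabla>\<^sub>u \<phi> - \<nabla>\<^sub>\<phi> u\<close> the last term becomes
  \<open>\<integral>\<rho> \<langle>\<nabla>H, \<phi>\<rangle> + \<rho> \<langle>v, \<nabla>\<^sub>u \<phi> - \<nabla>\<^sub>\<phi> u\<rangle>\<close>. So the momentum equation holds tested against \<open>\<rho> \<phi>\<close>. No compactly
  supported test functions are needed: if \<open>E\<close> is the left-hand side of that equation and \<open>d\<close> a defining function of
  the domain, then \<open>\<phi> = d \<rho> E\<close> is an admissible test field, and \<open>d < 0\<close> inside forces \<open>E = 0\<close>.
\<close>

section \<open>Calculus of smooth functions on open sets\<close>

text \<open>The boundary shapes the proof. Smoothness is given on \<open>closure \<Omega>\<close>
  only, and derivatives are taken of total functions with arbitrary values elsewhere. Integrals are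
  therefore evaluated with extensions (\<open>R\<close>, \<open>w\<close>, \<open>\<beta>\<close>),
  continuous up to the boundary with all derivatives, and carried back by agreement on the open set
  \<open>\<Omega>\<close>. A test field has to generate diffeomorphisms of the domain, remove all
  boundary terms and give a signed integrand. The factor \<open>d\<close> serves all three purposes:
  it fixes the boundary, and for small \<open>s\<close> the map changes \<open>d\<close> by less
  than its own size, so interior points stay inside. Moreover the derivative of
  \<open>\<phi>\<close> along the velocity, which is tangent, vanishes on the boundary, so that the
  commutator of velocity and test field is admissible in the integration by parts. The factor
  \<open>\<rho>\<close> turns the weight into a square. The field is frozen at the time considered,
  although \<open>E\<close> contains a time derivative. The connection is given, so Koszul's formula
  is only required for the velocity and the test field. The same test fields show that every
  gradient of the potential solves the equation with \<open>gn_operator\<close>.\<close>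

lemma ck_on_has_derivative:
  "ck_on (Suc n) S f \<Longrightarrow> x \<in> S \<Longrightarrow> (f has_derivative frechet_derivative f (at x)) (at x)"
  by (simp add: frechet_derivative_works)

lemma ck_on_cong:
  assumes "open S" and "\<And>x. x \<in> S \<Longrightarrow> f x = g x" and "ck_on n S f"
  shows "ck_on n S g"
  using assms(2,3)
proof (induction n arbitrary: f g)
  case 0
  then show ?case by (simp cong: continuous_on_cong)
next
  case (Suc n)
  have g: "(g has_derivative frechet_derivative f (at x)) (at x)" if "x \<in> S" for x
    by (rule has_derivative_transform_within_open[OF ck_on_has_derivative[OF Suc.prems(2) that] assms(1) that])
      (rule Suc.prems(1))
  have "ck_on n S (\<lambda>x. frechet_derivative g (at x) v)" for v
  proof (rule Suc.IH)
    show "frechet_derivative f (at x) v = frechet_derivative g (at x) v" if "x \<in> S" for x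
      using frechet_derivative_at[OF g[OF that]] by simp
    show "ck_on n S (\<lambda>x. frechet_derivative f (at x) v)"
      using Suc.prems(2) by simp
  qed
  moreover have "g differentiable (at x)" if "x \<in> S" for x
    using g[OF that] by (rule differentiableI)
  ultimately show ?case by simp
qed

text \<open>Lets an induction on the order supply the derivative in explicit form. Most closure
  properties below follow this pattern: differentiate once and recognise the derivative as built
  from functions of order \<open>n\<close> by operations already treated.\<close>

lemma ck_on_SucI:
  assumes S: "open S" and f: "\<And>x. x \<in> S \<Longrightarrow> (f has_derivative f' x) (at x)"
    and f': "\<And>v. ck_on n S (\<lambda>x. f' x v)"
  shows "ck_on (Suc n) S f"
proof -
  have "ck_on n S (\<lambda>x. frechet_derivative f (at x) v)" for v
  proof (rule ck_on_cong[OF S _ f'])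
    show "f' x v = frechet_derivative f (at x) v" if "x \<in> S" for x
      using frechet_derivative_at[OF f[OF that]] by simp
  qed
  moreover have "f differentiable (at x)" if "x \<in> S" for x
    using f[OF that] by (rule differentiableI)
  ultimately show ?thesis by simp
qed

lemma ck_on_Suc_imp: "ck_on (Suc n) S f \<Longrightarrow> ck_on n S f"
proof (induction n arbitrary: f)
  case 0
  then show ?case
    by (auto intro!: continuous_at_imp_continuous_on differentiable_imp_continuous_within)
qed auto

lemma ck_on_subset: "ck_on n S f \<Longrightarrow> T \<subseteq> S \<Longrightarrow> ck_on n T f"
  by (induction n arbitrary: f) (auto intro: continuous_on_subset)

lemma ck_on_local:
  assumes "\<And>x. x \<in> S \<Longrightarrow> \<exists>T. open T \<and> x \<in> T \<and> ck_on n T f"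
  shows "ck_on n S f"
  using assms
proof (induction n arbitrary: f)
  case 0
  have "isCont f x" if "x \<in> S" for x
    using 0[OF that] by (auto simp: continuous_on_eq_continuous_at)
  then show ?case
    by (auto intro: continuous_at_imp_continuous_on)
next
  case (Suc n)
  have "\<exists>T. open T \<and> x \<in> T \<and> ck_on n T (\<lambda>x. frechet_derivative f (at x) v)" if "x \<in> S" for x v
    using Suc.prems[OF that] by auto
  moreover have "f differentiable (at x)" if "x \<in> S" for x
    using Suc.prems[OF that] by auto
  ultimately show ?case
    using Suc.IH by auto
qed

lemma ck_on_const: "ck_on n S (\<lambda>x. c)"
  by (induction n arbitrary: c) auto

lemma ck_on_bounded_linear:
  assumes S: "open S" and h: "bounded_linear h"
  shows "ck_on n S f \<Longrightarrow> ck_on n S (\<lambda>x. h (f x))"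
proof (induction n arbitrary: f)
  case 0
  then show ?case
    using bounded_linear.continuous_on[OF h] by auto
next
  case (Suc n)
  then have f: "\<And>v. ck_on n S (\<lambda>x. frechet_derivative f (at x) v)"
    by auto
  show ?case
    by (rule ck_on_SucI[OF S bounded_linear.has_derivative[OF h ck_on_has_derivative[OF Suc.prems]]])
      (intro Suc.IH f | assumption)+
qed

lemma ck_on_add:
  assumes S: "open S"
  shows "ck_on n S f \<Longrightarrow> ck_on n S g \<Longrightarrow> ck_on n S (\<lambda>x. f x + g x)"
proof (induction n arbitrary: f g)
  case 0
  then show ?case by (auto intro: continuous_intros)
next
  case (Suc n)
  then have fg: "\<And>v. ck_on n S (\<lambda>x. frechet_derivative f (at x) v)"
    "\<And>v. ck_on n S (\<lambda>x. frechet_derivative g (at x) v)"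
    by auto
  show ?case
    by (rule ck_on_SucI[OF S has_derivative_add[OF ck_on_has_derivative[OF Suc.prems(1)]
            ck_on_has_derivative[OF Suc.prems(2)]]])
      (intro Suc.IH fg | assumption)+
qed

lemma ck_on_bilinear:
  assumes S: "open S" and h: "bounded_bilinear h"
  shows "ck_on n S f \<Longrightarrow> ck_on n S g \<Longrightarrow> ck_on n S (\<lambda>x. h (f x) (g x))"
proof (induction n arbitrary: f g)
  case 0
  then show ?case
    using bounded_bilinear.continuous_on[OF h] by auto
next
  case (Suc n)
  have f: "ck_on n S f" "\<And>v. ck_on n S (\<lambda>x. frechet_derivative f (at x) v)"
    using ck_on_Suc_imp[OF Suc.prems(1)] Suc.prems(1) by auto
  have g: "ck_on n S g" "\<And>v. ck_on n S (\<lambda>x. frechet_derivative g (at x) v)"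
    using ck_on_Suc_imp[OF Suc.prems(2)] Suc.prems(2) by auto
  show ?case
    by (rule ck_on_SucI[OF S bounded_bilinear.FDERIV[OF h ck_on_has_derivative[OF Suc.prems(1)]
            ck_on_has_derivative[OF Suc.prems(2)]]])
      (intro ck_on_add[OF S] Suc.IH f g | assumption)+
qed

lemma ck_on_sum:
  assumes S: "open S"
  shows "(\<And>i. i \<in> A \<Longrightarrow> ck_on n S (f i)) \<Longrightarrow> ck_on n S (\<lambda>x. \<Sum>i\<in>A. f i x)"
proof (induction A rule: infinite_finite_induct)
  case (insert a A)
  then show ?case
    by (auto intro!: ck_on_add[OF S])
qed (auto simp: ck_on_const)

text \<open>The chain rule inserts the \<open>x\<close>-dependent vector
  \<open>frechet_derivative g (at x) v\<close> into the derivative of \<open>f\<close>, whereas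
  \<open>ck_on\<close> controls derivatives in fixed directions only. Expanding that vector in
  \<open>Basis\<close> leaves products of coefficients of order \<open>n\<close> with derivatives of
  \<open>f\<close> in basis directions, composed with \<open>g\<close>; the induction hypothesis
  applies to the latter.\<close>

lemma ck_on_compose:
  fixes f :: "'b::euclidean_space \<Rightarrow> 'c::real_normed_vector" and g :: "'a::euclidean_space \<Rightarrow> 'b"
  assumes S: "open S" and gS: "g ` S \<subseteq> T"
  shows "ck_on n T f \<Longrightarrow> ck_on n S g \<Longrightarrow> ck_on n S (\<lambda>x. f (g x))"
proof (induction n arbitrary: f)
  case 0
  then show ?case
    using continuous_on_compose2[of T f S g] gS by auto
next
  case (Suc n)
  note dg = ck_on_has_derivative[OF Suc.prems(2)]
  have df: "(f has_derivative frechet_derivative f (at (g x))) (at (g x))" if "x \<in> S" for x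
    using ck_on_has_derivative[OF Suc.prems(1)] that gS by auto
  have D: "((\<lambda>x. f (g x)) has_derivative
      (\<lambda>v. \<Sum>e\<in>Basis. (frechet_derivative g (at x) v \<bullet> e) *\<^sub>R frechet_derivative f (at (g x)) e)) (at x)"
    if "x \<in> S" for x
  proof -
    have lin: "linear (frechet_derivative f (at (g x)))"
      using df[OF that] has_derivative_linear by blast
    have rep: "frechet_derivative f (at (g x)) w = (\<Sum>e\<in>Basis. (w \<bullet> e) *\<^sub>R frechet_derivative f (at (g x)) e)" for w
    proof -
      have "frechet_derivative f (at (g x)) w = frechet_derivative f (at (g x)) (\<Sum>e\<in>Basis. (w \<bullet> e) *\<^sub>R e)"
        by (simp only: euclidean_representation)
      also have "\<dots> = (\<Sum>e\<in>Basis. frechet_derivative f (at (g x)) ((w \<bullet> e) *\<^sub>R e))"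
        by (rule linear_sum[OF lin])
      finally show ?thesis
        by (simp only: linear_cmul[OF lin])
    qed
    show ?thesis
      using has_derivative_compose[OF dg[OF that] df[OF that]] unfolding rep[of "frechet_derivative g (at x) _"] .
  qed
  show ?case
  proof (rule ck_on_SucI[OF S D])
    fix v
    have "ck_on n S (\<lambda>x. frechet_derivative g (at x) v \<bullet> e)" for e
      using Suc.prems(2) by (intro ck_on_bilinear[OF S bounded_bilinear_inner] ck_on_const) simp
    moreover have "ck_on n S (\<lambda>x. frechet_derivative f (at (g x)) e)" for e
      using Suc.IH[of "\<lambda>y. frechet_derivative f (at y) e"] Suc.prems(1) ck_on_Suc_imp[OF Suc.prems(2)] by simp
    ultimately show "ck_on n S (\<lambda>x. \<Sum>e\<in>Basis. (frechet_derivative g (at x) v \<bullet> e) *\<^sub>R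
        frechet_derivative f (at (g x)) e)"
      by (intro ck_on_sum[OF S] ck_on_bilinear[OF S bounded_bilinear_scaleR])
  qed
qed

lemma ck_on_inverse:
  fixes f :: "'a::euclidean_space \<Rightarrow> real"
  assumes S: "open S" and nz: "\<And>x. x \<in> S \<Longrightarrow> f x \<noteq> 0"
  shows "ck_on n S f \<Longrightarrow> ck_on n S (\<lambda>x. inverse (f x))"
proof (induction n)
  case 0
  then show ?case
    using nz by (auto intro!: continuous_intros)
next
  case (Suc n)
  show ?case
  proof (rule ck_on_SucI[OF S Deriv.has_derivative_inverse[OF nz ck_on_has_derivative[OF Suc.prems]]])
    fix v
    \<comment> \<open>The derivative of the reciprocal contains the reciprocal again, but only at
      the lower order that the induction hypothesis provides.\<close>
    have inv: "ck_on n S (\<lambda>x. inverse (f x))"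
      using Suc ck_on_Suc_imp by blast
    have "ck_on n S (\<lambda>x. frechet_derivative f (at x) v)"
      using Suc.prems by auto
    then show "ck_on n S (\<lambda>x. - (inverse (f x) * frechet_derivative f (at x) v * inverse (f x)))"
      by (intro ck_on_bounded_linear[OF S bounded_linear_minus[OF bounded_linear_ident]]
          ck_on_bilinear[OF S bounded_bilinear_mult] inv)
  qed
qed

lemma smooth_on_ck: "smooth_on S f \<Longrightarrow> ck_on n S f"
  by (simp add: smooth_on_def)

lemma smooth_on_has_derivative:
  "smooth_on S f \<Longrightarrow> x \<in> S \<Longrightarrow> (f has_derivative frechet_derivative f (at x)) (at x)"
  using ck_on_has_derivative smooth_on_ck by blast

lemma smooth_on_differentiable: "smooth_on S f \<Longrightarrow> x \<in> S \<Longrightarrow> f differentiable (at x)"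
  using smooth_on_has_derivative frechet_derivative_works by blast

lemma smooth_on_continuous: "smooth_on S f \<Longrightarrow> continuous_on S f"
  using smooth_on_ck[of S f 0] by simp

lemma smooth_on_frechet_derivative:
  "smooth_on S f \<Longrightarrow> smooth_on S (\<lambda>x. frechet_derivative f (at x) v)"
  unfolding smooth_on_def
proof
  fix n assume "\<forall>n. ck_on n S f"
  then have "ck_on (Suc n) S f" by blast
  then show "ck_on n S (\<lambda>x. frechet_derivative f (at x) v)" by simp
qed

lemma smooth_on_cong:
  "open S \<Longrightarrow> smooth_on S f \<Longrightarrow> (\<And>x. x \<in> S \<Longrightarrow> f x = g x) \<Longrightarrow> smooth_on S g"
  unfolding smooth_on_def using ck_on_cong by blast

lemma smooth_on_subset: "smooth_on S f \<Longrightarrow> T \<subseteq> S \<Longrightarrow> smooth_on T f"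
  unfolding smooth_on_def using ck_on_subset by blast

lemma smooth_on_local:
  "(\<And>x. x \<in> S \<Longrightarrow> \<exists>T. open T \<and> x \<in> T \<and> smooth_on T f) \<Longrightarrow> smooth_on S f"
  unfolding smooth_on_def by (intro allI ck_on_local) metis

lemma smooth_on_const: "smooth_on S (\<lambda>x. c)"
  by (simp add: smooth_on_def ck_on_const)

lemma smooth_on_bounded_linear:
  "bounded_linear h \<Longrightarrow> open S \<Longrightarrow> smooth_on S f \<Longrightarrow> smooth_on S (\<lambda>x. h (f x))"
  unfolding smooth_on_def by (blast intro: ck_on_bounded_linear)

lemma smooth_on_ident: "smooth_on S (\<lambda>x. x)"
proof -
  have "ck_on n S (\<lambda>x. x)" for n
    by (cases n) (auto simp: ck_on_const)
  then show ?thesis by (simp add: smooth_on_def)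
qed

lemma smooth_on_add: "open S \<Longrightarrow> smooth_on S f \<Longrightarrow> smooth_on S g \<Longrightarrow> smooth_on S (\<lambda>x. f x + g x)"
  unfolding smooth_on_def by (blast intro: ck_on_add)

lemma smooth_on_bilinear:
  "bounded_bilinear h \<Longrightarrow> open S \<Longrightarrow> smooth_on S f \<Longrightarrow> smooth_on S g \<Longrightarrow> smooth_on S (\<lambda>x. h (f x) (g x))"
  unfolding smooth_on_def by (blast intro: ck_on_bilinear)

lemma smooth_on_sum:
  "open S \<Longrightarrow> (\<And>i. i \<in> A \<Longrightarrow> smooth_on S (f i)) \<Longrightarrow> smooth_on S (\<lambda>x. \<Sum>i\<in>A. f i x)"
  by (simp add: smooth_on_def ck_on_sum)

lemma smooth_on_compose:
  "smooth_on T f \<Longrightarrow> open S \<Longrightarrow> smooth_on S g \<Longrightarrow> g ` S \<subseteq> T \<Longrightarrow> smooth_on S (\<lambda>x. f (g x))"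
  unfolding smooth_on_def by (intro allI) (rule ck_on_compose[of S g T], simp_all)

lemma smooth_on_inverse:
  "open S \<Longrightarrow> smooth_on S f \<Longrightarrow> (\<And>x. x \<in> S \<Longrightarrow> f x \<noteq> 0) \<Longrightarrow> smooth_on S (\<lambda>x. inverse (f x :: real))"
  unfolding smooth_on_def by (blast intro: ck_on_inverse)

lemmas smooth_on_minus = smooth_on_bounded_linear[OF bounded_linear_minus[OF bounded_linear_ident]]
lemmas smooth_on_scaleR = smooth_on_bilinear[OF bounded_bilinear_scaleR]
lemmas smooth_on_inner = smooth_on_bilinear[OF bounded_bilinear_inner]
lemmas smooth_on_mult = smooth_on_bilinear[OF bounded_bilinear_mult]
lemmas smooth_on_fst = smooth_on_bounded_linear[OF bounded_linear_fst]
lemmas smooth_on_snd = smooth_on_bounded_linear[OF bounded_linear_snd]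
lemmas smooth_on_vec_nth = smooth_on_bounded_linear[OF bounded_linear_vec_nth]

lemma smooth_on_diff:
  "open S \<Longrightarrow> smooth_on S f \<Longrightarrow> smooth_on S g \<Longrightarrow> smooth_on S (\<lambda>x. f x - g x)"
  using smooth_on_add[OF _ _ smooth_on_minus, of S f g] by simp

lemma smooth_on_divide:
  "open S \<Longrightarrow> smooth_on S f \<Longrightarrow> smooth_on S g \<Longrightarrow> (\<And>x. x \<in> S \<Longrightarrow> g x \<noteq> 0) \<Longrightarrow>
    smooth_on S (\<lambda>x. f x / g x :: real)"
  by (simp add: divide_inverse smooth_on_mult smooth_on_inverse)

lemma smooth_on_power:
  fixes f :: "_ \<Rightarrow> 'b::real_normed_algebra_1"
  assumes "open S" and "smooth_on S f"
  shows "smooth_on S (\<lambda>x. f x ^ n)"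
  by (induction n) (use assms in \<open>auto intro!: smooth_on_const smooth_on_mult\<close>)

lemma smooth_on_Pair:
  fixes f :: "_ \<Rightarrow> 'b::real_normed_vector" and g :: "_ \<Rightarrow> 'c::real_normed_vector"
  assumes "open S" and "smooth_on S f" and "smooth_on S g"
  shows "smooth_on S (\<lambda>x. (f x, g x))"
proof -
  have "bounded_linear (\<lambda>a :: 'b. (a, 0 :: 'c))" "bounded_linear (\<lambda>c :: 'c. (0 :: 'b, c))"
    by (auto intro: bounded_linear_Pair bounded_linear_zero bounded_linear_ident)
  then have "smooth_on S (\<lambda>x. (f x, 0 :: 'c) + (0 :: 'b, g x))"
    using assms by (intro smooth_on_add smooth_on_bounded_linear[of "\<lambda>a. (a, 0)"] smooth_on_bounded_linear[of "\<lambda>a. (0, a)"]) auto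
  then show ?thesis by simp
qed

lemma smooth_on_vec_lambda:
  fixes f :: "'i::finite \<Rightarrow> 'a::euclidean_space \<Rightarrow> real"
  assumes "open S" and "\<And>i. smooth_on S (f i)"
  shows "smooth_on S (\<lambda>x. \<chi> i. f i x)"
proof -
  have "smooth_on S (\<lambda>x. \<Sum>i\<in>UNIV. f i x *\<^sub>R (axis i 1 :: real ^ 'i))"
    using assms by (intro smooth_on_sum smooth_on_scaleR smooth_on_const) auto
  moreover have "(\<chi> i. f i x) = (\<Sum>i\<in>UNIV. f i x *\<^sub>R (axis i 1 :: real ^ 'i))" for x
    by (simp add: vec_eq_iff axis_def if_distrib cong: if_cong)
  ultimately show ?thesis by simp
qed

lemmas smooth_intros = smooth_on_const smooth_on_ident smooth_on_minus smooth_on_scaleR smooth_on_inner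
  smooth_on_mult smooth_on_fst smooth_on_snd smooth_on_vec_nth smooth_on_add smooth_on_diff
  smooth_on_power smooth_on_Pair smooth_on_vec_lambda smooth_on_sum

text \<open>\<open>frechet_derivative\<close> is a choice among all derivatives at the point, and
  which maps are derivatives depends only on the values nearby. The equality therefore also covers
  points without a derivative. This and its companions carry formulas from the smooth extensions to
  the given functions.\<close>

lemma frechet_derivative_cong_open:
  assumes "open S" and "x \<in> S" and "\<And>y. y \<in> S \<Longrightarrow> f y = g y"
  shows "frechet_derivative f (at x) = frechet_derivative g (at x)"
proof -
  have "(f has_derivative h) (at x) \<longleftrightarrow> (g has_derivative h) (at x)" for h
    using assms by (metis has_derivative_transform_within_open)
  then show ?thesis
    unfolding frechet_derivative_def by simp
qed

lemma vector_derivative_cong_open: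
  assumes "open S" and "x \<in> S" and "\<And>y. y \<in> S \<Longrightarrow> f y = g y"
  shows "vector_derivative f (at x) = vector_derivative g (at x)"
proof -
  have "(f has_vector_derivative h) (at x) \<longleftrightarrow> (g has_vector_derivative h) (at x)" for h
    using assms by (metis has_vector_derivative_transform_within_open)
  then show ?thesis
    unfolding vector_derivative_def by simp
qed

lemma grad_cong_open:
  "open S \<Longrightarrow> x \<in> S \<Longrightarrow> (\<And>y. y \<in> S \<Longrightarrow> f y = g y) \<Longrightarrow> grad f x = grad g x"
  unfolding grad_def using frechet_derivative_cong_open by metis

lemma jacobian_cong_open:
  "open S \<Longrightarrow> x \<in> S \<Longrightarrow> (\<And>y. y \<in> S \<Longrightarrow> f y = g y) \<Longrightarrow> jacobian f (at x) = jacobian g (at x)"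
  unfolding jacobian_def using frechet_derivative_cong_open by metis

lemma divg_cong_open:
  "open S \<Longrightarrow> x \<in> S \<Longrightarrow> (\<And>y. y \<in> S \<Longrightarrow> f y = g y) \<Longrightarrow> divg f x = divg g x"
  unfolding divg_def using jacobian_cong_open by metis

section \<open>Partial derivatives of functions of time and space\<close>

lemma smooth_on_slice_derivative:
  assumes f: "smooth_on S f" and ax: "(a, x) \<in> S"
  shows "((\<lambda>y. f (a, y)) has_derivative (\<lambda>v. frechet_derivative f (at (a, x)) (0, v))) (at x)"
    and "((\<lambda>s. f (s, x)) has_derivative (\<lambda>s. frechet_derivative f (at (a, x)) (s, 0))) (at a)"
proof -
  note d = smooth_on_has_derivative[OF f ax]
  have "((\<lambda>y. (a, y)) has_derivative (\<lambda>v. (0, v))) (at x)"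
    by (auto intro!: derivative_eq_intros)
  from has_derivative_compose[OF this d]
  show "((\<lambda>y. f (a, y)) has_derivative (\<lambda>v. frechet_derivative f (at (a, x)) (0, v))) (at x)" .
  have "((\<lambda>s. (s, x)) has_derivative (\<lambda>s. (s, 0))) (at a)"
    by (auto intro!: derivative_eq_intros)
  from has_derivative_compose[OF this d]
  show "((\<lambda>s. f (s, x)) has_derivative (\<lambda>s. frechet_derivative f (at (a, x)) (s, 0))) (at a)" .
qed

lemma has_derivative_imp_has_vector_derivative:
  fixes f :: "real \<Rightarrow> 'a::real_normed_vector"
  assumes "(f has_derivative D) (at t)"
  shows "(f has_vector_derivative D 1) (at t)"
proof -
  have "linear D" using assms by (rule has_derivative_linear)
  then have "D = (\<lambda>s. s *\<^sub>R D 1)"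
    by (metis mult.right_neutral linear_cmul real_scaleR_def)
  then show ?thesis
    using assms by (simp add: has_vector_derivative_def)
qed

lemma smooth_on_has_vector_derivative_slice:
  assumes "smooth_on S f" and "(t, x) \<in> S"
  shows "((\<lambda>s. f (s, x)) has_vector_derivative frechet_derivative f (at (t, x)) (1, 0)) (at t)"
  using has_derivative_imp_has_vector_derivative[OF smooth_on_slice_derivative(2)[OF assms]] .

lemma smooth_on_frechet_slice:
  "smooth_on S (\<lambda>p. f (fst p) (snd p)) \<Longrightarrow> (t, x) \<in> S \<Longrightarrow>
    frechet_derivative (f t) (at x) v = frechet_derivative (\<lambda>p. f (fst p) (snd p)) (at (t, x)) (0, v)"
  using fun_cong[OF frechet_derivative_at[OF smooth_on_slice_derivative(1)[of S "\<lambda>p. f (fst p) (snd p)" t x]], of v]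
  by simp

lemma smooth_on_vector_derivative_slice:
  "smooth_on S (\<lambda>p. f (fst p) (snd p)) \<Longrightarrow> (t, x) \<in> S \<Longrightarrow>
    vector_derivative (\<lambda>s. f s x) (at t) = frechet_derivative (\<lambda>p. f (fst p) (snd p)) (at (t, x)) (1, 0)"
  using vector_derivative_at[OF smooth_on_has_vector_derivative_slice[of S "\<lambda>p. f (fst p) (snd p)" t x]]
  by simp

lemma smooth_on_has_vector_derivative:
  assumes "smooth_on S (\<lambda>p. f (fst p) (snd p))" and "(t, x) \<in> S"
  shows "((\<lambda>s. f s x) has_vector_derivative vector_derivative (\<lambda>s. f s x) (at t)) (at t)"
  using smooth_on_has_vector_derivative_slice[OF assms] smooth_on_vector_derivative_slice[OF assms]
  by simp

lemma smooth_on_slice: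
  assumes f: "smooth_on (T \<times> U) (\<lambda>p. f (fst p) (snd p))" and "t \<in> T" and U: "open U"
  shows "smooth_on U (f t)"
proof -
  have "smooth_on U (\<lambda>x. (t, x))"
    by (intro smooth_intros U)
  from smooth_on_compose[OF f U this] show ?thesis
    using assms(2) by auto
qed

text \<open>A spatial derivative of a slice is the derivative of the joint function in the direction
  \<open>(0, v)\<close>, so joint smoothness in time and space survives.\<close>

lemma smooth_on_frechet_param:
  assumes T: "open T" and U: "open U" and f: "smooth_on (T \<times> U) (\<lambda>p. f (fst p) (snd p))"
  shows "smooth_on (T \<times> U) (\<lambda>p. frechet_derivative (f (fst p)) (at (snd p)) v)"
  by (rule smooth_on_cong[OF open_Times[OF T U] smooth_on_frechet_derivative[OF f, of "(0, v)"]])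
    (use smooth_on_frechet_slice[OF f] in auto)

lemma smooth_on_time_derivative:
  assumes T: "open T" and U: "open U" and f: "smooth_on (T \<times> U) (\<lambda>p. f (fst p) (snd p))"
  shows "smooth_on (T \<times> U) (\<lambda>p. vector_derivative (\<lambda>s. f s (snd p)) (at (fst p)))"
  by (rule smooth_on_cong[OF open_Times[OF T U] smooth_on_frechet_derivative[OF f, of "(1, 0)"]])
    (use smooth_on_vector_derivative_slice[OF f] in auto)

lemma frechet_derivative_bounded_linear:
  assumes "bounded_linear h" and "f differentiable (at x)"
  shows "frechet_derivative (\<lambda>x. h (f x)) (at x) v = h (frechet_derivative f (at x) v)"
  using frechet_derivative_at[OF bounded_linear.has_derivative[OF assms(1)
        assms(2)[unfolded frechet_derivative_works]]] by (metis)

section \<open>Symmetry of second derivatives\<close>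

lemma second_difference_mvt:
  fixes f :: "'a::euclidean_space \<Rightarrow> real"
  assumes S: "open S" and f: "smooth_on S f" and h: "h > 0"
    and sub: "\<And>s t. s \<in> {0..h} \<Longrightarrow> t \<in> {0..h} \<Longrightarrow> x + s *\<^sub>R v + t *\<^sub>R w \<in> S"
  obtains s t where "s \<in> {0..h}" "t \<in> {0..h}"
    "f (x + h *\<^sub>R v + h *\<^sub>R w) - f (x + h *\<^sub>R v) - f (x + h *\<^sub>R w) + f x =
      h * h * frechet_derivative (\<lambda>x. frechet_derivative f (at x) v) (at (x + s *\<^sub>R v + t *\<^sub>R w)) w"
proof -
  have line: "((\<lambda>s. F (y + s *\<^sub>R u)) has_real_derivative frechet_derivative F (at (y + s *\<^sub>R u)) u) (at s)"
    if "smooth_on S F" "y + s *\<^sub>R u \<in> S" for F :: "'a \<Rightarrow> real" and y u s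
  proof -
    have "((\<lambda>s. y + s *\<^sub>R u) has_derivative (\<lambda>s. s *\<^sub>R u)) (at s)"
      by (auto intro!: derivative_eq_intros)
    from has_derivative_imp_has_vector_derivative[OF has_derivative_compose[OF this smooth_on_has_derivative[OF that]]]
    show ?thesis by (simp add: has_real_derivative_iff_has_vector_derivative)
  qed
  \<comment> \<open>The second difference is a first difference in \<open>v\<close> of the increment
    of \<open>f\<close> in direction \<open>w\<close>. One mean value step in each direction then
    produces the mixed derivative.\<close>
  define g where "g s = f (x + h *\<^sub>R w + s *\<^sub>R v) - f (x + s *\<^sub>R v)" for s
  have swap: "x + t *\<^sub>R w + s *\<^sub>R v = x + s *\<^sub>R v + t *\<^sub>R w" for s t
    by simp
  have g': "(g has_real_derivative frechet_derivative f (at (x + s *\<^sub>R v + h *\<^sub>R w)) v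
      - frechet_derivative f (at (x + s *\<^sub>R v)) v) (at s)" if "0 \<le> s" "s \<le> h" for s
  proof -
    have "x + h *\<^sub>R w + s *\<^sub>R v \<in> S" "x + s *\<^sub>R v \<in> S"
      using sub[of s h] sub[of s 0] that h by (auto simp: swap)
    from DERIV_diff[OF line[OF f this(1)] line[OF f this(2)]] show ?thesis
      unfolding g_def swap .
  qed
  obtain s where s: "0 < s" "s < h" "g h - g 0 = (h - 0) * (frechet_derivative f (at (x + s *\<^sub>R v + h *\<^sub>R w)) v
      - frechet_derivative f (at (x + s *\<^sub>R v)) v)"
    using MVT2[OF h g'] by blast
  have k': "((\<lambda>t. frechet_derivative f (at (x + s *\<^sub>R v + t *\<^sub>R w)) v) has_real_derivative
      frechet_derivative (\<lambda>x. frechet_derivative f (at x) v) (at (x + s *\<^sub>R v + t *\<^sub>R w)) w) (at t)"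
    if "0 \<le> t" "t \<le> h" for t
    by (rule line[OF smooth_on_frechet_derivative[OF f]]) (use sub[of s t] s that in auto)
  obtain t where t: "0 < t" "t < h" "frechet_derivative f (at (x + s *\<^sub>R v + h *\<^sub>R w)) v
      - frechet_derivative f (at (x + s *\<^sub>R v + 0 *\<^sub>R w)) v = (h - 0) *
      frechet_derivative (\<lambda>x. frechet_derivative f (at x) v) (at (x + s *\<^sub>R v + t *\<^sub>R w)) w"
    using MVT2[OF h k'] by blast
  show ?thesis
  proof (rule that)
    show "s \<in> {0..h}" "t \<in> {0..h}" using s t by auto
    show "f (x + h *\<^sub>R v + h *\<^sub>R w) - f (x + h *\<^sub>R v) - f (x + h *\<^sub>R w) + f x =
      h * h * frechet_derivative (\<lambda>x. frechet_derivative f (at x) v) (at (x + s *\<^sub>R v + t *\<^sub>R w)) w"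
      using s(3) t(3) unfolding g_def swap by (simp add: algebra_simps)
  qed
qed

text \<open>The second difference over the parallelogram spanned by \<open>h\<close> times
  \<open>v\<close> and \<open>h\<close> times \<open>w\<close> does not change when \<open>v\<close>
  and \<open>w\<close> are exchanged. It equals \<open>h * h\<close> times either mixed derivative,
  each at some point of the parallelogram, and continuity at \<open>x\<close> makes the two values
  agree up to any \<open>e\<close>.\<close>

lemma symmetric_frechet_derivative_real:
  fixes f :: "'a::euclidean_space \<Rightarrow> real"
  assumes S: "open S" and f: "smooth_on S f" and x: "x \<in> S"
  shows "frechet_derivative (\<lambda>x. frechet_derivative f (at x) v) (at x) w =
    frechet_derivative (\<lambda>x. frechet_derivative f (at x) w) (at x) v"
proof -
  let ?A = "\<lambda>y. frechet_derivative (\<lambda>x. frechet_derivative f (at x) v) (at y) w"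
  let ?B = "\<lambda>y. frechet_derivative (\<lambda>x. frechet_derivative f (at x) w) (at y) v"
  have cont: "isCont ?A x" "isCont ?B x"
    using smooth_on_continuous[OF smooth_on_frechet_derivative[OF smooth_on_frechet_derivative[OF f]]] S x
    by (auto simp: continuous_on_eq_continuous_at)
  have "\<bar>?A x - ?B x\<bar> \<le> e" if "e > 0" for e
  proof -
    have "\<forall>\<^sub>F y in nhds x. y \<in> S \<and> dist (?A y) (?A x) < e/2 \<and> dist (?B y) (?B x) < e/2"
      using that
      by (intro eventually_conj eventually_nhds_in_open[OF S x]
          tendstoD[OF tendsto_at_iff_tendsto_nhds[of ?A, THEN iffD1, OF cont(1)[unfolded isCont_def]]]
          tendstoD[OF tendsto_at_iff_tendsto_nhds[of ?B, THEN iffD1, OF cont(2)[unfolded isCont_def]]]) simp_all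
    then obtain r where r: "r > 0" "\<And>y. dist y x < r \<Longrightarrow> y \<in> S \<and> dist (?A y) (?A x) < e/2 \<and> dist (?B y) (?B x) < e/2"
      unfolding eventually_nhds_metric by blast
    \<comment> \<open>Every point of the parallelogram then lies within \<open>r / 2\<close> of
      \<open>x\<close>. The summand 1 covers the case that both vectors vanish.\<close>
    define h where "h = r / (2 * (norm v + norm w + 1))"
    have h: "h > 0" using r(1) by (auto simp: h_def intro!: divide_pos_pos add_nonneg_pos)
    have near: "dist (x + s *\<^sub>R a + t *\<^sub>R c) x < r"
      if "s \<in> {0..h}" "t \<in> {0..h}" "norm a + norm c = norm v + norm w" for s t a c
    proof -
      have "norm (s *\<^sub>R a + t *\<^sub>R c) \<le> s * norm a + t * norm c"
        using that norm_triangle_ineq[of "s *\<^sub>R a" "t *\<^sub>R c"] by auto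
      also have "\<dots> \<le> h * norm a + h * norm c"
        using that by (intro add_mono mult_right_mono) auto
      also have "\<dots> = h * (norm v + norm w)" using that(3) by (simp add: distrib_left[symmetric])
      also have "\<dots> \<le> h * (norm v + norm w + 1)" using h by (intro mult_left_mono) auto
      also have "\<dots> = r / 2"
      proof -
        have "norm v + norm w + 1 > 0" by (intro add_nonneg_pos) auto
        then show ?thesis by (simp add: h_def field_simps)
      qed
      also have "\<dots> < r" using r(1) by simp
      finally show ?thesis by (simp add: dist_norm algebra_simps)
    qed
    obtain s1 t1 where 1: "s1 \<in> {0..h}" "t1 \<in> {0..h}"
      "f (x + h *\<^sub>R v + h *\<^sub>R w) - f (x + h *\<^sub>R v) - f (x + h *\<^sub>R w) + f x = h * h * ?A (x + s1 *\<^sub>R v + t1 *\<^sub>R w)"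
      using second_difference_mvt[OF S f h, of x v w] r(2) near by (metis (no_types, lifting))
    obtain s2 t2 where 2: "s2 \<in> {0..h}" "t2 \<in> {0..h}"
      "f (x + h *\<^sub>R w + h *\<^sub>R v) - f (x + h *\<^sub>R w) - f (x + h *\<^sub>R v) + f x = h * h * ?B (x + s2 *\<^sub>R w + t2 *\<^sub>R v)"
      using second_difference_mvt[OF S f h, of x w v] r(2) near[of _ _ w v] by (metis (no_types, lifting) add.commute)
    have "h * h * ?A (x + s1 *\<^sub>R v + t1 *\<^sub>R w) = h * h * ?B (x + s2 *\<^sub>R w + t2 *\<^sub>R v)"
      unfolding 1(3)[symmetric] 2(3)[symmetric] by (simp add: algebra_simps)
    then have "?A (x + s1 *\<^sub>R v + t1 *\<^sub>R w) = ?B (x + s2 *\<^sub>R w + t2 *\<^sub>R v)"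
      using h by simp
    moreover have "dist (?A (x + s1 *\<^sub>R v + t1 *\<^sub>R w)) (?A x) < e/2" "dist (?B (x + s2 *\<^sub>R w + t2 *\<^sub>R v)) (?B x) < e/2"
      using r(2) near 1 2 by (auto simp: add.commute[of "norm w"])
    ultimately show ?thesis unfolding dist_real_def by linarith
  qed
  then show ?thesis
    by (metis abs_le_zero_iff field_le_epsilon add_0 eq_iff_diff_eq_0)
qed

lemma symmetric_frechet_derivative:
  fixes f :: "'a::euclidean_space \<Rightarrow> 'b::real_inner"
  assumes S: "open S" and f: "smooth_on S f" and x: "x \<in> S"
  shows "frechet_derivative (\<lambda>x. frechet_derivative f (at x) v) (at x) w =
    frechet_derivative (\<lambda>x. frechet_derivative f (at x) w) (at x) v"
proof -
  have "frechet_derivative (\<lambda>x. frechet_derivative f (at x) v) (at x) w \<bullet> c =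
    frechet_derivative (\<lambda>x. frechet_derivative f (at x) w) (at x) v \<bullet> c" for c
  proof -
    have bl: "bounded_linear (\<lambda>z :: 'b. z \<bullet> c)" by (rule bounded_linear_inner_left)
    have D: "frechet_derivative (\<lambda>x. frechet_derivative f (at x) v) (at x) w \<bullet> c =
      frechet_derivative (\<lambda>x. frechet_derivative (\<lambda>x. f x \<bullet> c) (at x) v) (at x) w" for v w
    proof -
      have "frechet_derivative (\<lambda>x. frechet_derivative f (at x) v) (at x) w \<bullet> c =
        frechet_derivative (\<lambda>x. frechet_derivative f (at x) v \<bullet> c) (at x) w"
        using frechet_derivative_bounded_linear[OF bl smooth_on_differentiable[OF smooth_on_frechet_derivative[OF f] x]]
        by metis
      also have "\<dots> = frechet_derivative (\<lambda>x. frechet_derivative (\<lambda>x. f x \<bullet> c) (at x) v) (at x) w"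
        by (rule fun_cong[OF frechet_derivative_cong_open[OF S x]])
          (metis frechet_derivative_bounded_linear[OF bl smooth_on_differentiable[OF f]])
      finally show ?thesis .
    qed
    show ?thesis
      unfolding D by (rule symmetric_frechet_derivative_real[OF S _ x])
        (rule smooth_on_bounded_linear[OF bl S f])
  qed
  then show ?thesis
    by (rule vector_eq_rdot[THEN iffD1, OF allI])
qed

text \<open>Symmetry of second derivatives of the joint function in the directions
  \<open>(1, 0)\<close> and \<open>(0, v)\<close>. It serves to differentiate divergences and
  Jacobians in time.\<close>

lemma frechet_derivative_time_derivative:
  fixes f :: "real \<Rightarrow> 'a::euclidean_space \<Rightarrow> 'b::real_inner"
  assumes T: "open T" and U: "open U" and f: "smooth_on (T \<times> U) (\<lambda>p. f (fst p) (snd p))"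
    and t: "t \<in> T" and x: "x \<in> U"
  shows "((\<lambda>s. frechet_derivative (f s) (at x) v) has_vector_derivative
    frechet_derivative (\<lambda>y. vector_derivative (\<lambda>s. f s y) (at t)) (at x) v) (at t)"
proof -
  let ?F = "\<lambda>p. f (fst p) (snd p)"
  have O: "open (T \<times> U)" and tx: "(t, x) \<in> T \<times> U"
    using T U t x by (auto intro: open_Times)
  have "frechet_derivative (\<lambda>y. vector_derivative (\<lambda>s. f s y) (at t)) (at x) v =
      frechet_derivative (\<lambda>y. frechet_derivative ?F (at (t, y)) (1, 0)) (at x) v"
    by (rule fun_cong[OF frechet_derivative_cong_open[OF U x]])
      (use smooth_on_vector_derivative_slice[OF f] t in auto)
  also have "\<dots> = frechet_derivative (\<lambda>p. frechet_derivative ?F (at p) (1, 0)) (at (t, x)) (0, v)"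
    by (rule fun_cong[OF frechet_derivative_at[OF smooth_on_slice_derivative(1)[OF smooth_on_frechet_derivative[OF f] tx]],
        symmetric])
  also have "\<dots> = frechet_derivative (\<lambda>p. frechet_derivative ?F (at p) (0, v)) (at (t, x)) (1, 0)"
    by (rule symmetric_frechet_derivative[OF O f tx])
  finally have eq: "frechet_derivative (\<lambda>y. vector_derivative (\<lambda>s. f s y) (at t)) (at x) v = \<dots>" .
  have "((\<lambda>s. frechet_derivative ?F (at (s, x)) (0, v)) has_vector_derivative \<dots>) (at t)"
    by (rule smooth_on_has_vector_derivative_slice[OF smooth_on_frechet_derivative[OF f] tx])
  then have "((\<lambda>s. frechet_derivative (f s) (at x) v) has_vector_derivative
      frechet_derivative (\<lambda>p. frechet_derivative ?F (at p) (0, v)) (at (t, x)) (1, 0)) (at t)"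
    by (rule has_vector_derivative_transform_within_open[OF _ T t])
      (use smooth_on_frechet_slice[OF f] x in auto)
  then show ?thesis unfolding eq .
qed

section \<open>Smoothness up to the boundary and product neighbourhoods\<close>

lemma smooth_upto_on: "open U \<Longrightarrow> S \<subseteq> U \<Longrightarrow> smooth_on U f \<Longrightarrow> smooth_upto S f"
  unfolding smooth_upto_def by blast

lemma smooth_upto_UNIV: "smooth_on UNIV f \<Longrightarrow> smooth_upto S f"
  by (rule smooth_upto_on[of UNIV]) auto

lemma smooth_upto_cong: "smooth_upto S f \<Longrightarrow> (\<And>x. x \<in> S \<Longrightarrow> f x = g x) \<Longrightarrow> smooth_upto S g"
  unfolding smooth_upto_def by metis

lemma smooth_upto_compose:
  assumes "smooth_upto T f" and "smooth_upto S g" and gS: "g ` S \<subseteq> T"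
  shows "smooth_upto S (\<lambda>x. f (g x))"
proof -
  obtain V f' where f': "open V" "T \<subseteq> V" "smooth_on V f'" "\<And>x. x \<in> T \<Longrightarrow> f' x = f x"
    using assms(1) unfolding smooth_upto_def by blast
  obtain U g' where g': "open U" "S \<subseteq> U" "smooth_on U g'" "\<And>x. x \<in> S \<Longrightarrow> g' x = g x"
    using assms(2) unfolding smooth_upto_def by blast
  define W where "W = U \<inter> g' -` V"
  have W: "open W"
    unfolding W_def by (rule continuous_open_preimage[OF smooth_on_continuous[OF g'(3)] g'(1) f'(1)])
  moreover have "S \<subseteq> W" using g'(2,4) gS f'(2) by (force simp: W_def)
  moreover have "smooth_on W (\<lambda>x. f' (g' x))"
    by (rule smooth_on_compose[OF f'(3) W smooth_on_subset[OF g'(3)]]) (auto simp: W_def)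
  moreover have "f' (g' x) = f (g x)" if "x \<in> S" for x
    using that g'(4) f'(4) gS by auto
  ultimately show ?thesis unfolding smooth_upto_def by blast
qed

lemma smooth_upto_Pair:
  assumes "smooth_upto S f" and "smooth_upto S g"
  shows "smooth_upto S (\<lambda>x. (f x, g x))"
proof -
  obtain V f' where f': "open V" "S \<subseteq> V" "smooth_on V f'" "\<And>x. x \<in> S \<Longrightarrow> f' x = f x"
    using assms(1) unfolding smooth_upto_def by blast
  obtain U g' where g': "open U" "S \<subseteq> U" "smooth_on U g'" "\<And>x. x \<in> S \<Longrightarrow> g' x = g x"
    using assms(2) unfolding smooth_upto_def by blast
  have "smooth_on (U \<inter> V) (\<lambda>x. (f' x, g' x))"
    by (intro smooth_on_Pair open_Int f' g' smooth_on_subset[OF f'(3)] smooth_on_subset[OF g'(3)]) auto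
  then show ?thesis
    using f' g' by (intro smooth_upto_def[THEN iffD2] exI[of _ "U \<inter> V"] exI[of _ "\<lambda>x. (f' x, g' x)"]) auto
qed

lemma smooth_upto_compose2:
  assumes "smooth_on UNIV (\<lambda>p. h (fst p) (snd p))" and "smooth_upto S f" and "smooth_upto S g"
  shows "smooth_upto S (\<lambda>x. h (f x) (g x))"
  using smooth_upto_compose[OF smooth_upto_UNIV[OF assms(1)] smooth_upto_Pair[OF assms(2,3)], of UNIV]
  by simp

lemma smooth_upto_add:
  fixes f g :: "_ \<Rightarrow> 'b::euclidean_space"
  shows "smooth_upto S f \<Longrightarrow> smooth_upto S g \<Longrightarrow> smooth_upto S (\<lambda>x. f x + g x)"
  by (rule smooth_upto_compose2) (intro smooth_intros open_UNIV)

lemma smooth_upto_scaleR: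
  fixes g :: "_ \<Rightarrow> 'b::euclidean_space"
  shows "smooth_upto S f \<Longrightarrow> smooth_upto S g \<Longrightarrow> smooth_upto S (\<lambda>x. f x *\<^sub>R g x)"
  by (rule smooth_upto_compose2) (intro smooth_intros open_UNIV)

lemma smooth_upto_fst: "smooth_upto S fst"
  by (intro smooth_upto_UNIV smooth_on_fst open_UNIV smooth_on_ident)

lemma smooth_upto_snd: "smooth_upto S snd"
  by (intro smooth_upto_UNIV smooth_on_snd open_UNIV smooth_on_ident)

lemma smooth_upto_const: "smooth_upto S (\<lambda>x. c)"
  by (intro smooth_upto_UNIV smooth_on_const)

lemma open_tube:
  fixes K :: "'a::metric_space set"
  assumes K: "compact K" and W: "open W" and sub: "{t0} \<times> K \<subseteq> W"
  obtains e U where "e > (0::real)" "open U" "K \<subseteq> U" "ball t0 e \<times> U \<subseteq> W"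
proof -
  have "\<exists>T U. open T \<and> open U \<and> t0 \<in> T \<and> x \<in> U \<and> T \<times> U \<subseteq> W" if "x \<in> K" for x
  proof -
    have "(t0, x) \<in> W" using sub that by auto
    then obtain T U where "open T" "open U" "(t0, x) \<in> T \<times> U" "T \<times> U \<subseteq> W"
      using open_prod_elim[OF W] by metis
    then show ?thesis by (intro exI[of _ T] exI[of _ U]) simp
  qed
  then obtain T U where TU: "\<And>x. x \<in> K \<Longrightarrow> open (T x) \<and> open (U x) \<and> t0 \<in> T x \<and> x \<in> U x \<and> T x \<times> U x \<subseteq> W"
    by metis
  obtain C where C: "C \<subseteq> K" "finite C" "K \<subseteq> (\<Union>x\<in>C. U x)"
    using compactE_image[OF K, of K U] TU by blast
  have "open (\<Inter>x\<in>C. T x)" "t0 \<in> (\<Inter>x\<in>C. T x)"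
    using C TU by (auto intro!: open_INT)
  then obtain e where e: "e > 0" "ball t0 e \<subseteq> (\<Inter>x\<in>C. T x)"
    by (meson open_contains_ball)
  show ?thesis
  proof
    show "open (\<Union>x\<in>C. U x)" using C TU by auto
    show "ball t0 e \<times> (\<Union>x\<in>C. U x) \<subseteq> W"
      using e(2) TU C(1) by fast
  qed (use e C in auto)
qed

text \<open>The neighbourhood provided by \<open>smooth_upto\<close> need not be a product.
  Shrinking it to one, locally in time, gives all slices a common open domain, which time
  derivatives and differentiation under the integral require.\<close>

lemma smooth_upto_tube:
  fixes f :: "real \<times> 'a::euclidean_space \<Rightarrow> 'b::real_normed_vector"
  assumes K: "compact K" and I: "open I" "t0 \<in> I" and f: "smooth_upto (I \<times> K) f"
  obtains e U g where "e > 0" "ball t0 e \<subseteq> I" "open U" "K \<subseteq> U"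
    "smooth_on (ball t0 e \<times> U) (\<lambda>p. g (fst p) (snd p))"
    "\<And>t x. t \<in> ball t0 e \<Longrightarrow> x \<in> K \<Longrightarrow> g t x = f (t, x)"
proof -
  obtain W g where W: "open W" "I \<times> K \<subseteq> W" "smooth_on W g" "\<And>p. p \<in> I \<times> K \<Longrightarrow> g p = f p"
    using f unfolding smooth_upto_def by blast
  obtain e U where eU: "e > 0" "open U" "K \<subseteq> U" "ball t0 e \<times> U \<subseteq> W"
    using open_tube[OF K W(1), of t0] W(2) I by blast
  obtain r where r: "r > 0" "ball t0 r \<subseteq> I"
    using I open_contains_ball by blast
  have sub: "ball t0 (min e r) \<subseteq> ball t0 e" "ball t0 (min e r) \<subseteq> I"
    using r(2) by auto
  show ?thesis
  proof (rule that[of "min e r" U "\<lambda>t x. g (t, x)"])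
    show "smooth_on (ball t0 (min e r) \<times> U) (\<lambda>p. g (fst p, snd p))"
      using smooth_on_subset[OF W(3), of "ball t0 (min e r) \<times> U"] sub eU(4) by auto
    show "g (t, x) = f (t, x)" if "t \<in> ball t0 (min e r)" "x \<in> K" for t x
      using W(4) sub that by auto
  qed (use eU r sub in auto)
qed

section \<open>Smooth inverses near compact sets\<close>

text \<open>\<open>D\<close> is the set of pairs at which injectivity does not fail.
  \<open>C \<times> C\<close> lies in its interior: on the diagonal by local injectivity, off the
  diagonal because disjoint neighbourhoods separate the images. By compactness a uniform
  neighbourhood of \<open>C \<times> C\<close> lies in \<open>D\<close> as well.\<close>

lemma injective_near_compact:
  fixes f :: "'a::euclidean_space \<Rightarrow> 'b::t2_space"
  assumes W: "open W" and f: "continuous_on W f" and C: "compact C" "C \<subseteq> W" and inj: "inj_on f C"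
    and loc: "\<And>x. x \<in> C \<Longrightarrow> \<exists>r>0. ball x r \<subseteq> W \<and> inj_on f (ball x r)"
  obtains N where "open N" "C \<subseteq> N" "N \<subseteq> W" "inj_on f N"
proof -
  define D where "D = {p \<in> W \<times> W. f (fst p) = f (snd p) \<longrightarrow> fst p = snd p}"
  have "C \<times> C \<subseteq> interior D"
  proof
    fix p assume "p \<in> C \<times> C"
    then obtain x y where p: "p = (x, y)" and xy: "x \<in> C" "y \<in> C" by auto
    show "p \<in> interior D"
    proof (cases "x = y")
      case True
      obtain r where r: "r > 0" "ball x r \<subseteq> W" "inj_on f (ball x r)"
        using loc xy by blast
      show ?thesis
      proof (rule interiorI)
        show "open (ball x r \<times> ball x r)" by (intro open_Times open_ball)
        show "p \<in> ball x r \<times> ball x r" using r(1) True p by simp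
        show "ball x r \<times> ball x r \<subseteq> D"
          using r(2) inj_onD[OF r(3)] unfolding D_def by force
      qed
    next
      case False
      then have ne: "f x \<noteq> f y" using inj_onD[OF inj] xy by blast
      obtain A B where AB: "open A" "open B" "f x \<in> A" "f y \<in> B" "A \<inter> B = {}"
        using hausdorff[OF ne] by metis
      show ?thesis
      proof (rule interiorI)
        show "open ((W \<inter> f -` A) \<times> (W \<inter> f -` B))"
          by (intro open_Times continuous_open_preimage[OF f W] AB)
        show "p \<in> (W \<inter> f -` A) \<times> (W \<inter> f -` B)" using AB xy C(2) p by auto
        show "(W \<inter> f -` A) \<times> (W \<inter> f -` B) \<subseteq> D"
          using AB(5) unfolding D_def by fastforce
      qed
    qed
  qed
  then obtain e where e: "e > 0" "(\<Union>p\<in>C \<times> C. ball p e) \<subseteq> interior D"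
    using compact_subset_open_imp_ball_epsilon_subset[OF compact_Times[OF C(1) C(1)] open_interior] by metis
  \<comment> \<open>Radius \<open>e/2\<close> in each factor keeps pairs of points of
    \<open>N\<close> within \<open>e\<close> of \<open>C \<times> C\<close>.\<close>
  define N where "N = (\<Union>x\<in>C. ball x (e/2))"
  have key: "(x, y) \<in> D" if xy: "x \<in> N" "y \<in> N" for x y
  proof -
    obtain a c where ac: "a \<in> C" "dist a x < e/2" "c \<in> C" "dist c y < e/2"
      using xy unfolding N_def UN_iff mem_ball by blast
    have "dist (a, c) (x, y) \<le> dist a x + dist c y"
      unfolding dist_Pair_Pair by (rule sqrt_sum_squares_le_sum) auto
    then have "(x, y) \<in> ball (a, c) e" using ac by simp
    then have "(x, y) \<in> interior D" using e(2) ac by blast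
    then show ?thesis using interior_subset by blast
  qed
  show ?thesis
  proof
    show "open N" unfolding N_def by blast
    show "C \<subseteq> N" using e(1) unfolding N_def by force
    show "N \<subseteq> W" using key unfolding D_def by auto
    show "inj_on f N"
      using key unfolding D_def inj_on_def by auto
  qed
qed

lemma onorm_le_sum_Basis:
  fixes L :: "'a::euclidean_space \<Rightarrow> 'b::real_normed_vector"
  assumes "linear L"
  shows "onorm L \<le> (\<Sum>e\<in>Basis. norm (L e))"
proof (rule onorm_bound)
  fix v
  have "norm (L v) = norm (\<Sum>e\<in>Basis. (v \<bullet> e) *\<^sub>R L e)"
    using linear_sum[OF assms, of "\<lambda>e. (v \<bullet> e) *\<^sub>R e" Basis]
    by (simp add: linear_cmul[OF assms] euclidean_representation)
  also have "\<dots> \<le> (\<Sum>e\<in>Basis. norm (L e) * norm v)"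
    by (rule order_trans[OF norm_sum], rule sum_mono)
      (auto simp: mult.commute[of "norm v"] intro!: mult_right_mono Basis_le_norm intro: order_trans[OF mult_right_mono[OF Basis_le_norm]])
  finally show "norm (L v) \<le> (\<Sum>e\<in>Basis. norm (L e)) * norm v"
    by (simp add: sum_distrib_right)
qed (auto intro: sum_nonneg)

text \<open>The injectivity criterion asks for continuity of the derivative in operator norm.
  Smoothness gives it direction by direction, which suffices because the operator norm is at most
  the sum of the norms over \<open>Basis\<close>.\<close>

lemma smooth_locally_injective:
  fixes f :: "'a::euclidean_space \<Rightarrow> 'b::euclidean_space"
  assumes W: "open W" and f: "smooth_on W f" and a: "a \<in> W"
    and L: "bounded_linear L" "L \<circ> frechet_derivative f (at a) = id"
  shows "\<exists>r>0. ball a r \<subseteq> W \<and> inj_on f (ball a r)"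
proof -
  have "\<exists>d>0. \<forall>x. dist a x < d \<longrightarrow>
      onorm (\<lambda>v. frechet_derivative f (at x) v - frechet_derivative f (at a) v) < e" if e: "e > 0" for e
  proof -
    let ?h = "\<lambda>x. \<Sum>b\<in>Basis. norm (frechet_derivative f (at x) b - frechet_derivative f (at a) b)"
    have "continuous_on W ?h"
      by (intro continuous_intros smooth_on_continuous[OF smooth_on_frechet_derivative[OF f]])
    then have "isCont ?h a"
      using W a by (simp add: continuous_on_eq_continuous_at)
    then obtain d where d: "d > 0" "\<And>x. dist x a < d \<Longrightarrow> dist (?h x) (?h a) < e"
      using e unfolding continuous_at_eps_delta by blast
    obtain r where r: "r > 0" "ball a r \<subseteq> W" using W a open_contains_ball by blast
    have "onorm (\<lambda>v. frechet_derivative f (at x) v - frechet_derivative f (at a) v) < e"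
      if x: "dist a x < min d r" for x
    proof -
      have xW: "x \<in> W" using r(2) x by auto
      have "linear (\<lambda>v. frechet_derivative f (at x) v - frechet_derivative f (at a) v)"
        by (rule linear_compose_sub[OF has_derivative_linear[OF smooth_on_has_derivative[OF f xW]]
              has_derivative_linear[OF smooth_on_has_derivative[OF f a]]])
      from onorm_le_sum_Basis[OF this] have "onorm (\<lambda>v. frechet_derivative f (at x) v - frechet_derivative f (at a) v) \<le> ?h x" .
      also have "\<dots> < e" using d(2)[of x] x by (simp add: dist_commute dist_real_def)
      finally show ?thesis .
    qed
    then show ?thesis using d(1) r(1) by (intro exI[of _ "min d r"]) auto
  qed
  from has_derivative_locally_injective[OF a W L smooth_on_has_derivative[OF f] this]
  show ?thesis by metis
qed

text \<open>The pointwise left inverse \<open>L\<close> of the derivative is taken as data, so that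
  its smoothness can be checked on an explicit formula. The inverse \<open>g\<close> has derivative
  \<open>L (g y)\<close> at \<open>y\<close>: once \<open>g\<close> has order \<open>n\<close>, so
  has this derivative, and \<open>g\<close> gains one order.\<close>

lemma smooth_inverse_near_compact:
  fixes f :: "'a::euclidean_space \<Rightarrow> 'a"
  assumes W: "open W" and f: "smooth_on W f" and C: "compact C" "C \<subseteq> W" and inj: "inj_on f C"
    and L: "\<And>x. x \<in> W \<Longrightarrow> linear (L x)"
      "\<And>x. x \<in> W \<Longrightarrow> L x \<circ> frechet_derivative f (at x) = id" "\<And>v. smooth_on W (\<lambda>x. L x v)"
  obtains N g where "open N" "C \<subseteq> N" "N \<subseteq> W" "open (f ` N)" "smooth_on (f ` N) g"
    "\<And>x. x \<in> N \<Longrightarrow> g (f x) = x"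
proof -
  have "\<exists>r>0. ball x r \<subseteq> W \<and> inj_on f (ball x r)" if "x \<in> C" for x
    using smooth_locally_injective[OF W f _ _ L(2)] L(1) C(2) that linear_conv_bounded_linear by blast
  then obtain N where N: "open N" "C \<subseteq> N" "N \<subseteq> W" "inj_on f N"
    using injective_near_compact[OF W smooth_on_continuous[OF f] C inj] by metis
  define g where "g = inv_into N f"
  have g: "g (f x) = x" if "x \<in> N" for x
    using N(4) that by (simp add: g_def)
  have contN: "continuous_on N f"
    using smooth_on_continuous[OF f] N(3) continuous_on_subset by blast
  have openf: "open (f ` N)"
    by (rule invariance_of_domain[OF contN N(1,4)])
  have der: "(g has_derivative L (g y)) (at y)" if y: "y \<in> f ` N" for y
  proof -
    obtain x where x: "x \<in> N" "y = f x" using y by blast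
    have xW: "x \<in> W" using x N by auto
    have fd: "(f has_derivative frechet_derivative f (at x)) (at x)"
      by (rule smooth_on_has_derivative[OF f xW])
    \<comment> \<open>A left inverse is also a right inverse, as domain and codomain have the same
      finite dimension; the inverse function rule needs the right inverse.\<close>
    have "frechet_derivative f (at x) \<circ> L x = id"
      using L(1,2)[OF xW] has_derivative_linear[OF fd] linear_inverse_left by blast
    from has_derivative_inverse_strong[OF N(1) x(1) contN g fd this]
    show ?thesis using x g by simp
  qed
  have "ck_on n (f ` N) g" for n
  proof (induction n)
    case 0
    have "isCont g y" if "y \<in> f ` N" for y
      using has_derivative_continuous[OF der[OF that]] .
    then show ?case
      by (simp add: continuous_at_imp_continuous_on)
  next
    case (Suc n)
    have "g ` f ` N \<subseteq> W" using g N(3) by auto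
    then have "ck_on n (f ` N) (\<lambda>y. L (g y) v)" for v
      by (rule ck_on_compose[OF openf _ smooth_on_ck[OF L(3)] Suc])
    from ck_on_SucI[OF openf der this] show ?case .
  qed
  then have "smooth_on (f ` N) g" by (simp add: smooth_on_def)
  then show ?thesis using that N(1-3) openf g by blast
qed

section \<open>Inverses of plane maps depending on a parameter\<close>

lemma jacobian_nth: "jacobian f (at x) $ i $ j = frechet_derivative f (at x) (axis j 1) $ i"
  by (simp add: jacobian_def matrix_def)

lemma det_jacobian:
  "det (jacobian f (at x)) =
    frechet_derivative f (at x) (axis 1 1) $ 1 * frechet_derivative f (at x) (axis 2 1) $ 2 -
    frechet_derivative f (at x) (axis 2 1) $ 1 * frechet_derivative f (at x) (axis 1 1) $ (2::2)"
  by (simp add: det_2 jacobian_nth)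

lemma plane_eq: "v = v $ 1 *\<^sub>R axis 1 1 + v $ 2 *\<^sub>R axis 2 (1::real)" for v :: plane
  by (simp add: vec_eq_iff forall_2 axis_def)

lemma linear_plane:
  "linear L \<Longrightarrow> L v = v $ 1 *\<^sub>R L (axis 1 1) + v $ 2 *\<^sub>R L (axis 2 1)" for v :: plane
  by (subst plane_eq) (simp only: linear_add linear_cmul)

text \<open>The inverse theorem is applied to the map \<open>\<Phi>\<close>, which keeps the
  parameter and sends \<open>(t, x)\<close> to \<open>(t, F t x)\<close>. A single smooth inverse
  then inverts all nearby \<open>F t\<close> and is smooth in both variables together.\<close>

lemma smooth_parametric_inverse:
  fixes F :: "real \<Rightarrow> plane \<Rightarrow> plane"
  assumes W: "open W" and F: "smooth_on W (\<lambda>p. F (fst p) (snd p))"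
    and K: "compact K" "{t0} \<times> K \<subseteq> W" and inj: "inj_on (F t0) K"
    and det: "\<And>x. x \<in> K \<Longrightarrow> det (jacobian (F t0) (at x)) \<noteq> 0"
  obtains e N g where "e > 0" "ball t0 e \<times> K \<subseteq> N" "N \<subseteq> W"
    "\<And>t x. (t, x) \<in> N \<Longrightarrow> det (jacobian (F t) (at x)) \<noteq> 0"
    "open ((\<lambda>p. (fst p, F (fst p) (snd p))) ` N)"
    "smooth_on ((\<lambda>p. (fst p, F (fst p) (snd p))) ` N) (\<lambda>p. g (fst p) (snd p))"
    "\<And>t x. (t, x) \<in> N \<Longrightarrow> g t (F t x) = x"
proof -
  define f where "f = (\<lambda>p. F (fst p) (snd p))"
  define \<Phi> where "\<Phi> = (\<lambda>p. (fst p, f p))"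
  define a where "a = (\<lambda>p. frechet_derivative f (at p) (0, axis 1 1))"
  define c where "c = (\<lambda>p. frechet_derivative f (at p) (0, axis 2 1))"
  define q where "q = (\<lambda>p. frechet_derivative f (at p) (1, 0))"
  define \<delta> where "\<delta> p = a p $ 1 * c p $ 2 - c p $ 1 * a p $ 2" for p
  note f = F[folded f_def]
  have sm: "smooth_on W a" "smooth_on W c" "smooth_on W q"
    unfolding a_def c_def q_def by (rule smooth_on_frechet_derivative[OF f])+
  have sm\<delta>: "smooth_on W \<delta>"
    unfolding \<delta>_def by (intro smooth_intros sm W)
  have det_eq: "det (jacobian (F t) (at x)) = \<delta> (t, x)" if "(t, x) \<in> W" for t x
    using smooth_on_frechet_slice[OF F that] by (simp add: det_jacobian \<delta>_def a_def c_def f_def)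
  define W1 where "W1 = W \<inter> \<delta> -` (- {0})"
  have W1: "open W1"
    unfolding W1_def by (rule continuous_open_preimage[OF smooth_on_continuous[OF sm\<delta>] W]) auto
  have W1W: "W1 \<subseteq> W" and nz: "\<And>p. p \<in> W1 \<Longrightarrow> \<delta> p \<noteq> 0" by (auto simp: W1_def)
  have C: "compact ({t0} \<times> K)" "{t0} \<times> K \<subseteq> W1"
  proof -
    show "compact ({t0} \<times> K)" using K(1) by (intro compact_Times) auto
    have "(t0, x) \<in> W1" if "x \<in> K" for x
      using det[OF that] det_eq[of t0 x] K(2) that by (auto simp: W1_def)
    then show "{t0} \<times> K \<subseteq> W1" by auto
  qed
  have sm1: "smooth_on W1 a" "smooth_on W1 c" "smooth_on W1 q" "smooth_on W1 \<delta>" "smooth_on W1 f"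
    using sm sm\<delta> f W1W smooth_on_subset by blast+
  have \<Phi>: "smooth_on W1 \<Phi>"
    unfolding \<Phi>_def by (intro smooth_intros sm1 W1)
  have inj\<Phi>: "inj_on \<Phi> ({t0} \<times> K)"
    using inj by (auto simp: inj_on_def \<Phi>_def f_def)
  \<comment> \<open>Cramer's rule: the contribution \<open>q\<close> of the parameter is removed
    from the second component, then the 2 by 2 system with columns \<open>a\<close> and
    \<open>c\<close> and determinant \<open>\<delta>\<close> is solved.\<close>
  define L where "L p v = (fst v,
      (((snd v $ 1 - fst v * q p $ 1) * c p $ 2 - c p $ 1 * (snd v $ 2 - fst v * q p $ 2)) / \<delta> p) *\<^sub>R axis 1 1 +
      ((a p $ 1 * (snd v $ 2 - fst v * q p $ 2) - a p $ 2 * (snd v $ 1 - fst v * q p $ 1)) / \<delta> p) *\<^sub>R axis (2::2) (1::real))"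
    for p :: "real \<times> plane" and v :: "real \<times> plane"
  have linL: "linear (L p)" for p
    by (rule linearI) (auto simp: L_def vec_eq_iff forall_2 axis_def algebra_simps add_divide_distrib diff_divide_distrib)
  have LD: "L p \<circ> frechet_derivative \<Phi> (at p) = id" if p: "p \<in> W1" for p
  proof
    fix v :: "real \<times> plane"
    have fd: "(f has_derivative frechet_derivative f (at p)) (at p)"
      by (rule smooth_on_has_derivative[OF sm1(5) p])
    have lin: "linear (frechet_derivative f (at p))" by (rule has_derivative_linear[OF fd])
    have d: "(\<Phi> has_derivative (\<lambda>v. (fst v, frechet_derivative f (at p) v))) (at p)"
      unfolding \<Phi>_def by (intro has_derivative_Pair has_derivative_fst has_derivative_ident fd)
    have D\<Phi>: "frechet_derivative \<Phi> (at p) v = (fst v, frechet_derivative f (at p) v)"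
      by (rule fun_cong[OF frechet_derivative_at[OF d], symmetric])
    have v: "v = fst v *\<^sub>R (1, 0) + (snd v $ 1 *\<^sub>R (0, axis 1 1) + snd v $ 2 *\<^sub>R (0, axis 2 1))"
      using plane_eq[of "snd v"] by (cases v) simp
    have Df: "frechet_derivative f (at p) v = fst v *\<^sub>R q p + (snd v $ 1 *\<^sub>R a p + snd v $ 2 *\<^sub>R c p)"
      unfolding q_def a_def c_def
      by (subst v) (simp only: linear_add[OF lin] linear_cmul[OF lin])
    have e: "((snd v $ 1 * a p $ 1 + snd v $ 2 * c p $ 1) * c p $ 2 - c p $ 1 * (snd v $ 1 * a p $ 2 + snd v $ 2 * c p $ 2)) = snd v $ 1 * \<delta> p"
      "(a p $ 1 * (snd v $ 1 * a p $ 2 + snd v $ 2 * c p $ 2) - a p $ 2 * (snd v $ 1 * a p $ 1 + snd v $ 2 * c p $ 1)) = snd v $ 2 * \<delta> p"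
      by (simp_all add: \<delta>_def algebra_simps)
    have z: "frechet_derivative f (at p) v $ i - fst v * q p $ i = snd v $ 1 * a p $ i + snd v $ 2 * c p $ i" for i
      by (simp add: Df)
    have "L p (fst v, frechet_derivative f (at p) v) = (fst v, snd v $ 1 *\<^sub>R axis 1 1 + snd v $ 2 *\<^sub>R axis 2 1)"
      unfolding L_def fst_conv snd_conv z e using nz[OF p] by simp
    then show "(L p \<circ> frechet_derivative \<Phi> (at p)) v = id v"
      unfolding o_def D\<Phi> using plane_eq[of "snd v"] by simp
  qed
  have smL: "smooth_on W1 (\<lambda>p. L p v)" for v
    unfolding L_def by (intro smooth_intros smooth_on_divide sm1 W1 nz)
  obtain N g where N: "open N" "{t0} \<times> K \<subseteq> N" "N \<subseteq> W1" "open (\<Phi> ` N)" "smooth_on (\<Phi> ` N) g"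
    "\<And>x. x \<in> N \<Longrightarrow> g (\<Phi> x) = x"
    using smooth_inverse_near_compact[OF W1 \<Phi> C inj\<Phi> linL LD smL] by metis
  obtain e U where e: "e > 0" "K \<subseteq> U" "ball t0 e \<times> U \<subseteq> N"
    using open_tube[OF K(1) N(1,2)] by metis
  have \<Phi>_eq: "\<Phi> = (\<lambda>p. (fst p, F (fst p) (snd p)))" by (simp add: \<Phi>_def f_def)
  show ?thesis
  proof (rule that[of e N "\<lambda>t x. snd (g (t, x))"])
    show "smooth_on ((\<lambda>p. (fst p, F (fst p) (snd p))) ` N) (\<lambda>p. snd (g (fst p, snd p)))"
      using N(4,5) unfolding \<Phi>_eq[symmetric] by (simp add: smooth_on_snd)
    show "open ((\<lambda>p. (fst p, F (fst p) (snd p))) ` N)"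
      using N(4) unfolding \<Phi>_eq .
    show "ball t0 e \<times> K \<subseteq> N" "N \<subseteq> W"
      using e N(3) W1W by auto
    show "snd (g (t, F t x)) = x" if "(t, x) \<in> N" for t x
      using N(6)[OF that] by (simp add: \<Phi>_def f_def)
    show "det (jacobian (F t) (at x)) \<noteq> 0" if "(t, x) \<in> N" for t x
      using that N(3) W1W nz det_eq by force
  qed (rule e(1))
qed

text \<open>Surjectivity at \<open>t0\<close> puts \<open>{t0} \<times> K\<close> inside the open
  image of \<open>N\<close>. A tube around it within that image is a domain for the inverses that is
  the same for all nearby parameters.\<close>

lemma smooth_parametric_inverse_surj:
  fixes F :: "real \<Rightarrow> plane \<Rightarrow> plane"
  assumes W: "open W" and F: "smooth_on W (\<lambda>p. F (fst p) (snd p))"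
    and K: "compact K" "{t0} \<times> K \<subseteq> W" and inj: "inj_on (F t0) K"
    and det: "\<And>x. x \<in> K \<Longrightarrow> det (jacobian (F t0) (at x)) \<noteq> 0"
    and surj: "F t0 ` K = K"
  obtains e U Y where "e > 0" "open U" "K \<subseteq> U" "ball t0 e \<times> K \<subseteq> W"
    "smooth_on (ball t0 e \<times> U) (\<lambda>p. Y (fst p) (snd p))"
    "\<And>t x. t \<in> ball t0 e \<Longrightarrow> x \<in> K \<Longrightarrow> Y t (F t x) = x"
    "\<And>t x. t \<in> ball t0 e \<Longrightarrow> x \<in> K \<Longrightarrow> det (jacobian (F t) (at x)) \<noteq> 0"
proof -
  obtain r N g where N: "r > 0" "ball t0 r \<times> K \<subseteq> N" "N \<subseteq> W"
    "\<And>t x. (t, x) \<in> N \<Longrightarrow> det (jacobian (F t) (at x)) \<noteq> 0"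
    "open ((\<lambda>p. (fst p, F (fst p) (snd p))) ` N)"
    "smooth_on ((\<lambda>p. (fst p, F (fst p) (snd p))) ` N) (\<lambda>p. g (fst p) (snd p))"
    "\<And>t x. (t, x) \<in> N \<Longrightarrow> g t (F t x) = x"
    using smooth_parametric_inverse[OF W F K inj det] by blast
  have K_im: "{t0} \<times> K \<subseteq> (\<lambda>p. (fst p, F (fst p) (snd p))) ` N"
  proof
    fix p assume "p \<in> {t0} \<times> K"
    then obtain x where x: "x \<in> K" "p = (t0, F t0 x)" using surj by blast
    then have "(t0, x) \<in> N" using N(1,2) by auto
    then show "p \<in> (\<lambda>p. (fst p, F (fst p) (snd p))) ` N"
      using x(2) by (intro image_eqI[of _ _ "(t0, x)"]) simp_all
  qed
  obtain e U where e: "e > 0" "open U" "K \<subseteq> U" "ball t0 e \<times> U \<subseteq> (\<lambda>p. (fst p, F (fst p) (snd p))) ` N"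
    by (rule open_tube[OF K(1) N(5) K_im])
  have sub: "ball t0 (min e r) \<times> U \<subseteq> (\<lambda>p. (fst p, F (fst p) (snd p))) ` N" "ball t0 (min e r) \<times> K \<subseteq> N"
    using e(4) N(2) by auto
  show ?thesis
  proof (rule that[of "min e r" U g])
    show "smooth_on (ball t0 (min e r) \<times> U) (\<lambda>p. g (fst p) (snd p))"
      by (rule smooth_on_subset[OF N(6) sub(1)])
    show "min e r > 0" using e N by simp
    show "ball t0 (min e r) \<times> K \<subseteq> W" using sub(2) N(3) by (rule order_trans)
    show "g t (F t x) = x" "det (jacobian (F t) (at x)) \<noteq> 0" if "t \<in> ball t0 (min e r)" "x \<in> K" for t x
      using N(4,7)[of t x] sub(2) that by blast+
  qed (use e in auto)
qed

section \<open>Differentiation under the integral and the divergence theorem\<close>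

lemma frechet_derivative_eq_grad:
  fixes f :: "plane \<Rightarrow> real"
  assumes "f differentiable (at x)"
  shows "frechet_derivative f (at x) v = grad f x \<bullet> v"
proof -
  have "linear (frechet_derivative f (at x))"
    using assms by (rule linear_frechet_derivative)
  from linear_plane[OF this, of v] show ?thesis
    by (simp add: grad_def inner_vec_def sum_2)
qed

lemma divg_eq:
  "divg F x = frechet_derivative F (at x) (axis 1 1) $ 1 + frechet_derivative F (at x) (axis 2 1) $ 2"
  by (simp add: divg_def trace_def jacobian_nth sum_2)

lemma set_integrable_continuous_closure:
  fixes f :: "'a::euclidean_space \<Rightarrow> real"
  assumes "open \<Omega>" and "bounded \<Omega>" and "continuous_on (closure \<Omega>) f"
  shows "set_integrable lborel \<Omega> f"
proof -
  have "set_integrable lborel (closure \<Omega>) f"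
    using borel_integrable_compact[of "closure \<Omega>" f] assms by (simp add: set_integrable_def)
  then show ?thesis
    by (rule set_integrable_subset) (use assms closure_subset in auto)
qed

text \<open>Dominated convergence of the difference quotients. Halving the radius gives the compact
  set \<open>cball t0 (e/2) \<times> closure \<Omega>\<close>, on which \<open>f'\<close> is
  bounded. The mean value inequality hands this bound to the quotients, and constants are integrable
  over the bounded set \<open>\<Omega>\<close>.\<close>

lemma leibniz_integral:
  fixes f f' :: "real \<Rightarrow> 'a::euclidean_space \<Rightarrow> real"
  assumes \<Omega>: "open \<Omega>" "bounded \<Omega>" and e: "e > 0" and U: "closure \<Omega> \<subseteq> U"
    and f: "\<And>t. t \<in> ball t0 e \<Longrightarrow> continuous_on U (f t)"
    and d: "\<And>t x. t \<in> ball t0 e \<Longrightarrow> x \<in> U \<Longrightarrow> ((\<lambda>s. f s x) has_real_derivative f' t x) (at t)"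
    and f': "continuous_on (ball t0 e \<times> U) (\<lambda>p. f' (fst p) (snd p))"
  shows "((\<lambda>t. LINT x:\<Omega>|lborel. f t x) has_real_derivative (LINT x:\<Omega>|lborel. f' t0 x)) (at t0)"
proof -
  let ?K = "closure \<Omega>"
  have K: "compact ?K" using \<Omega> by simp
  have subU: "\<Omega> \<subseteq> U" using U closure_subset by blast
  have cpt: "compact ((\<lambda>p. f' (fst p) (snd p)) ` (cball t0 (e/2) \<times> ?K))"
    by (intro compact_continuous_image continuous_on_subset[OF f'] compact_Times compact_cball K)
      (use e U in auto)
  obtain C where C0: "\<forall>y\<in>(\<lambda>p. f' (fst p) (snd p)) ` (cball t0 (e/2) \<times> ?K). norm y \<le> C"
    using compact_imp_bounded[OF cpt] unfolding bounded_iff by blast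
  have C: "\<bar>f' t x\<bar> \<le> C" if "t \<in> cball t0 (e/2)" "x \<in> ?K" for t x
    using C0[rule_format, OF imageI[of "(t, x)"]] that by simp
  have fint: "set_integrable lborel \<Omega> (f t)" if "t \<in> ball t0 e" for t
    by (rule set_integrable_continuous_closure[OF \<Omega> continuous_on_subset[OF f[OF that] U]])
  define q where "q h x = (f (t0 + h) x - f t0 x) / h" for h x
  have q_int: "(LINT x:\<Omega>|lborel. q h x) = ((LINT x:\<Omega>|lborel. f (t0 + h) x) - (LINT x:\<Omega>|lborel. f t0 x)) / h"
    if "h \<in> ball 0 (e/2)" for h
  proof -
    have "t0 + h \<in> ball t0 e" "t0 \<in> ball t0 e" using that e by (auto simp: dist_real_def)
    from set_integral_diff(2)[OF fint[OF this(1)] fint[OF this(2)]] show ?thesis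
      by (simp add: q_def)
  qed
  have q_bound: "\<bar>q h x\<bar> \<le> C" if h: "h \<in> ball 0 (e/2) - {0}" and x: "x \<in> \<Omega>" for h x
  proof -
    have xU: "x \<in> U" "x \<in> ?K" using x subU closure_subset by auto
    have der: "((\<lambda>s. f s x) has_derivative (\<lambda>u. f' t x * u)) (at t within cball t0 (e/2))"
      if "t \<in> cball t0 (e/2)" for t
    proof -
      have "t \<in> ball t0 e" using that e by auto
      from d[OF this xU(1)] show ?thesis
        unfolding has_field_derivative_def by (rule has_derivative_at_withinI)
    qed
    have on: "onorm (\<lambda>u. f' t x * u) \<le> C" if "t \<in> cball t0 (e/2)" for t
      using C[OF that xU(2)] by (intro onorm_bound) (auto simp: abs_mult intro: mult_right_mono order_trans[OF abs_ge_zero])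
    have "norm (f (t0 + h) x - f t0 x) \<le> C * norm (t0 + h - t0)"
      by (rule differentiable_bound[OF convex_cball der on]) (use h e in \<open>auto simp: dist_real_def\<close>)
    then show ?thesis
      using h by (simp add: q_def abs_divide divide_le_eq)
  qed
  have q_lim: "((\<lambda>h. q h x) \<longlongrightarrow> f' t0 x) (at 0)" if "x \<in> \<Omega>" for x
  proof -
    have "t0 \<in> ball t0 e" "x \<in> U" using that subU e by auto
    from d[OF this] show ?thesis unfolding DERIV_def q_def .
  qed
  have meas: "set_borel_measurable lborel \<Omega> (f t)" if "t \<in> ball t0 e" for t
    using fint[OF that] by (simp add: set_integrable_def set_borel_measurable_def borel_measurable_integrable)
  have f'_int: "set_integrable lborel \<Omega> (f' t0)"
  proof (rule set_integrable_continuous_closure[OF \<Omega>])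
    have "continuous_on ?K (\<lambda>x. (t0, x))" by (intro continuous_intros)
    moreover have "(\<lambda>x. (t0, x)) ` ?K \<subseteq> ball t0 e \<times> U" using e U by auto
    ultimately show "continuous_on ?K (f' t0)"
      using continuous_on_compose2[OF f', of ?K "\<lambda>x. (t0, x)"] by simp
  qed
  \<comment> \<open>Dominated convergence is a statement about sequences. Restricting the filter to
    the small ball makes the bound hold for every member of the sequence.\<close>
  have "((\<lambda>h. LINT x:\<Omega>|lborel. q h x) \<longlongrightarrow> (LINT x:\<Omega>|lborel. f' t0 x)) (at 0 within ball 0 (e/2))"
    unfolding tendsto_at_iff_sequentially
  proof (intro allI impI)
    fix X :: "nat \<Rightarrow> real" assume X: "\<forall>i. X i \<in> ball 0 (e/2) - {0}" "X \<longlonglongrightarrow> 0"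
    show "((\<lambda>h. LINT x:\<Omega>|lborel. q h x) \<circ> X) \<longlonglongrightarrow> (LINT x:\<Omega>|lborel. f' t0 x)"
      unfolding o_def set_lebesgue_integral_def
    proof (rule integral_dominated_convergence)
      show "integrable lborel (\<lambda>x. indicator \<Omega> x * C)"
        using \<Omega> emeasure_bounded_finite[OF \<Omega>(2)] by (intro integrable_mult_left) auto
      show "(\<lambda>x. indicator \<Omega> x *\<^sub>R f' t0 x) \<in> borel_measurable lborel"
        using f'_int by (simp add: set_integrable_def borel_measurable_integrable)
      show "(\<lambda>x. indicator \<Omega> x *\<^sub>R q (X i) x) \<in> borel_measurable lborel" for i
      proof -
        have "t0 + X i \<in> ball t0 e" "t0 \<in> ball t0 e" using X(1)[rule_format, of i] e by (auto simp: dist_real_def)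
        from meas[OF this(1)] meas[OF this(2)]
        have "(\<lambda>x. (indicator \<Omega> x *\<^sub>R f (t0 + X i) x - indicator \<Omega> x *\<^sub>R f t0 x) / X i) \<in> borel_measurable lborel"
          unfolding set_borel_measurable_def by measurable
        then show ?thesis by (simp add: q_def right_diff_distrib diff_divide_distrib)
      qed
      show "AE x in lborel. (\<lambda>i. indicator \<Omega> x *\<^sub>R q (X i) x) \<longlonglongrightarrow> indicator \<Omega> x *\<^sub>R f' t0 x"
      proof (rule AE_I2)
        fix x
        show "(\<lambda>i. indicator \<Omega> x *\<^sub>R q (X i) x) \<longlonglongrightarrow> indicator \<Omega> x *\<^sub>R f' t0 x"
        proof (cases "x \<in> \<Omega>")
          case True
          have "filterlim X (at 0) sequentially"
            using X by (auto simp: filterlim_at intro!: always_eventually)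
          from filterlim_compose[OF q_lim[OF True] this] True show ?thesis by simp
        qed simp
      qed
      show "AE x in lborel. norm (indicator \<Omega> x *\<^sub>R q (X i) x) \<le> indicator \<Omega> x * C" for i
        using q_bound X(1) by (intro AE_I2) (auto simp: indicator_def)
    qed
  qed
  then have "((\<lambda>h. LINT x:\<Omega>|lborel. q h x) \<longlongrightarrow> (LINT x:\<Omega>|lborel. f' t0 x)) (at 0)"
    using e by (simp add: at_within_open[of 0 "ball 0 (e/2)"])
  moreover have "\<forall>\<^sub>F h in at 0. (LINT x:\<Omega>|lborel. q h x) =
      ((LINT x:\<Omega>|lborel. f (t0 + h) x) - (LINT x:\<Omega>|lborel. f t0 x)) / h"
  proof (rule eventually_mono)
    show "\<forall>\<^sub>F h in at 0. h \<in> ball 0 (e/2)"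
      using e by (auto simp: eventually_at dist_commute intro!: exI[of _ "e/2"])
  qed (rule q_int)
  ultimately show ?thesis
    unfolding DERIV_def by (rule Lim_transform_eventually)
qed

lemma leibniz_integral_smooth:
  fixes f :: "real \<Rightarrow> 'a::euclidean_space \<Rightarrow> real"
  assumes \<Omega>: "open \<Omega>" "bounded \<Omega>" and e: "e > 0" and U: "open U" "closure \<Omega> \<subseteq> U"
    and f: "smooth_on (ball t0 e \<times> U) (\<lambda>p. f (fst p) (snd p))"
  shows "((\<lambda>t. LINT x:\<Omega>|lborel. f t x) has_real_derivative
    (LINT x:\<Omega>|lborel. vector_derivative (\<lambda>s. f s x) (at t0))) (at t0)"
proof (rule leibniz_integral[OF \<Omega> e U(2)])
  show "continuous_on U (f t)" if "t \<in> ball t0 e" for t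
    by (rule smooth_on_continuous[OF smooth_on_slice[OF f that U(1)]])
  show "((\<lambda>s. f s x) has_real_derivative vector_derivative (\<lambda>s. f s x) (at t)) (at t)"
    if "t \<in> ball t0 e" "x \<in> U" for t x
    using smooth_on_has_vector_derivative[OF f, of t x] that
    by (simp add: has_real_derivative_iff_has_vector_derivative)
  show "continuous_on (ball t0 e \<times> U) (\<lambda>p. vector_derivative (\<lambda>s. f s (snd p)) (at (fst p)))"
    by (rule smooth_on_continuous[OF smooth_on_time_derivative[OF open_ball U(1) f]])
qed

section \<open>The divergence theorem for tangent fields\<close>

lemma integral_directional_derivative_zero:
  fixes G :: "'a::euclidean_space \<Rightarrow> real"
  assumes G: "\<And>x. (G has_derivative G' x) (at x)" and G': "continuous_on UNIV (\<lambda>x. G' x v)"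
    and B: "\<And>x. norm x > B \<Longrightarrow> G x = 0"
  shows "(LINT x|lborel. G' x v) = 0"
proof -
  \<comment> \<open>Outside this ball all translates of \<open>G\<close> by \<open>t\<close> times
    \<open>v\<close> with \<open>\<bar>t\<bar> < 1\<close> vanish, so one bounded domain serves them
    all.\<close>
  let ?\<Omega> = "ball 0 (\<bar>B\<bar> + norm v + 1) :: 'a set"
  have contG: "continuous_on S G" for S
    using has_derivative_continuous[OF G] by (simp add: continuous_at_imp_continuous_on)
  have line: "((\<lambda>s. G (x + s *\<^sub>R v)) has_real_derivative G' (x + t *\<^sub>R v) v) (at t)" for x t
  proof -
    have "((\<lambda>s. x + s *\<^sub>R v) has_derivative (\<lambda>s. s *\<^sub>R v)) (at t)"
      by (auto intro!: derivative_eq_intros)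
    from has_derivative_imp_has_vector_derivative[OF has_derivative_compose[OF this G]]
    show ?thesis by (simp add: has_real_derivative_iff_has_vector_derivative)
  qed
  have d: "((\<lambda>t. LINT x:?\<Omega>|lborel. G (x + t *\<^sub>R v)) has_real_derivative (LINT x:?\<Omega>|lborel. G' (x + 0 *\<^sub>R v) v)) (at 0)"
  proof (rule leibniz_integral[where e = 1 and U = UNIV])
    show "continuous_on UNIV (\<lambda>x. G (x + t *\<^sub>R v))" for t
      by (rule continuous_on_compose2[OF contG[of UNIV]]) (auto intro!: continuous_intros)
    show "continuous_on (ball 0 1 \<times> UNIV) (\<lambda>p. G' (snd p + fst p *\<^sub>R v) v)"
      by (rule continuous_on_compose2[OF G']) (auto intro!: continuous_intros)
  qed (use line in auto)
  \<comment> \<open>Lebesgue measure is translation invariant, hence the integral of the translate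
    is constant in \<open>t\<close>. Its derivative at 0 is the integral that has to vanish.\<close>
  have trans: "(LINT x:?\<Omega>|lborel. G (x + t *\<^sub>R v)) = (LINT x|lborel. G x)" if t: "t \<in> ball 0 1" for t
  proof -
    have "(LINT x|lborel. G x) = (LINT x|distr lborel borel ((+) (t *\<^sub>R v)). G x)"
      by (simp add: lborel_distr_plus)
    also have "\<dots> = (LINT x|lborel. G (t *\<^sub>R v + x))"
      by (rule integral_distr) (use contG in \<open>auto intro: borel_measurable_continuous_onI\<close>)
    also have "\<dots> = (LINT x:?\<Omega>|lborel. G (x + t *\<^sub>R v))"
      unfolding set_lebesgue_integral_def
    proof (rule Bochner_Integration.integral_cong)
      fix x :: 'a
      show "G (t *\<^sub>R v + x) = indicator ?\<Omega> x *\<^sub>R G (x + t *\<^sub>R v)"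
      proof (cases "x \<in> ?\<Omega>")
        case False
        then have "norm x \<ge> \<bar>B\<bar> + norm v + 1" by simp
        moreover have "norm x \<le> norm (t *\<^sub>R v + x) + norm (t *\<^sub>R v)"
          using norm_triangle_ineq4[of "t *\<^sub>R v + x" "t *\<^sub>R v"] by simp
        moreover have "norm (t *\<^sub>R v) \<le> norm v"
          using t by (auto simp: mult_left_le_one_le)
        ultimately have "norm (t *\<^sub>R v + x) > B" by linarith
        then show ?thesis using False B by simp
      qed (simp add: add.commute)
    qed simp
    finally show ?thesis by simp
  qed
  have "((\<lambda>t. LINT x:?\<Omega>|lborel. G (x + t *\<^sub>R v)) has_real_derivative 0) (at 0)"
    by (rule has_field_derivative_transform_within_open[OF DERIV_const[of "LINT x|lborel. G x"] open_ball[of 0 1]])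
      (use trans in auto)
  then have "(LINT x:?\<Omega>|lborel. G' x v) = 0"
    using DERIV_unique[OF d] by simp
  moreover have "G' x v = 0" if "x \<notin> ?\<Omega>" for x
  proof -
    have "norm x \<ge> \<bar>B\<bar> + norm v + 1" using that by simp
    then have "norm x > B" using norm_ge_zero[of v] by linarith
    then have "x \<in> - cball 0 B" by simp
    then have "(G has_derivative (\<lambda>v. 0)) (at x)"
      using B by (intro has_derivative_transform_within_open[OF has_derivative_const, of "- cball 0 B"]) (auto simp: open_Compl)
    then show ?thesis using has_derivative_unique[OF G] by metis
  qed
  then have "(LINT x:?\<Omega>|lborel. G' x v) = (LINT x|lborel. G' x v)"
    unfolding set_lebesgue_integral_def
    by (intro Bochner_Integration.integral_cong) (auto simp: indicator_def)
  ultimately show ?thesis by simp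
qed

text \<open>Continuity of \<open>d\<close> only puts the frontier inside the zero set. Conversely,
  at a zero the gradient does not vanish, so moving against it enters the region
  \<open>d < 0\<close>, and the zero is a limit of points of \<open>\<Omega>\<close>.\<close>

lemma frontier_defining_function:
  assumes "defining_function \<Omega> d"
  shows "frontier \<Omega> = {x. d x = 0}" and "open \<Omega>"
proof -
  have d: "smooth_on UNIV d" and \<Omega>: "\<Omega> = {x. d x < 0}" and g: "\<And>x. d x = 0 \<Longrightarrow> grad d x \<noteq> 0"
    using assms by (auto simp: defining_function_def)
  have cont: "continuous_on UNIV d" by (rule smooth_on_continuous[OF d])
  show op: "open \<Omega>"
    unfolding \<Omega> using open_Collect_less[OF cont continuous_on_const] by simp
  have "closed {x. d x \<le> 0}"
    using closed_Collect_le[OF cont continuous_on_const] by simp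
  then have "closure \<Omega> \<subseteq> {x. d x \<le> 0}"
    unfolding \<Omega> by (intro closure_minimal) auto
  then have "frontier \<Omega> \<subseteq> {x. d x = 0}"
    using op unfolding frontier_def \<Omega> by (auto simp: interior_open)
  moreover have "z \<in> frontier \<Omega>" if z: "d z = 0" for z
  proof -
    let ?n = "grad d z"
    have "((\<lambda>s. z + s *\<^sub>R ?n) has_derivative (\<lambda>s. s *\<^sub>R ?n)) (at 0)"
      by (auto intro!: derivative_eq_intros)
    moreover have "(d has_derivative frechet_derivative d (at z)) (at (z + 0 *\<^sub>R ?n))"
      using smooth_on_has_derivative[OF d, of z] by simp
    ultimately have "((\<lambda>s. d (z + s *\<^sub>R ?n)) has_real_derivative frechet_derivative d (at z) (1 *\<^sub>R ?n)) (at 0)"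
      unfolding has_real_derivative_iff_has_vector_derivative
      by (rule has_derivative_imp_has_vector_derivative[OF has_derivative_compose])
    moreover have "frechet_derivative d (at z) (1 *\<^sub>R ?n) > 0"
      using g[OF z] frechet_derivative_eq_grad[OF smooth_on_differentiable[OF d, of z], of ?n] by simp
    ultimately obtain e where e: "e > 0" "\<And>h. 0 < h \<Longrightarrow> h < e \<Longrightarrow> d (z + (0 - h) *\<^sub>R ?n) < d (z + 0 *\<^sub>R ?n)"
      using DERIV_pos_inc_left by blast
    \<comment> \<open>Division by \<open>k + 2\<close> keeps every step strictly between 0 and
      \<open>e\<close>, from the first index on.\<close>
    have "(\<lambda>k. z + (0 - e / real (k + 2)) *\<^sub>R ?n) \<longlonglongrightarrow> z + (0 - 0) *\<^sub>R ?n"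
      by (intro tendsto_intros LIMSEQ_ignore_initial_segment[OF lim_const_over_n])
    moreover have "z + (0 - e / real (k + 2)) *\<^sub>R ?n \<in> \<Omega>" for k
    proof -
      have "e / real (k + 2) < e" "0 < e / real (k + 2)"
        using e(1) by (simp_all add: divide_less_eq algebra_simps add_pos_nonneg)
      from e(2)[OF this(2,1)] z show ?thesis by (simp add: \<Omega>)
    qed
    ultimately have "z \<in> closure \<Omega>"
      unfolding closure_sequential by (metis (no_types, lifting) add.right_neutral diff_zero scaleR_zero_left)
    then show ?thesis using z op by (simp add: frontier_def \<Omega> interior_open)
  qed
  ultimately show "frontier \<Omega> = {x. d x = 0}" by blast
qed

text \<open>From \<open>x\<close> follow the fixed direction \<open>n\<close>, the gradient of
  \<open>d\<close> at \<open>p\<close>. Near \<open>p\<close> the function \<open>d\<close> grows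
  along it at rate at least \<open>c/2\<close>, so the line meets the zero set after a time
  \<open>s\<close> with \<open>s * (c/2) \<le> \<bar>d x\<bar>\<close>. There \<open>f\<close>
  vanishes, and its slope along the line is at most \<open>M\<close>, so
  \<open>\<bar>f x\<bar> \<le> s * M\<close>.\<close>

lemma vanishing_bounded_by_defining_function_local:
  fixes f :: "plane \<Rightarrow> real"
  assumes d: "defining_function \<Omega> d" and U: "open U" "p \<in> U" and f: "smooth_on U f"
    and f0: "\<And>x. x \<in> U \<Longrightarrow> d x = 0 \<Longrightarrow> f x = 0" and p: "d p = 0"
  shows "\<exists>r C. r > 0 \<and> (\<forall>x\<in>ball p r \<inter> \<Omega>. \<bar>f x\<bar> \<le> C * \<bar>d x\<bar>)"
proof -
  have sd: "smooth_on UNIV d" and \<Omega>: "\<Omega> = {x. d x < 0}"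
    using d by (auto simp: defining_function_def)
  define n where "n = grad d p"
  have n0: "n \<noteq> 0" using d p by (auto simp: defining_function_def n_def)
  define c where "c = n \<bullet> n"
  have c: "c > 0" using n0 by (simp add: c_def)
  have Dd: "frechet_derivative d (at p) n = c"
    using frechet_derivative_eq_grad[OF smooth_on_differentiable[OF sd, of p]] by (simp add: n_def c_def)
  have cont: "isCont (\<lambda>x. frechet_derivative d (at x) n) p"
    using smooth_on_continuous[OF smooth_on_frechet_derivative[OF sd]] by (simp add: continuous_on_eq_continuous_at)
  obtain R1 where R1: "R1 > 0" "\<And>x. dist x p < R1 \<Longrightarrow> dist (frechet_derivative d (at x) n) c < c/2"
    using cont c unfolding continuous_at_eps_delta Dd by (metis half_gt_zero)
  obtain R2 where R2: "R2 > 0" "cball p R2 \<subseteq> U"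
    using U open_contains_cball by blast
  define R where "R = min (R1/2) R2"
  have R: "R > 0" using R1 R2 by (simp add: R_def)
  have dpos: "frechet_derivative d (at x) n \<ge> c/2" if "x \<in> cball p R" for x
  proof -
    have "dist x p \<le> R1/2" using that by (simp add: R_def dist_commute)
    then have "dist x p < R1" using R1(1) by linarith
    from R1(2)[OF this] show ?thesis unfolding dist_real_def by linarith
  qed
  have RU: "cball p R \<subseteq> U" using R2 by (auto simp: R_def)
  have "compact ((\<lambda>x. frechet_derivative f (at x) n) ` cball p R)"
    by (intro compact_continuous_image continuous_on_subset[OF smooth_on_continuous[OF smooth_on_frechet_derivative[OF f]] RU] compact_cball)
  from compact_imp_bounded[OF this] obtain M0 where M0: "\<forall>y\<in>(\<lambda>x. frechet_derivative f (at x) n) ` cball p R. norm y \<le> M0"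
    unfolding bounded_iff by blast
  define M where "M = \<bar>M0\<bar>"
  have M: "\<bar>frechet_derivative f (at x) n\<bar> \<le> M" if "x \<in> cball p R" for x
    using M0[rule_format, OF imageI[OF that]] by (simp add: M_def)
  \<comment> \<open>A line that starts within \<open>R/2\<close> of \<open>p\<close> stays in
    \<open>cball p R\<close> up to this time. The radius \<open>r1\<close> chosen next makes
    \<open>d x > - s0 * c / 2\<close>, so that the zero is reached no later than
    \<open>s0\<close>.\<close>
  define s0 where "s0 = R / (2 * norm n)"
  have s0: "s0 > 0" using R n0 by (simp add: s0_def)
  have "isCont d p"
    using smooth_on_continuous[OF sd] by (simp add: continuous_on_eq_continuous_at)
  moreover have "s0 * c / 2 > 0" using s0 c by simp
  ultimately obtain r1 where r1: "r1 > 0" "\<And>x. dist x p < r1 \<Longrightarrow> dist (d x) (d p) < s0 * c / 2"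
    unfolding continuous_at_eps_delta by blast
  define r where "r = min r1 (R/2)"
  have r: "r > 0" using r1 R by (simp add: r_def)
  have line: "((\<lambda>s. F (x + s *\<^sub>R n)) has_real_derivative frechet_derivative F (at (x + s *\<^sub>R n)) n) (at s)"
    if "smooth_on V F" "x + s *\<^sub>R n \<in> V" for V and F :: "plane \<Rightarrow> real" and x s
  proof -
    have "((\<lambda>s. x + s *\<^sub>R n) has_derivative (\<lambda>s. s *\<^sub>R n)) (at s)"
      by (auto intro!: derivative_eq_intros)
    from has_derivative_imp_has_vector_derivative[OF has_derivative_compose[OF this smooth_on_has_derivative[OF that]]]
    show ?thesis by (simp add: has_real_derivative_iff_has_vector_derivative)
  qed
  have "\<bar>f x\<bar> \<le> (2 * M / c) * \<bar>d x\<bar>" if x: "x \<in> ball p r \<inter> \<Omega>" for x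
  proof -
    have dx: "d x < 0" "dist x p < r1" "dist x p < R/2"
      using x by (auto simp: \<Omega> r_def dist_commute)
    have seg: "x + s *\<^sub>R n \<in> cball p R" if "0 \<le> s" "s \<le> s0" for s
    proof -
      have "norm (s *\<^sub>R n) \<le> s0 * norm n"
        using that by (simp add: mult_right_mono)
      also have "\<dots> = R/2" using n0 by (simp add: s0_def)
      finally have "norm (s *\<^sub>R n) \<le> R/2" .
      moreover have "dist p (x + s *\<^sub>R n) \<le> dist p x + norm (s *\<^sub>R n)"
        using norm_triangle_ineq4[of "p - x" "s *\<^sub>R n"] by (simp add: dist_norm diff_diff_add)
      ultimately show ?thesis using dx(3) by (simp add: dist_commute)
    qed
    have mvt: "\<exists>z. 0 < z \<and> z < s \<and> d (x + s *\<^sub>R n) - d x = s * frechet_derivative d (at (x + z *\<^sub>R n)) n"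
      if "0 < s" for s
      using MVT2[OF that, of "\<lambda>s. d (x + s *\<^sub>R n)" "\<lambda>s. frechet_derivative d (at (x + s *\<^sub>R n)) n"] line[OF sd] by simp
    have grow: "d (x + s *\<^sub>R n) - d x \<ge> s * (c/2)" if "0 < s" "s \<le> s0" for s
    proof -
      obtain z where z: "0 < z" "z < s" "d (x + s *\<^sub>R n) - d x = s * frechet_derivative d (at (x + z *\<^sub>R n)) n"
        using mvt[OF \<open>0 < s\<close>] by blast
      have "s * (c/2) \<le> s * frechet_derivative d (at (x + z *\<^sub>R n)) n"
        using that z by (intro mult_left_mono dpos seg) auto
      then show ?thesis using z by simp
    qed
    have "d (x + s0 *\<^sub>R n) \<ge> 0"
      using grow[of s0] s0 r1(2)[OF dx(2)] p dx(1) by (simp add: dist_real_def)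
    moreover have "continuous_on {0..s0} (\<lambda>s. d (x + s *\<^sub>R n))"
      by (rule continuous_on_compose2[OF smooth_on_continuous[OF sd]]) (auto intro!: continuous_intros)
    ultimately obtain s where s: "0 \<le> s" "s \<le> s0" "d (x + s *\<^sub>R n) = 0"
      using IVT'[of "\<lambda>s. d (x + s *\<^sub>R n)" 0 0 s0] s0 dx(1) by auto
    have spos: "s > 0" using s dx(1) by (cases "s = 0") auto
    have z0: "f (x + s *\<^sub>R n) = 0"
      using f0 s seg RU by blast
    have fder: "((\<lambda>s. f (x + s *\<^sub>R n)) has_real_derivative frechet_derivative f (at (x + u *\<^sub>R n)) n) (at u)"
      if "0 \<le> u" "u \<le> s" for u
      using line[OF f] seg[of u] that s RU by auto
    obtain u where u: "0 < u" "u < s" "f (x + s *\<^sub>R n) - f (x + 0 *\<^sub>R n) = (s - 0) * frechet_derivative f (at (x + u *\<^sub>R n)) n"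
      using MVT2[OF spos fder] by blast
    have "\<bar>f x\<bar> = s * \<bar>frechet_derivative f (at (x + u *\<^sub>R n)) n\<bar>"
    proof -
      have "f x = - (s * frechet_derivative f (at (x + u *\<^sub>R n)) n)" using u(3) z0 by simp
      then show ?thesis using spos by (simp add: abs_mult)
    qed
    also have "\<dots> \<le> s * M"
      using spos u s by (intro mult_left_mono M seg) auto
    also have "\<dots> \<le> (2 * M / c) * \<bar>d x\<bar>"
    proof -
      have "s * (c/2) \<le> \<bar>d x\<bar>" using grow[OF spos s(2)] s(3) dx(1) by simp
      then have "s * (c/2) * (2 * M / c) \<le> \<bar>d x\<bar> * (2 * M / c)"
        using c by (intro mult_right_mono) (auto simp: M_def)
      then show ?thesis using c by (simp add: field_simps)
    qed
    finally show ?thesis .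
  qed
  then show ?thesis using r by blast
qed

lemma vanishing_bounded_by_defining_function:
  fixes f :: "plane \<Rightarrow> real"
  assumes d: "defining_function \<Omega> d" and \<Omega>: "bounded \<Omega>" and U: "open U" "closure \<Omega> \<subseteq> U"
    and f: "smooth_on U f" and f0: "\<And>x. x \<in> frontier \<Omega> \<Longrightarrow> f x = 0"
  obtains C where "C \<ge> 0" "\<And>x. x \<in> \<Omega> \<Longrightarrow> \<bar>f x\<bar> \<le> C * \<bar>d x\<bar>"
proof -
  have front: "frontier \<Omega> = {x. d x = 0}" and op: "open \<Omega>" using frontier_defining_function[OF d] by auto
  have sd: "smooth_on UNIV d" and \<Omega>d: "\<Omega> = {x. d x < 0}"
    using d by (auto simp: defining_function_def)
  have loc: "\<exists>r C. r > 0 \<and> (\<forall>x\<in>ball p r \<inter> \<Omega>. \<bar>f x\<bar> \<le> C * \<bar>d x\<bar>)" if p: "p \<in> closure \<Omega>" for p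
  proof (cases "p \<in> \<Omega>")
    case False
    then have "d p = 0" using p front op by (auto simp: frontier_def interior_open)
    then show ?thesis
      using vanishing_bounded_by_defining_function_local[OF d U(1) _ f] p U(2) f0 front by blast
  next
    \<comment> \<open>Near an interior point \<open>d\<close> is bounded away from 0, so an upper
      bound for \<open>f\<close> divided by a lower bound for \<open>\<bar>d\<bar>\<close> is a
      suitable constant.\<close>
    case True
    have "isCont f p" "isCont d p"
      using smooth_on_continuous[OF f] smooth_on_continuous[OF sd] U p by (auto simp: continuous_on_eq_continuous_at)
    moreover have dp: "\<bar>d p\<bar> / 2 > 0" using True by (simp add: \<Omega>d)
    ultimately obtain r1 r2 where r: "r1 > 0" "\<And>x. dist x p < r1 \<Longrightarrow> dist (f x) (f p) < 1"
        "r2 > 0" "\<And>x. dist x p < r2 \<Longrightarrow> dist (d x) (d p) < \<bar>d p\<bar> / 2"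
      unfolding continuous_at_eps_delta by (metis zero_less_one)
    have "\<bar>f x\<bar> \<le> (\<bar>f p\<bar> + 1) / (\<bar>d p\<bar> / 2) * \<bar>d x\<bar>" if "x \<in> ball p (min r1 r2)" for x
    proof -
      have 1: "\<bar>f x\<bar> \<le> \<bar>f p\<bar> + 1" "\<bar>d p\<bar> / 2 \<le> \<bar>d x\<bar>"
        using r(2)[of x] r(4)[of x] that by (auto simp: dist_real_def dist_commute abs_if split: if_splits)
      have "\<bar>f p\<bar> + 1 = (\<bar>f p\<bar> + 1) / (\<bar>d p\<bar> / 2) * (\<bar>d p\<bar> / 2)" using dp by simp
      also have "\<dots> \<le> (\<bar>f p\<bar> + 1) / (\<bar>d p\<bar> / 2) * \<bar>d x\<bar>"
        using 1 dp by (intro mult_left_mono) auto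
      finally show ?thesis using 1 by linarith
    qed
    then show ?thesis
      using r by (intro exI[of _ "min r1 r2"] exI[of _ "(\<bar>f p\<bar> + 1) / (\<bar>d p\<bar> / 2)"]) auto
  qed
  then obtain r C where rC: "\<And>p. p \<in> closure \<Omega> \<Longrightarrow> r p > 0 \<and> (\<forall>x\<in>ball p (r p) \<inter> \<Omega>. \<bar>f x\<bar> \<le> C p * \<bar>d x\<bar>)"
    by metis
  obtain F where F: "F \<subseteq> closure \<Omega>" "finite F" "closure \<Omega> \<subseteq> (\<Union>p\<in>F. ball p (r p))"
  proof (rule compactE_image)
    show "compact (closure \<Omega>)" using \<Omega> by simp
    show "closure \<Omega> \<subseteq> (\<Union>p\<in>closure \<Omega>. ball p (r p))" using rC by force
  qed auto
  have "\<bar>f x\<bar> \<le> (\<Sum>p\<in>F. \<bar>C p\<bar>) * \<bar>d x\<bar>" if x: "x \<in> \<Omega>" for x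
  proof -
    obtain p where p: "p \<in> F" "x \<in> ball p (r p)" using F(3) x closure_subset by blast
    then have "\<bar>f x\<bar> \<le> C p * \<bar>d x\<bar>" using rC[of p] F(1) x by auto
    also have "\<dots> \<le> (\<Sum>p\<in>F. \<bar>C p\<bar>) * \<bar>d x\<bar>"
      using member_le_sum[OF p(1), of "\<lambda>p. \<bar>C p\<bar>"] F(2) by (intro mult_right_mono) auto
    finally show ?thesis .
  qed
  moreover have "0 \<le> (\<Sum>p\<in>F. \<bar>C p\<bar>)" by (rule sum_nonneg) simp
  ultimately show ?thesis using that by metis
qed

lemma has_real_derivative_quadratic_error:
  fixes f :: "real \<Rightarrow> real"
  assumes "\<And>y. \<bar>f y - f x - D * (y - x)\<bar> \<le> (y - x)\<^sup>2"
  shows "(f has_real_derivative D) (at x)"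
proof -
  have "((\<lambda>h. (f (x + h) - f x) / h - D) \<longlongrightarrow> 0) (at 0)"
  proof (rule Lim_null_comparison)
    show "\<forall>\<^sub>F h in at 0. norm ((f (x + h) - f x) / h - D) \<le> \<bar>h\<bar>"
      unfolding eventually_at_filter
    proof (rule always_eventually, intro allI impI)
      fix h :: real assume h: "h \<noteq> 0"
      have "(f (x + h) - f x) / h - D = (f (x + h) - f x - D * (x + h - x)) / h"
        using h by (simp add: field_simps)
      then have "\<bar>(f (x + h) - f x) / h - D\<bar> = \<bar>f (x + h) - f x - D * (x + h - x)\<bar> / \<bar>h\<bar>"
        by (simp only: abs_divide)
      also have "\<dots> \<le> (x + h - x)\<^sup>2 / \<bar>h\<bar>"
        by (intro divide_right_mono assms) simp
      also have "\<dots> = \<bar>h\<bar>" using h by (simp add: power2_eq_square abs_if)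
      finally show "norm ((f (x + h) - f x) / h - D) \<le> \<bar>h\<bar>" by simp
    qed
    show "((\<lambda>h. \<bar>h\<bar>) \<longlongrightarrow> 0) (at (0::real))"
      using tendsto_rabs_zero[OF tendsto_ident_at] .
  qed
  then show ?thesis unfolding DERIV_def by (rule Lim_null[THEN iffD2])
qed

text \<open>Squaring makes the truncation continuously differentiable across 0. This is the
  regularity needed to extend the cut-off field by zero.\<close>

lemma has_real_derivative_max_0_sq: "((\<lambda>s. (max 0 s)\<^sup>2) has_real_derivative 2 * max 0 r) (at (r::real))"
proof (rule has_real_derivative_quadratic_error)
  fix y :: real
  consider "y \<ge> 0" "r \<ge> 0" | "y < 0" "r < 0" | "y < 0" "r \<ge> 0" | "y \<ge> 0" "r < 0" by linarith
  then show "\<bar>(max 0 y)\<^sup>2 - (max 0 r)\<^sup>2 - 2 * max 0 r * (y - r)\<bar> \<le> (y - r)\<^sup>2"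
  proof cases
    case 1
    then have "(max 0 y)\<^sup>2 - (max 0 r)\<^sup>2 - 2 * max 0 r * (y - r) = (y - r)\<^sup>2"
      by (simp add: power2_eq_square algebra_simps)
    then show ?thesis by simp
  next
    case 3
    then have "(max 0 y)\<^sup>2 - (max 0 r)\<^sup>2 - 2 * max 0 r * (y - r) = (y - r)\<^sup>2 - y\<^sup>2"
      by (simp add: power2_eq_square algebra_simps)
    moreover have "(y - r)\<^sup>2 - y\<^sup>2 = r\<^sup>2 + 2 * r * (- y)" by (simp add: power2_eq_square algebra_simps)
    moreover have "r\<^sup>2 + 2 * r * (- y) \<ge> 0" using 3 by (intro add_nonneg_nonneg mult_nonneg_nonneg) auto
    ultimately show ?thesis using zero_le_power2[of y] by linarith
  next
    case 4
    then have "(y - r)\<^sup>2 = y\<^sup>2 + (r\<^sup>2 + 2 * y * (- r))" by (simp add: power2_eq_square algebra_simps)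
    moreover have "r\<^sup>2 + 2 * y * (- r) \<ge> 0" using 4 by (intro add_nonneg_nonneg mult_nonneg_nonneg) auto
    ultimately show ?thesis using 4 by simp
  qed simp
qed

lemma has_derivative_cutoff:
  defines "m \<equiv> \<lambda>s :: real. max 0 (- s - 1)"
  shows "((\<lambda>s. 1 - 1 / (1 + (m s)\<^sup>2)) has_real_derivative - 2 * m s / (1 + (m s)\<^sup>2)\<^sup>2) (at s)"
proof -
  have "((\<lambda>s. - s - 1) has_real_derivative -1) (at s)"
    by (auto intro!: derivative_eq_intros)
  from DERIV_chain2[OF has_real_derivative_max_0_sq this]
  have "((\<lambda>s. (m s)\<^sup>2) has_real_derivative - 2 * m s) (at s)"
    by (simp add: m_def)
  moreover have "1 + (m s)\<^sup>2 \<noteq> 0" using zero_le_power2[of "m s"] by linarith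
  moreover have "((\<lambda>s. 1 - 1 / (1 + N s)) has_real_derivative D / (1 + N s)\<^sup>2) (at s)"
    if "(N has_real_derivative D) (at s)" "1 + N s \<noteq> 0" for N D
    using that by (auto intro!: derivative_eq_intros simp: power2_eq_square)
  ultimately show ?thesis by blast
qed

text \<open>The field is multiplied by the cutoff \<open>1 - 1 / (1 + m\<^sup>2)\<close> with \<open>m = max 0 (- k d - 1)\<close>, which
  is supported in \<open>d \<le> - 1 / k\<close>. The term with the derivative of the cutoff is bounded because
  the normal component of the field is \<open>O(d)\<close> near the boundary.\<close>

theorem integral_divg_tangent_field:
  assumes d: "defining_function \<Omega> d" and bd: "bounded \<Omega>" and U: "open U" "closure \<Omega> \<subseteq> U"
    and F: "smooth_on U F" and tang: "\<And>x. x \<in> frontier \<Omega> \<Longrightarrow> F x \<bullet> grad d x = 0"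
  shows "(LINT x:\<Omega>|lborel. divg F x) = 0"
proof -
  have op: "open \<Omega>" using frontier_defining_function[OF d] by auto
  have sd: "smooth_on UNIV d" and \<Omega>d: "\<Omega> = {x. d x < 0}"
    using d by (auto simp: defining_function_def)
  have subU: "\<Omega> \<subseteq> U" using U closure_subset by blast
  have smgrad: "smooth_on U (\<lambda>x. grad d x)"
    unfolding grad_def
    by (intro smooth_intros smooth_on_frechet_derivative smooth_on_subset[OF sd] U) auto
  define f where "f x = F x \<bullet> grad d x" for x
  have smf: "smooth_on U f" unfolding f_def by (intro smooth_intros F smgrad U)
  obtain C where C: "C \<ge> 0" "\<And>x. x \<in> \<Omega> \<Longrightarrow> \<bar>f x\<bar> \<le> C * \<bar>d x\<bar>"
    using vanishing_bounded_by_defining_function[OF d bd U smf] tang by (auto simp: f_def)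
  define \<phi> where "\<phi> s = 1 - 1 / (1 + (max 0 (- s - 1))\<^sup>2)" for s :: real
  define \<phi>' where "\<phi>' s = - 2 * max 0 (- s - 1) / (1 + (max 0 (- s - 1))\<^sup>2)\<^sup>2" for s :: real
  have d\<phi>: "(\<phi> has_real_derivative \<phi>' s) (at s)" for s
    using has_derivative_cutoff[of s] unfolding \<phi>_def[abs_def] \<phi>'_def .
  have c\<phi>: "continuous_on UNIV \<phi>"
    using d\<phi> by (auto intro!: continuous_at_imp_continuous_on DERIV_isCont)
  have pos: "1 + (max 0 (- s - 1))\<^sup>2 \<noteq> 0" for s :: real
    using zero_le_power2[of "max 0 (- s - 1)"] by linarith
  have c\<phi>': "continuous_on UNIV \<phi>'"
    unfolding \<phi>'_def[abs_def] using pos by (intro continuous_intros) auto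
  have \<phi>0: "\<phi> s = 0" "\<phi>' s = 0" if "s > -1" for s
    using that by (auto simp: \<phi>_def \<phi>'_def max_def)
  have cF: "continuous_on U (\<lambda>x. frechet_derivative F (at x) v)" for v
    by (rule smooth_on_continuous[OF smooth_on_frechet_derivative[OF F]])
  have cD: "continuous_on U (\<lambda>x. frechet_derivative d (at x) v)" for v
    by (rule continuous_on_subset[OF smooth_on_continuous[OF smooth_on_frechet_derivative[OF sd]]]) auto
  have cd: "continuous_on U d" by (rule continuous_on_subset[OF smooth_on_continuous[OF sd]]) auto
  \<comment> \<open>The derivative in direction \<open>v\<close> of the \<open>i\<close>-th
    component of the cut-off field. The scale of the cutoff is \<open>Suc k\<close>, which is never
    0.\<close>
  define E where "E k i x v = \<phi> (real (Suc k) * d x) * frechet_derivative F (at x) v $ i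
      + (real (Suc k) * frechet_derivative d (at x) v) * \<phi>' (real (Suc k) * d x) * F x $ i" for k i x v
  have cE: "continuous_on U (\<lambda>x. E k i x v)" for k i v
    unfolding E_def
    by (intro continuous_intros cF cD smooth_on_continuous[OF F]
        continuous_on_compose2[OF c\<phi>] continuous_on_compose2[OF c\<phi>'] cd) auto
  have E_int: "set_integrable lborel \<Omega> (\<lambda>x. E k i x v)" for k i v
    by (rule set_integrable_continuous_closure[OF op bd continuous_on_subset[OF cE U(2)]])
  have E0: "(LINT x:\<Omega>|lborel. E k i x v) = 0" for k i v
  proof -
    \<comment> \<open>On \<open>Z\<close> the argument of the cutoff exceeds -1, where the cutoff
      and its derivative vanish. As the open sets \<open>Z\<close> and \<open>\<Omega>\<close> cover
      the plane, the extension by zero is continuously differentiable everywhere.\<close>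
    define Z where "Z = {x. real (Suc k) * d x > -1}"
    have Z: "open Z"
      unfolding Z_def
      using open_Collect_less[OF continuous_on_const[of UNIV "-1"] continuous_on_mult_left[OF smooth_on_continuous[OF sd]]]
      by simp
    have cover: "\<Omega> \<union> Z = UNIV"
    proof -
      have "real (Suc k) * d x > -1" if "\<not> d x < 0" for x
      proof -
        have "0 \<le> real (Suc k) * d x" using that by (intro mult_nonneg_nonneg) auto
        then show ?thesis by linarith
      qed
      then show ?thesis by (auto simp: \<Omega>d Z_def)
    qed
    define G where "G x = (if x \<in> \<Omega> then \<phi> (real (Suc k) * d x) * F x $ i else 0)" for x
    define G' where "G' x v = (if x \<in> \<Omega> then E k i x v else 0)" for x v
    have GZ: "G x = 0" "G' x v = 0" if "x \<in> Z" for x v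
      using \<phi>0[of "real (Suc k) * d x"] that by (auto simp: G_def G'_def E_def Z_def)
    have dG: "(G has_derivative G' x) (at x)" for x
    proof (cases "x \<in> \<Omega>")
      case True
      have "((\<lambda>x. real (Suc k) * d x) has_derivative (\<lambda>v. real (Suc k) * frechet_derivative d (at x) v)) (at x)"
        by (intro has_derivative_mult_right smooth_on_has_derivative[OF sd]) auto
      from DERIV_compose_FDERIV[OF d\<phi> this]
      have 1: "((\<lambda>x. \<phi> (real (Suc k) * d x)) has_derivative
        (\<lambda>v. real (Suc k) * frechet_derivative d (at x) v * \<phi>' (real (Suc k) * d x))) (at x)" .
      have 2: "((\<lambda>x. F x $ i) has_derivative (\<lambda>v. frechet_derivative F (at x) v $ i)) (at x)"
        by (rule bounded_linear.has_derivative[OF bounded_linear_vec_nth smooth_on_has_derivative[OF F]])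
          (use True subU in auto)
      have "G' x = (\<lambda>v. E k i x v)" using True by (simp add: G'_def fun_eq_iff)
      with has_derivative_mult[OF 1 2] have "((\<lambda>x. \<phi> (real (Suc k) * d x) * F x $ i) has_derivative G' x) (at x)"
        by (simp add: E_def)
      then show ?thesis
        by (rule has_derivative_transform_within_open[OF _ op True]) (simp add: G_def)
    next
      case False
      then have x: "x \<in> Z" using cover by auto
      have "((\<lambda>x. 0) has_derivative (\<lambda>v. 0)) (at x)" by simp
      then have "(G has_derivative (\<lambda>v. 0)) (at x)"
        by (rule has_derivative_transform_within_open[OF _ Z x]) (simp add: GZ)
      moreover have "G' x = (\<lambda>v. 0)" using GZ(2)[OF x] by (simp add: fun_eq_iff)
      ultimately show ?thesis by simp
    qed
    have "continuous_on (\<Omega> \<union> Z) (\<lambda>x. G' x v)"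
    proof (rule continuous_on_open_Un[OF op Z])
      show "continuous_on \<Omega> (\<lambda>x. G' x v)"
        by (rule continuous_on_eq[OF continuous_on_subset[OF cE subU]]) (simp add: G'_def)
      show "continuous_on Z (\<lambda>x. G' x v)"
        by (rule continuous_on_eq[OF continuous_on_const[of Z 0]]) (simp add: GZ)
    qed
    then have cG': "continuous_on UNIV (\<lambda>x. G' x v)" by (simp add: cover)
    obtain B where B: "\<forall>x\<in>\<Omega>. norm x \<le> B" using bd unfolding bounded_iff by blast
    have "(LINT x|lborel. G' x v) = 0"
      by (rule integral_directional_derivative_zero[OF dG cG', of B]) (use B in \<open>auto simp: G_def not_le[symmetric]\<close>)
    moreover have "(LINT x|lborel. G' x v) = (LINT x:\<Omega>|lborel. E k i x v)"
      unfolding set_lebesgue_integral_def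
      by (intro Bochner_Integration.integral_cong) (auto simp: G'_def indicator_def)
    ultimately show ?thesis by simp
  qed
  \<comment> \<open>The divergence of the cut-off field. It splits into \<open>divg F\<close> with
    weight \<open>1 - w k x\<close> and a multiple of \<open>f\<close>, the component of the field
    along \<open>grad d\<close>.\<close>
  define H where "H k x = E k 1 x (axis 1 1) + E k 2 x (axis 2 1)" for k x
  have H0: "(LINT x:\<Omega>|lborel. H k x) = 0" for k
    unfolding H_def using set_integral_add(2)[OF E_int E_int] by (simp add: E0)
  have H_int: "set_integrable lborel \<Omega> (\<lambda>x. H k x)" for k
    unfolding H_def by (rule set_integral_add(1)[OF E_int E_int])
  have smdiv: "continuous_on U (divg F)"
    unfolding divg_eq by (intro continuous_intros cF)
  have div_int: "set_integrable lborel \<Omega> (divg F)"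
    by (rule set_integrable_continuous_closure[OF op bd continuous_on_subset[OF smdiv U(2)]])
  define w where "w k x = 1 / (1 + (max 0 (- (real (Suc k) * d x) - 1))\<^sup>2)" for k x
  have H_eq: "H k x = (1 - w k x) * divg F x + real (Suc k) * \<phi>' (real (Suc k) * d x) * f x" for k x
  proof -
    have "f x = F x $ 1 * frechet_derivative d (at x) (axis 1 1) + F x $ 2 * frechet_derivative d (at x) (axis 2 1)"
      by (simp add: f_def inner_vec_def sum_2 grad_def)
    then show ?thesis
      by (simp add: H_def E_def divg_eq \<phi>_def w_def algebra_simps)
  qed
  have w: "0 \<le> w k x" "w k x \<le> 1" for k x
  proof -
    have "0 \<le> 1 / (1 + z\<^sup>2)" "1 / (1 + z\<^sup>2) \<le> 1" for z :: real
    proof -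
      have z: "1 + z\<^sup>2 \<ge> 1" by simp
      then show "0 \<le> 1 / (1 + z\<^sup>2)" by (intro divide_nonneg_nonneg) linarith+
      show "1 / (1 + z\<^sup>2) \<le> 1" using z by (subst pos_divide_le_eq) (linarith, simp)
    qed
    then show "0 \<le> w k x" "w k x \<le> 1" unfolding w_def by blast+
  qed
  \<comment> \<open>Where the cutoff is active,
    \<open>real (Suc k) * \<bar>d x\<bar> = m + 1\<close>, which absorbs the large factor in its
    derivative. The constant 4 comes from \<open>m * (m + 1) \<le> 2 * (1 + m\<^sup>2)\<close>.
    Keeping \<open>w k x\<close> in the bound makes the term tend to 0 pointwise, beyond being
    dominated.\<close>
  have err: "\<bar>real (Suc k) * \<phi>' (real (Suc k) * d x) * f x\<bar> \<le> 4 * C * w k x" if x: "x \<in> \<Omega>" for k x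
  proof -
    define m where "m = max 0 (- (real (Suc k) * d x) - 1)"
    have m: "m \<ge> 0" by (simp add: m_def)
    have m1: "1 + m\<^sup>2 \<ge> 1" by simp
    have \<phi>'m: "\<bar>\<phi>' (real (Suc k) * d x)\<bar> = 2 * m / (1 + m\<^sup>2)\<^sup>2"
    proof -
      have "\<phi>' (real (Suc k) * d x) = - 2 * m / (1 + m\<^sup>2)\<^sup>2" by (simp only: \<phi>'_def m_def)
      then show ?thesis using m by (simp add: abs_mult)
    qed
    have wm: "w k x = 1 / (1 + m\<^sup>2)" by (simp only: w_def m_def)
    show ?thesis
    proof (cases "m = 0")
      case True
      then have "\<phi>' (real (Suc k) * d x) = 0" using \<phi>'m by simp
      then show ?thesis using C(1) w(1)[of k x] by simp
    next
      case False
      have dx: "d x < 0" using x by (simp add: \<Omega>d)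
      have kd: "real (Suc k) * \<bar>d x\<bar> = m + 1" using False dx by (simp add: m_def max_def split: if_splits)
      have "\<bar>real (Suc k) * \<phi>' (real (Suc k) * d x) * f x\<bar> = real (Suc k) * (2 * m / (1 + m\<^sup>2)\<^sup>2) * \<bar>f x\<bar>"
        by (simp only: abs_mult \<phi>'m abs_of_nat)
      also have "\<dots> \<le> real (Suc k) * (2 * m / (1 + m\<^sup>2)\<^sup>2) * (C * \<bar>d x\<bar>)"
        using m by (intro mult_left_mono C(2) x) auto
      also have "\<dots> = 2 * C * (m * (m + 1)) / (1 + m\<^sup>2)\<^sup>2"
        unfolding kd[symmetric] by simp
      also have "\<dots> \<le> 2 * C * (2 * (1 + m\<^sup>2)) / (1 + m\<^sup>2)\<^sup>2"
      proof -
        have "m * (m + 1) \<le> 2 * (1 + m\<^sup>2)"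
          using zero_le_power2[of "m - 1"] m by (simp add: power2_eq_square algebra_simps)
        then show ?thesis using C(1) by (intro divide_right_mono mult_left_mono) auto
      qed
      also have "\<dots> = 4 * C * w k x"
      proof -
        have "2 * C * (2 * n) / n\<^sup>2 = 4 * C * (1 / n)" if "n \<ge> 1" for n :: real
          using that by (simp add: field_simps power2_eq_square)
        from this[OF m1] show ?thesis by (simp only: wm)
      qed
      finally show ?thesis .
    qed
  qed
  have w_lim: "(\<lambda>k. w k x) \<longlonglongrightarrow> 0" if x: "x \<in> \<Omega>" for x
  proof (rule tendsto_sandwich[where f = "\<lambda>_. 0"])
    have dx: "d x < 0" using x by (simp add: \<Omega>d)
    show "\<forall>\<^sub>F k in sequentially. w k x \<le> (2 / (- d x)) / real (Suc k)"
    proof (rule always_eventually, rule allI)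
      fix k
      define m where "m = max 0 (- (real (Suc k) * d x) - 1)"
      have "real (Suc k) * (- d x) > 0" using dx by (intro mult_pos_pos) auto
      moreover have "real (Suc k) * (- d x) \<le> m + 1" by (simp add: m_def)
      \<comment> \<open>Bounds \<open>w k x\<close> by a multiple of \<open>1 / (m + 1)\<close>,
        hence of \<open>1 / real (Suc k)\<close>, at each fixed point of
        \<open>\<Omega>\<close>.\<close>
      moreover have "(m + 1) / 2 \<le> 1 + m\<^sup>2"
        using zero_le_power2[of "m - 1/4"] by (simp add: power2_eq_square algebra_simps)
      moreover have "1 / (1 + m\<^sup>2) \<le> 1 / (p / 2)"
        if "p > 0" "p \<le> m + 1" "(m + 1) / 2 \<le> 1 + m\<^sup>2" for p
      proof (rule divide_left_mono)
        have "p / 2 \<le> (m + 1) / 2" using that(2) by (rule divide_right_mono) simp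
        then show "p / 2 \<le> 1 + m\<^sup>2" using that(3) by (rule order_trans)
        have "1 + m\<^sup>2 > 0" by (intro add_pos_nonneg) auto
        then show "(1 + m\<^sup>2) * (p / 2) > 0" using that(1) by (intro mult_pos_pos) auto
      qed simp
      ultimately have "1 / (1 + m\<^sup>2) \<le> 1 / (real (Suc k) * (- d x) / 2)"
        by blast
      also have "\<dots> = (2 / (- d x)) / real (Suc k)"
      proof -
        have "1 / (a * b / 2) = (2 / b) / a" for a b :: real by simp
        then show ?thesis .
      qed
      finally show "w k x \<le> (2 / (- d x)) / real (Suc k)" by (simp add: w_def m_def)
    qed
    show "(\<lambda>k. (2 / (- d x)) / real (Suc k)) \<longlonglongrightarrow> 0"
      by (rule LIMSEQ_Suc[OF lim_const_over_n])
  qed (use w in auto)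
  have H_lim: "(\<lambda>k. H k x) \<longlonglongrightarrow> divg F x" if x: "x \<in> \<Omega>" for x
  proof -
    have "(\<lambda>k. real (Suc k) * \<phi>' (real (Suc k) * d x) * f x) \<longlonglongrightarrow> 0"
      by (rule Lim_null_comparison[OF always_eventually tendsto_mult_right_zero[OF w_lim[OF x], of "4 * C"]])
        (use err[OF x] in auto)
    moreover have "(\<lambda>k. (1 - w k x) * divg F x) \<longlonglongrightarrow> (1 - 0) * divg F x"
      by (intro tendsto_intros w_lim x)
    ultimately have "(\<lambda>k. (1 - w k x) * divg F x + real (Suc k) * \<phi>' (real (Suc k) * d x) * f x) \<longlonglongrightarrow> (1 - 0) * divg F x + 0"
      by (intro tendsto_add)
    then show ?thesis by (simp add: H_eq)
  qed
  have H_bound: "\<bar>H k x\<bar> \<le> \<bar>divg F x\<bar> + 4 * C" if x: "x \<in> \<Omega>" for k x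
  proof -
    have "\<bar>(1 - w k x) * divg F x\<bar> \<le> \<bar>divg F x\<bar>"
      using w[of k x] by (auto simp: abs_mult intro!: mult_left_le_one_le)
    moreover have "4 * C * w k x \<le> 4 * C" using w[of k x] C(1) by (intro mult_left_le) auto
    ultimately show ?thesis
      unfolding H_eq using err[OF x, of k] by (intro order_trans[OF abs_triangle_ineq]) linarith
  qed
  have "(\<lambda>k. LINT x|lborel. indicator \<Omega> x *\<^sub>R H k x) \<longlonglongrightarrow> (LINT x|lborel. indicator \<Omega> x *\<^sub>R divg F x)"
  proof (rule integral_dominated_convergence)
    have "set_integrable lborel \<Omega> (\<lambda>x. \<bar>divg F x\<bar> + 4 * C)"
      by (rule set_integrable_continuous_closure[OF op bd])
        (intro continuous_intros continuous_on_subset[OF smdiv U(2)])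
    then show "integrable lborel (\<lambda>x. indicator \<Omega> x *\<^sub>R (\<bar>divg F x\<bar> + 4 * C))"
      by (simp add: set_integrable_def)
    show "(\<lambda>x. indicator \<Omega> x *\<^sub>R divg F x) \<in> borel_measurable lborel"
      using div_int by (simp add: set_integrable_def borel_measurable_integrable)
    show "(\<lambda>x. indicator \<Omega> x *\<^sub>R H k x) \<in> borel_measurable lborel" for k
      using H_int by (simp add: set_integrable_def borel_measurable_integrable)
    show "AE x in lborel. (\<lambda>k. indicator \<Omega> x *\<^sub>R H k x) \<longlonglongrightarrow> indicator \<Omega> x *\<^sub>R divg F x"
      using H_lim by (intro AE_I2) (auto simp: indicator_def)
    show "AE x in lborel. norm (indicator \<Omega> x *\<^sub>R H k x) \<le> indicator \<Omega> x *\<^sub>R (\<bar>divg F x\<bar> + 4 * C)" for k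
      using H_bound by (intro AE_I2) (auto simp: indicator_def)
  qed
  then show ?thesis
    using H0 LIMSEQ_unique[OF _ tendsto_const] unfolding set_lebesgue_integral_def by simp
qed

section \<open>Integration by parts for the Green--Naghdi metric\<close>

lemma grad_inner:
  assumes "(f has_derivative D) (at x)"
  shows "grad f x \<bullet> v = D v"
proof -
  have "f differentiable (at x)" using assms by (rule differentiableI)
  from frechet_derivative_eq_grad[OF this, of v] frechet_derivative_at[OF assms] show ?thesis by simp
qed

lemma grad_eqI:
  assumes "(f has_derivative (\<lambda>v. g \<bullet> v)) (at x)"
  shows "grad f x = g"
  by (rule vector_eq_rdot[THEN iffD1, OF allI]) (rule grad_inner[OF assms])

lemma has_derivative_grad: "f differentiable (at x) \<Longrightarrow> (f has_derivative (\<lambda>v. grad f x \<bullet> v)) (at x)"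
proof -
  assume f: "f differentiable (at x)"
  have "frechet_derivative f (at x) = (\<lambda>v. grad f x \<bullet> v)"
    by (rule ext) (rule frechet_derivative_eq_grad[OF f])
  with f[unfolded frechet_derivative_works] show ?thesis by simp
qed

lemma jacobian_mult: "F differentiable (at x) \<Longrightarrow> jacobian F (at x) *v w = frechet_derivative F (at x) w"
  for F :: "plane \<Rightarrow> plane"
  by (rule fun_cong[OF frechet_derivative_at[OF jacobian_works[THEN iffD1]]])

text \<open>The transposed Jacobian only ever enters through its pairing with a test vector, where
  it becomes an ordinary directional derivative.\<close>

lemma inner_transpose_jacobian:
  "F differentiable (at x) \<Longrightarrow> (transpose (jacobian F (at x)) *v w) \<bullet> h = w \<bullet> frechet_derivative F (at x) h"
  for F :: "plane \<Rightarrow> plane"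
  by (simp only: jacobian_mult[symmetric] dot_lmul_matrix[symmetric] transpose_matrix_vector)

lemma grad_add:
  "f differentiable (at x) \<Longrightarrow> g differentiable (at x) \<Longrightarrow> grad (\<lambda>y. f y + g y) x = grad f x + grad g x"
  by (rule grad_eqI) (auto simp: inner_add_left intro!: has_derivative_add has_derivative_grad)

lemma grad_diff:
  "f differentiable (at x) \<Longrightarrow> g differentiable (at x) \<Longrightarrow> grad (\<lambda>y. f y - g y) x = grad f x - grad g x"
  by (rule grad_eqI) (auto simp: inner_diff_left intro!: has_derivative_diff has_derivative_grad)

lemma grad_cmult: "f differentiable (at x) \<Longrightarrow> grad (\<lambda>y. c * f y) x = c *\<^sub>R grad f x"
  by (rule grad_eqI) (auto intro!: has_derivative_mult_right has_derivative_grad)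

lemma divg_eqI:
  assumes "(F has_derivative D) (at x)"
  shows "divg F x = D (axis 1 1) $ 1 + D (axis 2 1) $ 2"
  unfolding divg_eq frechet_derivative_at[OF assms, symmetric] ..

lemma divg_scaleR:
  assumes "f differentiable (at x)" and "F differentiable (at x)"
  shows "divg (\<lambda>y. f y *\<^sub>R F y) x = f x * divg F x + grad f x \<bullet> F x"
proof -
  have "((\<lambda>y. f y *\<^sub>R F y) has_derivative (\<lambda>v. f x *\<^sub>R frechet_derivative F (at x) v + (grad f x \<bullet> v) *\<^sub>R F x)) (at x)"
    using assms by (intro has_derivative_scaleR has_derivative_grad) (simp_all add: frechet_derivative_works[symmetric])
  from divg_eqI[OF this] show ?thesis
    by (simp add: divg_eq inner_vec_def sum_2 axis_def algebra_simps)
qed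

lemma smooth_on_grad: "open U \<Longrightarrow> smooth_on U f \<Longrightarrow> smooth_on U (grad f)"
  unfolding grad_def[abs_def] by (intro smooth_intros smooth_on_frechet_derivative)

lemma smooth_on_divg: "open U \<Longrightarrow> smooth_on U F \<Longrightarrow> smooth_on U (divg F)"
  unfolding divg_eq[abs_def] by (intro smooth_intros smooth_on_frechet_derivative)

lemma smooth_on_grad_param:
  "open T \<Longrightarrow> open U \<Longrightarrow> smooth_on (T \<times> U) (\<lambda>p. f (fst p) (snd p)) \<Longrightarrow>
    smooth_on (T \<times> U) (\<lambda>p. grad (f (fst p)) (snd p))"
  unfolding grad_def by (intro smooth_on_vec_lambda open_Times smooth_on_frechet_param)

lemma smooth_on_divg_param:
  "open T \<Longrightarrow> open U \<Longrightarrow> smooth_on (T \<times> U) (\<lambda>p. F (fst p) (snd p)) \<Longrightarrow>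
    smooth_on (T \<times> U) (\<lambda>p. divg (F (fst p)) (snd p))"
  unfolding divg_eq by (intro smooth_on_add smooth_on_vec_nth open_Times smooth_on_frechet_param)

lemma smooth_on_space:
  "open T \<Longrightarrow> open U \<Longrightarrow> smooth_on U f \<Longrightarrow> smooth_on (T \<times> U) (\<lambda>p. f (snd p))"
  by (rule smooth_on_compose[of U f]) (auto intro!: open_Times smooth_on_snd smooth_on_ident)

text \<open>The direction varies with \<open>x\<close>, so it is expanded in the two coordinate axes
  with smooth coefficients.\<close>

lemma smooth_on_frechet_apply:
  fixes F G :: "plane \<Rightarrow> plane"
  assumes U: "open U" and F: "smooth_on U F" and G: "smooth_on U G"
  shows "smooth_on U (\<lambda>x. frechet_derivative F (at x) (G x))"
proof (rule smooth_on_cong[OF U])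
  show "smooth_on U (\<lambda>x. G x $ 1 *\<^sub>R frechet_derivative F (at x) (axis 1 1) + G x $ 2 *\<^sub>R frechet_derivative F (at x) (axis 2 1))"
    by (intro smooth_intros assms smooth_on_frechet_derivative)
  show "G x $ 1 *\<^sub>R frechet_derivative F (at x) (axis 1 1) + G x $ 2 *\<^sub>R frechet_derivative F (at x) (axis 2 1) =
      frechet_derivative F (at x) (G x)" if "x \<in> U" for x
    by (rule linear_plane[symmetric, OF linear_frechet_derivative[OF smooth_on_differentiable[OF F that]]])
qed

section \<open>The density of the metric and the associated operator\<close>

definition gn_density ::
  "(plane \<Rightarrow> real) \<Rightarrow> (plane \<Rightarrow> real) \<Rightarrow> (plane \<Rightarrow> plane) \<Rightarrow> (plane \<Rightarrow> plane) \<Rightarrow> plane \<Rightarrow> real" where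
  "gn_density b \<rho> \<xi> \<eta> x =
     \<rho> x * (\<xi> x \<bullet> \<eta> x)
   + 1/3 * \<rho> x ^ 3 * divg \<xi> x * divg \<eta> x
   + 1/2 * \<rho> x ^ 2 * divg \<xi> x * (\<eta> x \<bullet> grad b x)
   + 1/2 * \<rho> x ^ 2 * divg \<eta> x * (\<xi> x \<bullet> grad b x)
   + \<rho> x * (\<xi> x \<bullet> grad b x) * (\<eta> x \<bullet> grad b x)"

lemma gn_metric_eq:
  "gn_metric \<Omega> b \<rho>0 X V W =
    (LINT x:\<Omega>|lborel. gn_density b (mass_density \<Omega> \<rho>0 X) (eulerian \<Omega> X V) (eulerian \<Omega> X W) x)"
  by (simp add: gn_metric_def gn_density_def Let_def)

lemma gn_density_commute: "gn_density b \<rho> \<xi> \<eta> x = gn_density b \<rho> \<eta> \<xi> x"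
  by (simp add: gn_density_def inner_commute algebra_simps)

lemma gn_density_cong_open:
  assumes "open S" and "x \<in> S"
    and "\<And>y. y \<in> S \<Longrightarrow> b y = b' y" "\<And>y. y \<in> S \<Longrightarrow> \<rho> y = \<rho>' y"
    and "\<And>y. y \<in> S \<Longrightarrow> \<xi> y = \<xi>' y" "\<And>y. y \<in> S \<Longrightarrow> \<eta> y = \<eta>' y"
  shows "gn_density b \<rho> \<xi> \<eta> x = gn_density b' \<rho>' \<xi>' \<eta>' x"
  using grad_cong_open[OF assms(1-3)] divg_cong_open[OF assms(1,2,5)] divg_cong_open[OF assms(1,2,6)] assms
  by (simp add: gn_density_def)

lemma gn_operator_cong_open:
  assumes "open S" and "x \<in> S"
    and b: "\<And>y. y \<in> S \<Longrightarrow> b y = b' y" and \<rho>: "\<And>y. y \<in> S \<Longrightarrow> \<rho> y = \<rho>' y" and \<eta>: "\<And>y. y \<in> S \<Longrightarrow> \<eta> y = \<eta>' y"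
  shows "gn_operator b \<rho> \<eta> x = gn_operator b' \<rho>' \<eta>' x"
proof -
  have g: "grad b y = grad b' y" and dv: "divg \<eta> y = divg \<eta>' y" if "y \<in> S" for y
    using grad_cong_open[OF assms(1) that b] divg_cong_open[OF assms(1) that \<eta>] by auto
  have "grad (\<lambda>y. \<rho> y ^ 3 * divg \<eta> y) x = grad (\<lambda>y. \<rho>' y ^ 3 * divg \<eta>' y) x"
    "grad (\<lambda>y. \<rho> y ^ 2 * (\<eta> y \<bullet> grad b y)) x = grad (\<lambda>y. \<rho>' y ^ 2 * (\<eta>' y \<bullet> grad b' y)) x"
    by (rule grad_cong_open[OF assms(1,2)], simp add: g dv \<rho> \<eta>)+
  then show ?thesis
    using g[OF assms(2)] dv[OF assms(2)] \<rho>[OF assms(2)] \<eta>[OF assms(2)] by (simp add: gn_operator_def)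
qed

lemma smooth_on_gn_operator_param:
  assumes T: "open T" and U: "open U" and b: "smooth_on U b"
    and \<rho>: "smooth_on (T \<times> U) (\<lambda>p. \<rho> (fst p) (snd p))" and \<eta>: "smooth_on (T \<times> U) (\<lambda>p. \<eta> (fst p) (snd p))"
    and nz: "\<And>t x. t \<in> T \<Longrightarrow> x \<in> U \<Longrightarrow> \<rho> t x \<noteq> 0"
  shows "smooth_on (T \<times> U) (\<lambda>p. gn_operator b (\<rho> (fst p)) (\<eta> (fst p)) (snd p))"
proof -
  note O = open_Times[OF T U]
  have gb: "smooth_on (T \<times> U) (\<lambda>p. grad b (snd p))"
    by (rule smooth_on_space[OF T U smooth_on_grad[OF U b]])
  have dv: "smooth_on (T \<times> U) (\<lambda>p. divg (\<eta> (fst p)) (snd p))"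
    by (rule smooth_on_divg_param[OF T U \<eta>])
  have 1: "smooth_on (T \<times> U) (\<lambda>p. grad (\<lambda>y. \<rho> (fst p) y ^ 3 * divg (\<eta> (fst p)) y) (snd p))"
    by (rule smooth_on_grad_param[OF T U, of "\<lambda>t y. \<rho> t y ^ 3 * divg (\<eta> t) y"]) (intro smooth_intros O \<rho> dv)
  have 2: "smooth_on (T \<times> U) (\<lambda>p. grad (\<lambda>y. \<rho> (fst p) y ^ 2 * (\<eta> (fst p) y \<bullet> grad b y)) (snd p))"
    by (rule smooth_on_grad_param[OF T U, of "\<lambda>t y. \<rho> t y ^ 2 * (\<eta> t y \<bullet> grad b y)"])
      (intro smooth_intros O \<rho> \<eta> gb)
  have 3: "smooth_on (T \<times> U) (\<lambda>p. inverse (\<rho> (fst p) (snd p)))"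
    by (intro smooth_on_inverse O \<rho>) (use nz in auto)
  show ?thesis
    unfolding gn_operator_def by (intro smooth_intros O 1 2 3 dv gb \<rho> \<eta>)
qed

lemma smooth_on_gn_operator:
  assumes U: "open U" and b: "smooth_on U b" and \<rho>: "smooth_on U \<rho>" and \<eta>: "smooth_on U \<eta>"
    and nz: "\<And>x. x \<in> U \<Longrightarrow> \<rho> x \<noteq> 0"
  shows "smooth_on U (gn_operator b \<rho> \<eta>)"
proof -
  have "smooth_on (UNIV \<times> U) (\<lambda>p. gn_operator b ((\<lambda>_ :: real. \<rho>) (fst p)) ((\<lambda>_ :: real. \<eta>) (fst p)) (snd p))"
    by (rule smooth_on_gn_operator_param[OF open_UNIV U b smooth_on_space[OF open_UNIV U \<rho>]
          smooth_on_space[OF open_UNIV U \<eta>] nz])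
  from smooth_on_slice[OF this UNIV_I U] show ?thesis by simp
qed

text \<open>Two terms of the density contain \<open>divg \<xi>\<close>; the sum of their
  coefficients is the scalar under the divergence on the right. The product rule exchanges them for
  minus the gradient of that scalar paired with \<open>\<xi>\<close>. These are the gradient terms
  of the operator, whose division by \<open>\<rho>\<close> is undone by the weight.\<close>

lemma gn_density_eq_operator:
  assumes U: "open U" and x: "x \<in> U" and b: "smooth_on U b" and \<rho>: "smooth_on U \<rho>" and \<eta>: "smooth_on U \<eta>"
    and \<xi>: "smooth_on U \<xi>" and nz: "\<rho> x \<noteq> 0"
  shows "gn_density b \<rho> \<xi> \<eta> x = \<rho> x * (\<xi> x \<bullet> gn_operator b \<rho> \<eta> x) +
    divg (\<lambda>y. (1/3 * (\<rho> y ^ 3 * divg \<eta> y) + 1/2 * (\<rho> y ^ 2 * (\<eta> y \<bullet> grad b y))) *\<^sub>R \<xi> y) x"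
proof -
  let ?f = "\<lambda>y. \<rho> y ^ 3 * divg \<eta> y" and ?g = "\<lambda>y. \<rho> y ^ 2 * (\<eta> y \<bullet> grad b y)"
  have sm: "smooth_on U ?f" "smooth_on U ?g"
    by (intro smooth_intros U \<rho> \<eta> smooth_on_divg smooth_on_grad b)+
  have d: "?f differentiable (at x)" "?g differentiable (at x)" "\<xi> differentiable (at x)"
    "(\<lambda>y. 1/3 * ?f y) differentiable (at x)" "(\<lambda>y. 1/2 * ?g y) differentiable (at x)"
    "(\<lambda>y. 1/3 * ?f y + 1/2 * ?g y) differentiable (at x)"
    by (rule smooth_on_differentiable[OF _ x], intro smooth_intros U sm \<xi>)+
  have "divg (\<lambda>y. (1/3 * ?f y + 1/2 * ?g y) *\<^sub>R \<xi> y) x = (1/3 * ?f x + 1/2 * ?g x) * divg \<xi> x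
      + ((1/3) *\<^sub>R grad ?f x + (1/2) *\<^sub>R grad ?g x) \<bullet> \<xi> x"
    by (simp only: divg_scaleR[OF d(6,3)] grad_add[OF d(4,5)] grad_cmult[OF d(1)] grad_cmult[OF d(2)])
  moreover have mult_inv: "\<rho> x * (inverse (\<rho> x) * z) = z" for z using nz by simp
  have "\<rho> x * (\<xi> x \<bullet> gn_operator b \<rho> \<eta> x) = \<rho> x * (\<xi> x \<bullet> \<eta> x)
      - ((1/3) *\<^sub>R grad ?f x + (1/2) *\<^sub>R grad ?g x) \<bullet> \<xi> x
      + 1/2 * \<rho> x ^ 2 * divg \<eta> x * (\<xi> x \<bullet> grad b x) + \<rho> x * (\<xi> x \<bullet> grad b x) * (\<eta> x \<bullet> grad b x)"
    by (simp add: mult_inv gn_operator_def inner_add_right inner_diff_right inner_add_left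
        inner_commute[of _ "\<xi> x"] algebra_simps power2_eq_square)
  ultimately show ?thesis
    by (simp add: gn_density_def algebra_simps)
qed

lemma integral_divg_scaleR:
  assumes dom: "defining_function \<Omega> d" "bounded \<Omega>" and U: "open U" "closure \<Omega> \<subseteq> U"
    and f: "smooth_on U f" and \<xi>: "smooth_on U \<xi>" and tang: "\<And>x. x \<in> frontier \<Omega> \<Longrightarrow> \<xi> x \<bullet> grad d x = 0"
  shows "(LINT x:\<Omega>|lborel. divg (\<lambda>y. f y *\<^sub>R \<xi> y) x) = 0"
  by (rule integral_divg_tangent_field[OF dom U])
    (use tang in \<open>auto intro!: smooth_on_scaleR U f \<xi>\<close>)

text \<open>The boundary term is the flux of a multiple of \<open>\<xi>\<close>, the field relieved
  of its derivatives, so tangency is a condition on \<open>\<xi>\<close> alone. This asymmetry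
  matters in the energy variation, where \<open>\<xi>\<close> is the commutator of velocity and test
  field.\<close>

lemma integral_gn_density:
  assumes dom: "defining_function \<Omega> d" "bounded \<Omega>" and U: "open U" "closure \<Omega> \<subseteq> U"
    and b: "smooth_on U b" and \<rho>: "smooth_on U \<rho>" and \<eta>: "smooth_on U \<eta>" and \<xi>: "smooth_on U \<xi>"
    and nz: "\<And>x. x \<in> U \<Longrightarrow> \<rho> x \<noteq> 0"
    and tang: "\<And>x. x \<in> frontier \<Omega> \<Longrightarrow> \<xi> x \<bullet> grad d x = 0"
  shows "(LINT x:\<Omega>|lborel. gn_density b \<rho> \<xi> \<eta> x) = (LINT x:\<Omega>|lborel. \<rho> x * (\<xi> x \<bullet> gn_operator b \<rho> \<eta> x))"
proof -
  let ?f = "\<lambda>y. 1/3 * (\<rho> y ^ 3 * divg \<eta> y) + 1/2 * (\<rho> y ^ 2 * (\<eta> y \<bullet> grad b y))"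
  have op: "open \<Omega>" using frontier_defining_function[OF dom(1)] by auto
  have sub: "\<Omega> \<subseteq> U" using U closure_subset by blast
  have int: "set_integrable lborel \<Omega> g" if "smooth_on U g" for g :: "plane \<Rightarrow> real"
    by (rule set_integrable_continuous_closure[OF op dom(2) continuous_on_subset[OF smooth_on_continuous[OF that] U(2)]])
  have sf: "smooth_on U ?f"
    by (intro smooth_intros U \<rho> \<eta> smooth_on_divg smooth_on_grad b)
  have "(LINT x:\<Omega>|lborel. gn_density b \<rho> \<xi> \<eta> x) =
      (LINT x:\<Omega>|lborel. \<rho> x * (\<xi> x \<bullet> gn_operator b \<rho> \<eta> x) + divg (\<lambda>y. ?f y *\<^sub>R \<xi> y) x)"
  proof (rule set_lebesgue_integral_cong)
    show "\<Omega> \<in> sets lborel" using op by simp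
    show "\<forall>x. x \<in> \<Omega> \<longrightarrow> gn_density b \<rho> \<xi> \<eta> x = \<rho> x * (\<xi> x \<bullet> gn_operator b \<rho> \<eta> x) + divg (\<lambda>y. ?f y *\<^sub>R \<xi> y) x"
      using gn_density_eq_operator[OF U(1) _ b \<rho> \<eta> \<xi>] sub nz by blast
  qed
  also have "\<dots> = (LINT x:\<Omega>|lborel. \<rho> x * (\<xi> x \<bullet> gn_operator b \<rho> \<eta> x)) + (LINT x:\<Omega>|lborel. divg (\<lambda>y. ?f y *\<^sub>R \<xi> y) x)"
    by (rule set_integral_add(2); rule int; intro smooth_intros U \<rho> \<xi> smooth_on_gn_operator b \<eta> nz smooth_on_divg sf)
  also have "(LINT x:\<Omega>|lborel. divg (\<lambda>y. ?f y *\<^sub>R \<xi> y) x) = 0"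
    by (rule integral_divg_scaleR[OF dom U sf \<xi> tang])
  finally show ?thesis by simp
qed

section \<open>First variation of kinetic energy and of momentum\<close>

text \<open>The derivative of the kinetic energy density \<open>1/2 gn_density b \<rho> u u\<close> in the variable \<open>\<rho>\<close>.\<close>
definition gn_bernoulli :: "(plane \<Rightarrow> real) \<Rightarrow> (plane \<Rightarrow> real) \<Rightarrow> (plane \<Rightarrow> plane) \<Rightarrow> plane \<Rightarrow> real" where
  "gn_bernoulli b \<rho> u x = 1/2 * (norm (u x))\<^sup>2 + 1/2 * (\<rho> x * divg u x + u x \<bullet> grad b x)\<^sup>2"

lemma smooth_on_gn_bernoulli:
  assumes "open U" and "smooth_on U b" and "smooth_on U \<rho>" and "smooth_on U u"
  shows "smooth_on U (gn_bernoulli b \<rho> u)"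
proof -
  have "smooth_on U (\<lambda>x. 1/2 * (u x \<bullet> u x) + 1/2 * (\<rho> x * divg u x + u x \<bullet> grad b x)\<^sup>2)"
    by (intro smooth_intros smooth_on_divg smooth_on_grad assms)
  then show ?thesis by (simp add: gn_bernoulli_def[abs_def] power2_norm_eq_inner)
qed

text \<open>At a fixed point, density, velocity and divergence \<open>\<delta>\<close> are
  independent functions of \<open>s\<close>. The form is quadratic in velocity and divergence,
  whence the factor 2. The coefficients are such that the derivative in the density is the squared
  speed plus the perfect square of \<open>R s * \<delta> s + u s \<bullet> g\<close>.\<close>

lemma has_derivative_gn_density:
  assumes R: "(R has_real_derivative R') (at s)" and u: "(u has_vector_derivative u') (at s)"
    and \<delta>: "(\<delta> has_real_derivative \<delta>') (at s)"
  shows "((\<lambda>s. R s * (u s \<bullet> u s) + 1/3 * R s ^ 3 * \<delta> s * \<delta> s + 1/2 * R s ^ 2 * \<delta> s * (u s \<bullet> g)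
      + 1/2 * R s ^ 2 * \<delta> s * (u s \<bullet> g) + R s * (u s \<bullet> g) * (u s \<bullet> g)) has_real_derivative
    2 * ((1/2 * (norm (u s))\<^sup>2 + 1/2 * (R s * \<delta> s + u s \<bullet> g)\<^sup>2) * R'
      + (R s * (u s \<bullet> u') + 1/3 * R s ^ 3 * \<delta> s * \<delta>' + 1/2 * R s ^ 2 * \<delta> s * (u' \<bullet> g)
      + 1/2 * R s ^ 2 * \<delta>' * (u s \<bullet> g) + R s * (u s \<bullet> g) * (u' \<bullet> g)))) (at s)"
proof -
  have ud: "(u has_derivative (\<lambda>h. h *\<^sub>R u')) (at s)" using u by (simp add: has_vector_derivative_def)
  have n: "((\<lambda>s. u s \<bullet> u s) has_real_derivative 2 * (u s \<bullet> u')) (at s)"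
    using has_derivative_imp_has_vector_derivative[OF has_derivative_inner[OF ud ud]]
    by (simp add: has_real_derivative_iff_has_vector_derivative inner_commute)
  have k: "((\<lambda>s. u s \<bullet> g) has_real_derivative u' \<bullet> g) (at s)"
    using has_derivative_imp_has_vector_derivative[OF has_derivative_inner_left[OF ud]]
    by (simp add: has_real_derivative_iff_has_vector_derivative)
  show ?thesis
    by (rule derivative_eq_intros R n k \<delta> refl)+
      (simp add: power2_norm_eq_inner, simp add: power2_eq_square power3_eq_cube field_simps)
qed

text \<open>The integral is twice the kinetic energy, whence the factor 2. Its density part is a
  Bernoulli function times a divergence, its velocity part the form evaluated on \<open>u 0\<close>
  and the commutator \<open>c\<close>. Both are integrated by parts without boundary terms:
  \<open>\<phi>\<close> vanishes on the frontier, and there so does \<open>c\<close>, by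
  \<open>u_tang\<close> and \<open>\<phi>0\<close>.\<close>

lemma kinetic_term_variation:
  assumes dom: "defining_function \<Omega> d" "bounded \<Omega>" and e: "e > 0" and U: "open U" "closure \<Omega> \<subseteq> U"
    and b: "smooth_on U b" and \<phi>: "smooth_on U \<phi>" and \<phi>0: "\<And>x. x \<in> frontier \<Omega> \<Longrightarrow> \<phi> x = 0"
    and R: "smooth_on (ball 0 e \<times> U) (\<lambda>p. R (fst p) (snd p))"
    and u: "smooth_on (ball 0 e \<times> U) (\<lambda>p. u (fst p) (snd p))"
    and nz: "\<And>x. x \<in> U \<Longrightarrow> R 0 x \<noteq> 0"
    and u_tang: "\<And>x. x \<in> frontier \<Omega> \<Longrightarrow> frechet_derivative \<phi> (at x) (u 0 x) = 0"
    and R_s: "\<And>x. x \<in> \<Omega> \<Longrightarrow> vector_derivative (\<lambda>s. R s x) (at 0) = - divg (\<lambda>y. R 0 y *\<^sub>R \<phi> y) x"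
    and u_s: "\<And>x. x \<in> \<Omega> \<Longrightarrow> vector_derivative (\<lambda>s. u s x) (at 0) =
      frechet_derivative \<phi> (at x) (u 0 x) - frechet_derivative (u 0) (at x) (\<phi> x)"
  shows "((\<lambda>s. LINT x:\<Omega>|lborel. gn_density b (R s) (u s) (u s) x) has_real_derivative
    2 * (LINT x:\<Omega>|lborel. R 0 x * (grad (gn_bernoulli b (R 0) (u 0)) x \<bullet> \<phi> x +
      gn_operator b (R 0) (u 0) x \<bullet> (frechet_derivative \<phi> (at x) (u 0 x) - frechet_derivative (u 0) (at x) (\<phi> x))))) (at 0)"
proof -
  let ?T = "ball (0::real) e"
  have op: "open \<Omega>" using frontier_defining_function[OF dom(1)] by auto
  have sub: "\<Omega> \<subseteq> U" using U closure_subset by blast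
  have int: "set_integrable lborel \<Omega> g" if "smooth_on U g" for g :: "plane \<Rightarrow> real"
    by (rule set_integrable_continuous_closure[OF op dom(2) continuous_on_subset[OF smooth_on_continuous[OF that] U(2)]])
  have 0: "0 \<in> ?T" using e by simp
  have R0: "smooth_on U (R 0)" and u0: "smooth_on U (u 0)"
    using smooth_on_slice[OF R 0 U(1)] smooth_on_slice[OF u 0 U(1)] by auto
  note O = open_Times[OF open_ball[of "0::real" e] U(1)]
  have gb: "smooth_on (?T \<times> U) (\<lambda>p. grad b (snd p))"
    by (rule smooth_on_space[OF open_ball U(1) smooth_on_grad[OF U(1) b]])
  have dv: "smooth_on (?T \<times> U) (\<lambda>p. divg (u (fst p)) (snd p))"
    by (rule smooth_on_divg_param[OF open_ball U(1) u])
  have sm: "smooth_on (?T \<times> U) (\<lambda>p. gn_density b (R (fst p)) (u (fst p)) (u (fst p)) (snd p))"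
    unfolding gn_density_def by (intro smooth_intros O R u gb dv)
  define c where "c x = frechet_derivative \<phi> (at x) (u 0 x) - frechet_derivative (u 0) (at x) (\<phi> x)" for x
  define uc where "uc x = vector_derivative (\<lambda>s. u s x) (at 0)" for x
  have smc: "smooth_on U c"
    unfolding c_def by (intro smooth_on_diff smooth_on_frechet_apply U(1) \<phi> u0)
  let ?H = "gn_bernoulli b (R 0) (u 0)"
  have smH: "smooth_on U ?H" by (rule smooth_on_gn_bernoulli[OF U(1) b R0 u0])
  have der: "vector_derivative (\<lambda>s. gn_density b (R s) (u s) (u s) x) (at 0) =
      2 * (R 0 x * (grad ?H x \<bullet> \<phi> x) - divg (\<lambda>y. ?H y *\<^sub>R (R 0 y *\<^sub>R \<phi> y)) x + gn_density b (R 0) (u 0) c x)"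
    if x: "x \<in> \<Omega>" for x
  proof -
    have xU: "x \<in> U" and px: "(0, x) \<in> ?T \<times> U" using x sub 0 by auto
    have 1: "((\<lambda>s. R s x) has_real_derivative - divg (\<lambda>y. R 0 y *\<^sub>R \<phi> y) x) (at 0)"
      using smooth_on_has_vector_derivative[OF R px] R_s[OF x]
      by (simp add: has_real_derivative_iff_has_vector_derivative)
    have 2: "((\<lambda>s. u s x) has_vector_derivative c x) (at 0)"
      using smooth_on_has_vector_derivative[OF u px] u_s[OF x] by (simp add: c_def)
    \<comment> \<open>The formula for the \<open>s\<close>-derivative of the velocity is known on
      \<open>\<Omega>\<close> only. Since \<open>\<Omega>\<close> is open, this still determines its
      spatial derivatives, and with them the \<open>s\<close>-derivative of the divergence.\<close>
    have cong: "frechet_derivative uc (at x) = frechet_derivative c (at x)"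
      by (rule frechet_derivative_cong_open[OF op x]) (simp add: uc_def c_def u_s)
    have nth: "((\<lambda>s. frechet_derivative (u s) (at x) v $ i) has_real_derivative frechet_derivative c (at x) v $ i) (at 0)" for v i
    proof -
      have "((\<lambda>s. frechet_derivative (u s) (at x) v) has_vector_derivative frechet_derivative uc (at x) v) (at 0)"
        unfolding uc_def by (rule frechet_derivative_time_derivative[OF open_ball U(1) u 0 xU])
      from bounded_linear.has_vector_derivative[OF bounded_linear_vec_nth this]
      show ?thesis by (simp add: has_real_derivative_iff_has_vector_derivative cong)
    qed
    have 3: "((\<lambda>s. divg (u s) x) has_real_derivative divg c x) (at 0)"
      unfolding divg_eq by (intro DERIV_add nth)
    have dH: "?H differentiable (at x)" and dRphi: "(\<lambda>y. R 0 y *\<^sub>R \<phi> y) differentiable (at x)"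
      by (rule smooth_on_differentiable[OF _ xU], intro smooth_intros U smH R0 \<phi>)+
    have "divg (\<lambda>y. ?H y *\<^sub>R (R 0 y *\<^sub>R \<phi> y)) x = ?H x * divg (\<lambda>y. R 0 y *\<^sub>R \<phi> y) x + R 0 x * (grad ?H x \<bullet> \<phi> x)"
      using divg_scaleR[OF dH dRphi] by simp
    then have eq: "R 0 x * (grad ?H x \<bullet> \<phi> x) - divg (\<lambda>y. ?H y *\<^sub>R (R 0 y *\<^sub>R \<phi> y)) x = ?H x * - divg (\<lambda>y. R 0 y *\<^sub>R \<phi> y) x"
      by simp
    have "((\<lambda>s. gn_density b (R s) (u s) (u s) x) has_real_derivative
      2 * (?H x * - divg (\<lambda>y. R 0 y *\<^sub>R \<phi> y) x + gn_density b (R 0) (u 0) c x)) (at 0)"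
      using has_derivative_gn_density[OF 1 2 3, of "grad b x"]
      unfolding gn_density_def gn_bernoulli_def .
    then show ?thesis
      unfolding eq[symmetric] has_real_derivative_iff_has_vector_derivative by (rule vector_derivative_at)
  qed
  have c_tang: "c x \<bullet> grad d x = 0" if "x \<in> frontier \<Omega>" for x
  proof -
    have "x \<in> U" using that U(2) by (auto simp: frontier_def)
    then have "linear (frechet_derivative (u 0) (at x))"
      by (intro linear_frechet_derivative smooth_on_differentiable[OF u0])
    then show ?thesis using u_tang[OF that] \<phi>0[OF that] by (simp add: c_def linear_0)
  qed
  have IH: "(LINT x:\<Omega>|lborel. divg (\<lambda>y. ?H y *\<^sub>R (R 0 y *\<^sub>R \<phi> y)) x) = 0"
    by (rule integral_divg_scaleR[OF dom U smH]) (auto intro!: smooth_intros U R0 \<phi> simp: \<phi>0)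
  have A: "(LINT x:\<Omega>|lborel. gn_density b (R 0) (u 0) c x) = (LINT x:\<Omega>|lborel. R 0 x * (c x \<bullet> gn_operator b (R 0) (u 0) x))"
    unfolding gn_density_commute[of b "R 0" "u 0" c]
    by (rule integral_gn_density[OF dom U b R0 u0 smc nz c_tang])
  have smA: "smooth_on U (gn_operator b (R 0) (u 0))"
    by (rule smooth_on_gn_operator[OF U(1) b R0 u0 nz])
  have i1: "set_integrable lborel \<Omega> (\<lambda>x. R 0 x * (grad ?H x \<bullet> \<phi> x))"
    by (rule int) (intro smooth_intros U R0 \<phi> smooth_on_grad smH)
  have i2: "set_integrable lborel \<Omega> (\<lambda>x. divg (\<lambda>y. ?H y *\<^sub>R (R 0 y *\<^sub>R \<phi> y)) x)"
    by (rule int) (intro smooth_intros U R0 \<phi> smooth_on_divg smH)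
  have i3: "set_integrable lborel \<Omega> (\<lambda>x. gn_density b (R 0) (u 0) c x)"
    unfolding gn_density_def by (rule int) (intro smooth_intros U R0 u0 smc smooth_on_divg smooth_on_grad b)
  have i4: "set_integrable lborel \<Omega> (\<lambda>x. R 0 x * (c x \<bullet> gn_operator b (R 0) (u 0) x))"
    by (rule int) (intro smooth_intros U R0 smc smA)
  have "(LINT x:\<Omega>|lborel. vector_derivative (\<lambda>s. gn_density b (R s) (u s) (u s) x) (at 0)) =
      (LINT x:\<Omega>|lborel. 2 * (R 0 x * (grad ?H x \<bullet> \<phi> x) - divg (\<lambda>y. ?H y *\<^sub>R (R 0 y *\<^sub>R \<phi> y)) x + gn_density b (R 0) (u 0) c x))"
    by (rule set_lebesgue_integral_cong) (use op der in auto)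
  also have "\<dots> = 2 * ((LINT x:\<Omega>|lborel. R 0 x * (grad ?H x \<bullet> \<phi> x)) - (LINT x:\<Omega>|lborel. divg (\<lambda>y. ?H y *\<^sub>R (R 0 y *\<^sub>R \<phi> y)) x)
      + (LINT x:\<Omega>|lborel. gn_density b (R 0) (u 0) c x))"
    by (simp only: set_integral_mult_right set_integral_add(2)[OF set_integral_diff(1)[OF i1 i2] i3] set_integral_diff(2)[OF i1 i2])
  also have "\<dots> = 2 * ((LINT x:\<Omega>|lborel. R 0 x * (grad ?H x \<bullet> \<phi> x)) + (LINT x:\<Omega>|lborel. R 0 x * (c x \<bullet> gn_operator b (R 0) (u 0) x)))"
    by (simp only: IH A diff_0_right)
  also have "\<dots> = 2 * (LINT x:\<Omega>|lborel. R 0 x * (grad ?H x \<bullet> \<phi> x) + R 0 x * (c x \<bullet> gn_operator b (R 0) (u 0) x))"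
    by (simp only: set_integral_add(2)[OF i1 i4])
  also have "\<dots> = 2 * (LINT x:\<Omega>|lborel. R 0 x * (grad ?H x \<bullet> \<phi> x + gn_operator b (R 0) (u 0) x \<bullet> c x))"
    by (simp only: distrib_left inner_commute)
  finally have eq: "(LINT x:\<Omega>|lborel. vector_derivative (\<lambda>s. gn_density b (R s) (u s) (u s) x) (at 0)) = \<dots>" .
  show ?thesis
    using leibniz_integral_smooth[OF op dom(2) e U sm] unfolding eq c_def .
qed

text \<open>Transport formula: by conservation of mass, the time derivative of \<open>R\<close>
  times a function is \<open>R\<close> times the material derivative of that function, minus the
  divergence of a flux along \<open>u\<close>. The function here is the pairing of \<open>v\<close>
  with a time-independent field, and the flux is tangent to the boundary because \<open>u\<close>
  is.\<close>

lemma momentum_time_derivative: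
  assumes dom: "defining_function \<Omega> d" "bounded \<Omega>" and e: "e > 0" and U: "open U" "closure \<Omega> \<subseteq> U"
    and \<phi>: "smooth_on U \<phi>"
    and R: "smooth_on (ball t0 e \<times> U) (\<lambda>p. R (fst p) (snd p))"
    and u: "smooth_on U u"
    and v: "smooth_on (ball t0 e \<times> U) (\<lambda>p. v (fst p) (snd p))"
    and u_tang: "\<And>x. x \<in> frontier \<Omega> \<Longrightarrow> u x \<bullet> grad d x = 0"
    and R_t: "\<And>x. x \<in> \<Omega> \<Longrightarrow> vector_derivative (\<lambda>s. R s x) (at t0) + divg (\<lambda>y. R t0 y *\<^sub>R u y) x = 0"
  shows "((\<lambda>t. LINT x:\<Omega>|lborel. R t x * (v t x \<bullet> \<phi> x)) has_real_derivative
    (LINT x:\<Omega>|lborel. R t0 x * ((vector_derivative (\<lambda>s. v s x) (at t0) + frechet_derivative (v t0) (at x) (u x)) \<bullet> \<phi> x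
      + v t0 x \<bullet> frechet_derivative \<phi> (at x) (u x)))) (at t0)"
proof -
  let ?T = "ball t0 e"
  have op: "open \<Omega>" using frontier_defining_function[OF dom(1)] by auto
  have sub: "\<Omega> \<subseteq> U" using U closure_subset by blast
  have int: "set_integrable lborel \<Omega> g" if "continuous_on U g" for g :: "plane \<Rightarrow> real"
    by (rule set_integrable_continuous_closure[OF op dom(2) continuous_on_subset[OF that U(2)]])
  have t0: "t0 \<in> ?T" using e by simp
  have R0: "smooth_on U (R t0)" and v0: "smooth_on U (v t0)"
    using smooth_on_slice[OF R t0 U(1)] smooth_on_slice[OF v t0 U(1)] by auto
  note O = open_Times[OF open_ball[of t0 e] U(1)]
  have sm: "smooth_on (?T \<times> U) (\<lambda>p. R (fst p) (snd p) * (v (fst p) (snd p) \<bullet> \<phi> (snd p)))"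
    by (intro smooth_intros O R v smooth_on_space[OF open_ball U(1) \<phi>])
  let ?f = "\<lambda>y. v t0 y \<bullet> \<phi> y"
  have smf: "smooth_on U ?f" by (intro smooth_intros U v0 \<phi>)
  have smRu: "smooth_on U (\<lambda>y. R t0 y *\<^sub>R u y)" by (intro smooth_intros U R0 u)
  let ?I = "\<lambda>x. R t0 x * ((vector_derivative (\<lambda>s. v s x) (at t0) + frechet_derivative (v t0) (at x) (u x)) \<bullet> \<phi> x
      + v t0 x \<bullet> frechet_derivative \<phi> (at x) (u x))"
  have der: "vector_derivative (\<lambda>s. R s x * (v s x \<bullet> \<phi> x)) (at t0) = ?I x - divg (\<lambda>y. ?f y *\<^sub>R (R t0 y *\<^sub>R u y)) x"
    if x: "x \<in> \<Omega>" for x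
  proof -
    have xU: "x \<in> U" and px: "(t0, x) \<in> ?T \<times> U" using x sub t0 by auto
    have 1: "((\<lambda>s. R s x) has_real_derivative - divg (\<lambda>y. R t0 y *\<^sub>R u y) x) (at t0)"
      using smooth_on_has_vector_derivative[OF R px] R_t[OF x]
      by (simp add: has_real_derivative_iff_has_vector_derivative add_eq_0_iff)
    let ?v' = "vector_derivative (\<lambda>s. v s x) (at t0)"
    have "((\<lambda>s. v s x) has_derivative (\<lambda>h. h *\<^sub>R ?v')) (at t0)"
      using smooth_on_has_vector_derivative[OF v px] by (simp add: has_vector_derivative_def)
    from has_derivative_imp_has_vector_derivative[OF has_derivative_inner_left[OF this]]
    have 2: "((\<lambda>s. v s x \<bullet> \<phi> x) has_real_derivative ?v' \<bullet> \<phi> x) (at t0)"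
      by (simp add: has_real_derivative_iff_has_vector_derivative)
    have "((\<lambda>s. R s x * (v s x \<bullet> \<phi> x)) has_real_derivative
        - divg (\<lambda>y. R t0 y *\<^sub>R u y) x * (v t0 x \<bullet> \<phi> x) + ?v' \<bullet> \<phi> x * R t0 x) (at t0)"
      by (rule DERIV_mult[OF 1 2])
    then have D: "vector_derivative (\<lambda>s. R s x * (v s x \<bullet> \<phi> x)) (at t0) =
        - divg (\<lambda>y. R t0 y *\<^sub>R u y) x * (v t0 x \<bullet> \<phi> x) + ?v' \<bullet> \<phi> x * R t0 x"
      unfolding has_real_derivative_iff_has_vector_derivative by (rule vector_derivative_at)
    have df: "?f differentiable (at x)" and dRu: "(\<lambda>y. R t0 y *\<^sub>R u y) differentiable (at x)"
      by (rule smooth_on_differentiable[OF _ xU], rule smf smRu)+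
    have "grad ?f x \<bullet> w = v t0 x \<bullet> frechet_derivative \<phi> (at x) w + frechet_derivative (v t0) (at x) w \<bullet> \<phi> x" for w
      by (rule grad_inner[OF has_derivative_inner[OF smooth_on_has_derivative[OF v0 xU] smooth_on_has_derivative[OF \<phi> xU]]])
    then have "divg (\<lambda>y. ?f y *\<^sub>R (R t0 y *\<^sub>R u y)) x = ?f x * divg (\<lambda>y. R t0 y *\<^sub>R u y) x
        + R t0 x * (v t0 x \<bullet> frechet_derivative \<phi> (at x) (u x) + frechet_derivative (v t0) (at x) (u x) \<bullet> \<phi> x)"
      using divg_scaleR[OF df dRu] by simp
    then show ?thesis
      unfolding D by (simp add: inner_add_left algebra_simps)
  qed
  have 0: "(LINT x:\<Omega>|lborel. divg (\<lambda>y. ?f y *\<^sub>R (R t0 y *\<^sub>R u y)) x) = 0"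
    by (rule integral_divg_scaleR[OF dom U smf smRu]) (simp add: u_tang)
  have i1: "set_integrable lborel \<Omega> (\<lambda>x. divg (\<lambda>y. ?f y *\<^sub>R (R t0 y *\<^sub>R u y)) x)"
    by (rule int[OF smooth_on_continuous]) (intro smooth_intros U smooth_on_divg smf smRu)
  have smD: "continuous_on U (\<lambda>x. vector_derivative (\<lambda>s. R s x * (v s x \<bullet> \<phi> x)) (at t0))"
  proof -
    have "smooth_on (?T \<times> U) (\<lambda>p. vector_derivative (\<lambda>s. R s (snd p) * (v s (snd p) \<bullet> \<phi> (snd p))) (at (fst p)))"
      by (rule smooth_on_time_derivative[OF open_ball U(1), where f = "\<lambda>s x. R s x * (v s x \<bullet> \<phi> x)"]) (rule sm)
    from smooth_on_continuous[OF smooth_on_slice[where f = "\<lambda>t x. vector_derivative (\<lambda>s. R s x * (v s x \<bullet> \<phi> x)) (at t)", OF this t0 U(1)]]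
    show ?thesis .
  qed
  \<comment> \<open>The vanishing integral of the divergence is added to that of the time
    derivative, as these are the two integrands already known to be integrable.\<close>
  have "(LINT x:\<Omega>|lborel. vector_derivative (\<lambda>s. R s x * (v s x \<bullet> \<phi> x)) (at t0)) =
      (LINT x:\<Omega>|lborel. vector_derivative (\<lambda>s. R s x * (v s x \<bullet> \<phi> x)) (at t0)) + (LINT x:\<Omega>|lborel. divg (\<lambda>y. ?f y *\<^sub>R (R t0 y *\<^sub>R u y)) x)"
    by (simp only: 0 add_0_right)
  also have "\<dots> = (LINT x:\<Omega>|lborel. vector_derivative (\<lambda>s. R s x * (v s x \<bullet> \<phi> x)) (at t0) + divg (\<lambda>y. ?f y *\<^sub>R (R t0 y *\<^sub>R u y)) x)"
    by (rule set_integral_add(2)[symmetric, OF int[OF smD] i1])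
  also have "\<dots> = (LINT x:\<Omega>|lborel. ?I x)"
    by (rule set_lebesgue_integral_cong) (use op der in auto)
  finally have eq: "(LINT x:\<Omega>|lborel. vector_derivative (\<lambda>s. R s x * (v s x \<bullet> \<phi> x)) (at t0)) = (LINT x:\<Omega>|lborel. ?I x)" .
  show ?thesis
    using leibniz_integral_smooth[OF op dom(2) e U sm] unfolding eq .
qed

section \<open>Eulerian fields along curves of diffeomorphisms\<close>

lemma smooth_bounded_domainD:
  assumes "smooth_bounded_domain \<Omega>"
  shows "open \<Omega>" "connected \<Omega>" "\<Omega> \<noteq> {}" "bounded \<Omega>" "compact (closure \<Omega>)"
    "closure \<Omega> = \<Omega> \<union> frontier \<Omega>" "\<Omega> \<inter> frontier \<Omega> = {}" "\<Omega> \<subseteq> closure \<Omega>" "frontier \<Omega> \<subseteq> closure \<Omega>"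
proof -
  show o: "open \<Omega>" and "connected \<Omega>" "\<Omega> \<noteq> {}" and bd: "bounded \<Omega>"
    using assms by (auto simp: smooth_bounded_domain_def)
  show "compact (closure \<Omega>)" using bd by simp
  show "closure \<Omega> = \<Omega> \<union> frontier \<Omega>" "\<Omega> \<inter> frontier \<Omega> = {}"
    using o closure_subset[of \<Omega>] by (auto simp: frontier_def interior_open)
  show "\<Omega> \<subseteq> closure \<Omega>" by (rule closure_subset)
  show "frontier \<Omega> \<subseteq> closure \<Omega>" by (simp add: frontier_def)
qed

text \<open>A bijection of the closure that maps the frontier onto itself also preserves the
  interior, in both directions.\<close>

lemma inverse_map_Diff:
  assumes dom: "smooth_bounded_domain \<Omega>" and X: "X \<in> Diff \<Omega>"
  shows "\<And>y. y \<in> closure \<Omega> \<Longrightarrow> inverse_map \<Omega> X (X y) = y"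
    "\<And>x. x \<in> closure \<Omega> \<Longrightarrow> X (inverse_map \<Omega> X x) = x"
    "\<And>x. x \<in> closure \<Omega> \<Longrightarrow> inverse_map \<Omega> X x \<in> closure \<Omega>"
    "\<And>x. x \<in> \<Omega> \<Longrightarrow> inverse_map \<Omega> X x \<in> \<Omega>" "\<And>y. y \<in> \<Omega> \<Longrightarrow> X y \<in> \<Omega>"
    "\<And>x. x \<in> frontier \<Omega> \<Longrightarrow> inverse_map \<Omega> X x \<in> frontier \<Omega>"
    "\<And>y. y \<in> closure \<Omega> \<Longrightarrow> X y \<in> closure \<Omega>"
proof -
  note D = smooth_bounded_domainD[OF dom]
  have bij: "bij_betw X (closure \<Omega>) (closure \<Omega>)" and fr: "X ` frontier \<Omega> = frontier \<Omega>"
    using X by (auto simp: Diff_def)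
  show 1: "inverse_map \<Omega> X (X y) = y" if "y \<in> closure \<Omega>" for y
    using bij that by (simp add: inverse_map_def bij_betw_def)
  show 2: "X (inverse_map \<Omega> X x) = x" if "x \<in> closure \<Omega>" for x
    using bij that by (simp add: inverse_map_def bij_betw_def f_inv_into_f)
  show 3: "inverse_map \<Omega> X x \<in> closure \<Omega>" if "x \<in> closure \<Omega>" for x
    using bij that unfolding inverse_map_def bij_betw_def by (metis inv_into_into)
  show 4: "X y \<in> closure \<Omega>" if "y \<in> closure \<Omega>" for y
    using bij that by (auto simp: bij_betw_def)
  show 5: "inverse_map \<Omega> X x \<in> frontier \<Omega>" if x: "x \<in> frontier \<Omega>" for x
  proof -
    obtain y where "y \<in> frontier \<Omega>" "x = X y" using fr x by blast
    then show ?thesis using 1[of y] D(9) by auto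
  qed
  show "X y \<in> \<Omega>" if y: "y \<in> \<Omega>" for y
  proof -
    have "y \<in> closure \<Omega>" using y D(8) by blast
    then have "X y \<notin> frontier \<Omega>" using 5[of "X y"] 1[of y] y D(7) by auto
    then show ?thesis using 4[OF \<open>y \<in> closure \<Omega>\<close>] D(6) by blast
  qed
  show "inverse_map \<Omega> X x \<in> \<Omega>" if x: "x \<in> \<Omega>" for x
  proof -
    have xK: "x \<in> closure \<Omega>" using x D(8) by blast
    have "inverse_map \<Omega> X x \<notin> frontier \<Omega>"
    proof
      assume "inverse_map \<Omega> X x \<in> frontier \<Omega>"
      then have "X (inverse_map \<Omega> X x) \<in> frontier \<Omega>" using fr by blast
      then show False using 2[OF xK] x D(7) by auto
    qed
    then show ?thesis using 3[OF xK] D(6) by blast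
  qed
qed

text \<open>The extended inverse composed with \<open>F\<close> is the identity on
  \<open>\<Omega>\<close>, hence has the identity as derivative there. Around a boundary point the
  extensions need not be inverse to each other, but the derivative of the composite is continuous on
  the closure, so the identity persists up to the frontier.\<close>

lemma det_jacobian_Diff:
  assumes dom: "smooth_bounded_domain \<Omega>" and X: "X \<in> Diff \<Omega>"
    and U: "open U" "closure \<Omega> \<subseteq> U" and F: "smooth_on U F" and FX: "\<And>x. x \<in> closure \<Omega> \<Longrightarrow> F x = X x"
    and y: "y \<in> closure \<Omega>"
  shows "det (jacobian F (at y)) \<noteq> 0"
proof -
  note D = smooth_bounded_domainD[OF dom] and I = inverse_map_Diff[OF dom X]
  obtain V Z where Z: "open V" "closure \<Omega> \<subseteq> V" "smooth_on V Z" "\<And>x. x \<in> closure \<Omega> \<Longrightarrow> Z x = inverse_map \<Omega> X x"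
    using X unfolding Diff_def smooth_upto_def by blast
  define W where "W = U \<inter> F -` V"
  have W: "open W"
    unfolding W_def by (rule continuous_open_preimage[OF smooth_on_continuous[OF F] U(1) Z(1)])
  have KW: "closure \<Omega> \<subseteq> W"
  proof
    fix x assume x: "x \<in> closure \<Omega>"
    then have "F x \<in> V" using FX[OF x] I(7)[OF x] Z(2) by auto
    then show "x \<in> W" using x U(2) by (auto simp: W_def)
  qed
  have G: "smooth_on W (\<lambda>x. Z (F x))"
    by (rule smooth_on_compose[OF Z(3) W smooth_on_subset[OF F]]) (auto simp: W_def)
  have id: "frechet_derivative (\<lambda>x. Z (F x)) (at x) v = v" if x: "x \<in> \<Omega>" for x v
  proof -
    have "frechet_derivative (\<lambda>x. Z (F x)) (at x) = frechet_derivative (\<lambda>x. x) (at x)"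
      by (rule frechet_derivative_cong_open[OF D(1) x]) (use Z(4) FX I D(8) in auto)
    then show ?thesis by simp
  qed
  have "frechet_derivative (\<lambda>x. Z (F x)) (at y) v = v" for v
    by (rule continuous_constant_on_closure[OF continuous_on_subset[OF smooth_on_continuous[OF
            smooth_on_frechet_derivative[OF G]] KW] id y])
  moreover have yU: "y \<in> U" and Fy: "F y \<in> V" using y U(2) KW by (auto simp: W_def)
  have "((\<lambda>x. Z (F x)) has_derivative (\<lambda>v. frechet_derivative Z (at (F y)) (frechet_derivative F (at y) v))) (at y)"
    by (rule has_derivative_compose[OF smooth_on_has_derivative[OF F yU] smooth_on_has_derivative[OF Z(3) Fy]])
  ultimately have "frechet_derivative Z (at (F y)) (frechet_derivative F (at y) v) = v" for v
    using fun_cong[OF frechet_derivative_at, of "\<lambda>x. Z (F x)" "\<lambda>v. frechet_derivative Z (at (F y)) (frechet_derivative F (at y) v)" y v]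
    by simp
  then have "(jacobian Z (at (F y)) ** jacobian F (at y)) *v v = mat 1 *v v" for v
    by (simp add: matrix_vector_mul_assoc[symmetric] jacobian_mult smooth_on_differentiable[OF F yU]
        smooth_on_differentiable[OF Z(3) Fy])
  then have "jacobian Z (at (F y)) ** jacobian F (at y) = mat 1"
    by (simp add: matrix_eq)
  then have "det (jacobian Z (at (F y))) * det (jacobian F (at y)) = 1"
    using det_mul[of "jacobian Z (at (F y))" "jacobian F (at y)"] by simp
  then show ?thesis by auto
qed

text \<open>\<open>smooth_curve\<close> makes each inverse smooth in space but says nothing about
  its dependence on time. Joint smoothness comes from the parametric inverse theorem, applied to a
  smooth extension \<open>F\<close> of the curve, whose Jacobian determinant has no zeros up to the
  boundary.\<close>

lemma smooth_curve_extension: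
  assumes dom: "smooth_bounded_domain \<Omega>" and X: "smooth_curve \<Omega> I X" and t0: "t0 \<in> I"
  obtains e U V F Y where "e > 0" "ball t0 e \<subseteq> I" "open U" "closure \<Omega> \<subseteq> U" "open V" "closure \<Omega> \<subseteq> V"
    "smooth_on (ball t0 e \<times> V) (\<lambda>p. F (fst p) (snd p))"
    "smooth_on (ball t0 e \<times> U) (\<lambda>p. Y (fst p) (snd p))"
    "\<And>t x. t \<in> ball t0 e \<Longrightarrow> x \<in> closure \<Omega> \<Longrightarrow> F t x = X t x"
    "\<And>t x. t \<in> ball t0 e \<Longrightarrow> x \<in> closure \<Omega> \<Longrightarrow> Y t x = inverse_map \<Omega> (X t) x"
    "\<And>t x. t \<in> ball t0 e \<Longrightarrow> x \<in> closure \<Omega> \<Longrightarrow> det (jacobian (F t) (at x)) \<noteq> 0"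
proof -
  note D = smooth_bounded_domainD[OF dom]
  have I: "open I" and Diff: "\<And>t. t \<in> I \<Longrightarrow> X t \<in> Diff \<Omega>"
    and sm: "smooth_upto (I \<times> closure \<Omega>) (\<lambda>(t, x). X t x)"
    using X by (auto simp: smooth_curve_def open_interval_def)
  obtain e1 V F where F: "e1 > 0" "ball t0 e1 \<subseteq> I" "open V" "closure \<Omega> \<subseteq> V"
    "smooth_on (ball t0 e1 \<times> V) (\<lambda>p. F (fst p) (snd p))"
    "\<And>t x. t \<in> ball t0 e1 \<Longrightarrow> x \<in> closure \<Omega> \<Longrightarrow> F t x = (\<lambda>(t, x). X t x) (t, x)"
    by (rule smooth_upto_tube[OF D(5) I t0 sm]) (rule that; (assumption | simp))
  have FX: "F t x = X t x" if "t \<in> ball t0 e1" "x \<in> closure \<Omega>" for t x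
    using F(6)[OF that] by simp
  have t0b: "t0 \<in> ball t0 e1" using F(1) by simp
  have bij: "bij_betw (X t0) (closure \<Omega>) (closure \<Omega>)" using Diff[OF t0] by (simp add: Diff_def)
  have inj: "inj_on (F t0) (closure \<Omega>)" and surj: "F t0 ` closure \<Omega> = closure \<Omega>"
    using bij FX[OF t0b] by (auto simp: bij_betw_def inj_on_def image_def)
  have det: "det (jacobian (F t0) (at x)) \<noteq> 0" if "x \<in> closure \<Omega>" for x
    by (rule det_jacobian_Diff[OF dom Diff[OF t0] F(3,4) smooth_on_slice[OF F(5) t0b F(3)] FX[OF t0b] that])
  have sub: "{t0} \<times> closure \<Omega> \<subseteq> ball t0 e1 \<times> V" using t0b F(4) by auto
  obtain e U Y where Y: "e > 0" "open U" "closure \<Omega> \<subseteq> U" "ball t0 e \<times> closure \<Omega> \<subseteq> ball t0 e1 \<times> V"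
    "smooth_on (ball t0 e \<times> U) (\<lambda>p. Y (fst p) (snd p))"
    "\<And>t x. t \<in> ball t0 e \<Longrightarrow> x \<in> closure \<Omega> \<Longrightarrow> Y t (F t x) = x"
    "\<And>t x. t \<in> ball t0 e \<Longrightarrow> x \<in> closure \<Omega> \<Longrightarrow> det (jacobian (F t) (at x)) \<noteq> 0"
    by (rule smooth_parametric_inverse_surj[OF open_Times[OF open_ball F(3)] F(5) D(5) sub inj det surj], assumption) (rule that; (assumption | simp))
  have sube: "ball t0 e \<subseteq> ball t0 e1" using Y(4) D(3,8) by blast
  have YX: "Y t x = inverse_map \<Omega> (X t) x" if t: "t \<in> ball t0 e" and x: "x \<in> closure \<Omega>" for t x
  proof -
    have te: "t \<in> ball t0 e1" using sube t by blast
    then have XD: "X t \<in> Diff \<Omega>" using F(2) Diff by blast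
    note J = inverse_map_Diff[OF dom XD]
    have "F t (inverse_map \<Omega> (X t) x) = x" using FX[OF te J(3)[OF x]] J(2)[OF x] by simp
    then show ?thesis using Y(6)[OF t J(3)[OF x]] by simp
  qed
  show ?thesis
  proof (rule that[of e U V F Y])
    show "ball t0 e \<subseteq> I" using sube F(2) by blast
    show "smooth_on (ball t0 e \<times> V) (\<lambda>p. F (fst p) (snd p))"
      by (rule smooth_on_subset[OF F(5)]) (use sube in blast)
    show "F t x = X t x" if "t \<in> ball t0 e" "x \<in> closure \<Omega>" for t x
      using FX sube that by blast
  qed (use Y F YX in blast)+
qed

text \<open>On the frontier the Jacobian in \<open>mass_density\<close> may depend on irrelevant
  values of \<open>X\<close>. The density is therefore identified on the open set only, where every
  extension has the same derivatives.\<close>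

lemma mass_density_eq:
  assumes dom: "smooth_bounded_domain \<Omega>" and X: "X \<in> Diff \<Omega>"
    and F: "\<And>x. x \<in> closure \<Omega> \<Longrightarrow> F x = X x" and x: "x \<in> \<Omega>"
  shows "mass_density \<Omega> \<rho>0 X x = \<rho>0 (inverse_map \<Omega> X x) / det (jacobian F (at (inverse_map \<Omega> X x)))"
proof -
  note D = smooth_bounded_domainD[OF dom]
  have "jacobian X (at (inverse_map \<Omega> X x)) = jacobian F (at (inverse_map \<Omega> X x))"
    by (rule jacobian_cong_open[OF D(1) inverse_map_Diff(4)[OF dom X x]]) (use F D(8) in auto)
  then show ?thesis by (simp add: mass_density_def Let_def)
qed

lemma smooth_curve_density:
  assumes dom: "smooth_bounded_domain \<Omega>" and \<rho>0: "smooth_upto (closure \<Omega>) \<rho>0" "\<forall>x\<in>closure \<Omega>. \<rho>0 x > 0"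
    and X: "smooth_curve \<Omega> I X" and t0: "t0 \<in> I"
  obtains e U R where "e > 0" "ball t0 e \<subseteq> I" "open U" "closure \<Omega> \<subseteq> U"
    "smooth_on (ball t0 e \<times> U) (\<lambda>p. R (fst p) (snd p))"
    "\<And>t x. t \<in> ball t0 e \<Longrightarrow> x \<in> U \<Longrightarrow> R t x \<noteq> 0"
    "\<And>t x. t \<in> ball t0 e \<Longrightarrow> x \<in> \<Omega> \<Longrightarrow> R t x = mass_density \<Omega> \<rho>0 (X t) x"
proof -
  note D = smooth_bounded_domainD[OF dom]
  have Diff: "\<And>t. t \<in> I \<Longrightarrow> X t \<in> Diff \<Omega>" using X by (auto simp: smooth_curve_def)
  obtain e U V F Y where E: "e > 0" "ball t0 e \<subseteq> I" "open U" "closure \<Omega> \<subseteq> U" "open V" "closure \<Omega> \<subseteq> V"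
    "smooth_on (ball t0 e \<times> V) (\<lambda>p. F (fst p) (snd p))"
    "smooth_on (ball t0 e \<times> U) (\<lambda>p. Y (fst p) (snd p))"
    "\<And>t x. t \<in> ball t0 e \<Longrightarrow> x \<in> closure \<Omega> \<Longrightarrow> F t x = X t x"
    "\<And>t x. t \<in> ball t0 e \<Longrightarrow> x \<in> closure \<Omega> \<Longrightarrow> Y t x = inverse_map \<Omega> (X t) x"
    "\<And>t x. t \<in> ball t0 e \<Longrightarrow> x \<in> closure \<Omega> \<Longrightarrow> det (jacobian (F t) (at x)) \<noteq> 0"
    by (rule smooth_curve_extension[OF dom X t0]) (rule that; (assumption | simp))
  obtain P r where r: "open P" "closure \<Omega> \<subseteq> P" "smooth_on P r" "\<And>x. x \<in> closure \<Omega> \<Longrightarrow> r x = \<rho>0 x"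
    using \<rho>0(1) unfolding smooth_upto_def by blast
  let ?T = "ball t0 e"
  have t0T: "t0 \<in> ?T" using E(1) by simp
  define J where "J p = det (jacobian (F (fst p)) (at (snd p)))" for p
  \<comment> \<open>Here the quotient of initial density and Jacobian is smooth and nonzero. The
    preimage \<open>Q\<close> of this set under the inverse flow is an open neighbourhood of the
    closure at time \<open>t0\<close>, so it contains a tube on which the extended density has no
    zeros.\<close>
  define PV where "PV = {p \<in> ?T \<times> V. J p \<noteq> 0} \<inter> ?T \<times> {y \<in> P. r y \<noteq> 0}"
  have smJ: "smooth_on (?T \<times> V) J"
    unfolding J_def det_jacobian
    by (intro smooth_intros open_Times open_ball E smooth_on_frechet_param)
  have PV: "open PV"
  proof -
    have "open ((?T \<times> V) \<inter> J -` (- {0}))"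
      by (rule continuous_open_preimage[OF smooth_on_continuous[OF smJ] open_Times[OF open_ball E(5)]]) auto
    moreover have "open (P \<inter> r -` (- {0}))"
      by (rule continuous_open_preimage[OF smooth_on_continuous[OF r(3)] r(1)]) auto
    moreover have "PV = ((?T \<times> V) \<inter> J -` (- {0})) \<inter> ?T \<times> (P \<inter> r -` (- {0}))"
      by (auto simp: PV_def)
    ultimately show ?thesis by (simp add: open_Int open_Times)
  qed
  have smJ': "smooth_on PV J" by (rule smooth_on_subset[OF smJ]) (auto simp: PV_def)
  have "smooth_on (UNIV \<times> P) (\<lambda>p. r (snd p))" by (rule smooth_on_space[OF open_UNIV r(1,3)])
  then have smr: "smooth_on PV (\<lambda>p. r (snd p))" by (rule smooth_on_subset) (auto simp: PV_def)
  have smq: "smooth_on PV (\<lambda>p. r (snd p) / J p)"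
    by (rule smooth_on_divide[OF PV smr smJ']) (auto simp: PV_def)
  define \<Psi> where "\<Psi> p = (fst p, Y (fst p) (snd p))" for p
  have O: "open (?T \<times> U)" by (intro open_Times open_ball E)
  have sm\<Psi>: "smooth_on (?T \<times> U) \<Psi>"
    unfolding \<Psi>_def by (intro smooth_intros O E)
  define Q where "Q = (?T \<times> U) \<inter> \<Psi> -` PV"
  have Q: "open Q"
    unfolding Q_def by (rule continuous_open_preimage[OF smooth_on_continuous[OF sm\<Psi>] O PV])
  have inPV: "(t, inverse_map \<Omega> (X t) x) \<in> PV" if "t \<in> ?T" "x \<in> closure \<Omega>" for t x
  proof -
    have "inverse_map \<Omega> (X t) x \<in> closure \<Omega>"
      using inverse_map_Diff(3)[OF dom Diff] that E(2) by blast
    then show ?thesis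
      using that E(6) E(11)[OF that(1)] r(2,4) \<rho>0(2) unfolding PV_def J_def by fastforce
  qed
  have KQ: "?T \<times> closure \<Omega> \<subseteq> Q"
    using inPV E(4,10) by (auto simp: Q_def \<Psi>_def)
  have t0Q: "{t0} \<times> closure \<Omega> \<subseteq> Q" using KQ t0T by blast
  have smR: "smooth_on Q (\<lambda>p. r (snd (\<Psi> p)) / J (\<Psi> p))"
    by (rule smooth_on_compose[OF smq Q smooth_on_subset[OF sm\<Psi>]]) (auto simp: Q_def)
  obtain e' U' where eU: "e' > 0" "open U'" "closure \<Omega> \<subseteq> U'" "ball t0 e' \<times> U' \<subseteq> Q"
    by (rule open_tube[OF D(5) Q t0Q])
  have sube: "ball t0 e' \<subseteq> ?T" using eU(3,4) D(3,8) unfolding Q_def by blast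
  show ?thesis
  proof (rule that[of e' U' "\<lambda>t x. r (snd (\<Psi> (t, x))) / J (\<Psi> (t, x))"])
    show "ball t0 e' \<subseteq> I" using sube E(2) by blast
    show "smooth_on (ball t0 e' \<times> U') (\<lambda>p. r (snd (\<Psi> (fst p, snd p))) / J (\<Psi> (fst p, snd p)))"
      using smooth_on_subset[OF smR eU(4)] by simp
    show "r (snd (\<Psi> (t, x))) / J (\<Psi> (t, x)) \<noteq> 0" if "t \<in> ball t0 e'" "x \<in> U'" for t x
    proof -
      have "(t, x) \<in> Q" using eU(4) that by blast
      then have "\<Psi> (t, x) \<in> PV" by (simp add: Q_def)
      then show ?thesis by (auto simp: PV_def)
    qed
    show "r (snd (\<Psi> (t, x))) / J (\<Psi> (t, x)) = mass_density \<Omega> \<rho>0 (X t) x" if t: "t \<in> ball t0 e'" and x: "x \<in> \<Omega>" for t x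
    proof -
      have tT: "t \<in> ?T" and xK: "x \<in> closure \<Omega>" and tI: "t \<in> I" using t x sube D(8) E(2) by auto
      have inK: "inverse_map \<Omega> (X t) x \<in> closure \<Omega>" by (rule inverse_map_Diff(3)[OF dom Diff[OF tI] xK])
      have "mass_density \<Omega> \<rho>0 (X t) x =
          \<rho>0 (inverse_map \<Omega> (X t) x) / det (jacobian (F t) (at (inverse_map \<Omega> (X t) x)))"
        by (rule mass_density_eq[OF dom Diff[OF tI] _ x]) (rule E(9)[OF tT])
      then show ?thesis
        by (simp add: \<Psi>_def E(10)[OF tT xK] r(4)[OF inK] J_def)
    qed
  qed (use eU in blast)+
qed

text \<open>\<open>V\<close> is any smooth family and not only the velocity of \<open>X\<close>. In
  the variation argument the curve runs in the variation parameter, while \<open>V\<close> is the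
  velocity in time.\<close>

lemma smooth_curve_eulerian:
  assumes dom: "smooth_bounded_domain \<Omega>" and X: "smooth_curve \<Omega> I X" and t0: "t0 \<in> I"
    and V: "smooth_upto (I \<times> closure \<Omega>) (\<lambda>(t, x). V t x)"
  obtains e U w where "e > 0" "ball t0 e \<subseteq> I" "open U" "closure \<Omega> \<subseteq> U"
    "smooth_on (ball t0 e \<times> U) (\<lambda>p. w (fst p) (snd p))"
    "\<And>t x. t \<in> ball t0 e \<Longrightarrow> x \<in> closure \<Omega> \<Longrightarrow> w t x = eulerian \<Omega> (X t) (V t) x"
proof -
  note D = smooth_bounded_domainD[OF dom]
  have Diff: "\<And>t. t \<in> I \<Longrightarrow> X t \<in> Diff \<Omega>" using X by (auto simp: smooth_curve_def)
  obtain e U Z F Y where E: "e > 0" "ball t0 e \<subseteq> I" "open U" "closure \<Omega> \<subseteq> U" "open Z" "closure \<Omega> \<subseteq> Z"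
    "smooth_on (ball t0 e \<times> Z) (\<lambda>p. F (fst p) (snd p))"
    "smooth_on (ball t0 e \<times> U) (\<lambda>p. Y (fst p) (snd p))"
    "\<And>t x. t \<in> ball t0 e \<Longrightarrow> x \<in> closure \<Omega> \<Longrightarrow> F t x = X t x"
    "\<And>t x. t \<in> ball t0 e \<Longrightarrow> x \<in> closure \<Omega> \<Longrightarrow> Y t x = inverse_map \<Omega> (X t) x"
    "\<And>t x. t \<in> ball t0 e \<Longrightarrow> x \<in> closure \<Omega> \<Longrightarrow> det (jacobian (F t) (at x)) \<noteq> 0"
    by (rule smooth_curve_extension[OF dom X t0]) (rule that; (assumption | simp))
  let ?T = "ball t0 e"
  have Y: "smooth_upto (?T \<times> closure \<Omega>) (\<lambda>p. Y (fst p) (snd p))"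
    by (rule smooth_upto_on[OF open_Times[OF open_ball E(3)] _ E(8)]) (use E(4) in blast)
  have "smooth_upto (?T \<times> closure \<Omega>) (\<lambda>p. (\<lambda>(t, x). V t x) (fst p, Y (fst p) (snd p)))"
  proof (rule smooth_upto_compose[OF V smooth_upto_Pair[OF smooth_upto_fst Y]])
    have "Y t x \<in> closure \<Omega>" if "t \<in> ?T" "x \<in> closure \<Omega>" for t x
      unfolding E(10)[OF that] by (rule inverse_map_Diff(3)[OF dom Diff that(2)]) (use E(2) that(1) in blast)
    then show "(\<lambda>p. (fst p, Y (fst p) (snd p))) ` (?T \<times> closure \<Omega>) \<subseteq> I \<times> closure \<Omega>"
      using E(2) by auto
  qed
  note smV = this
  have t0T: "t0 \<in> ?T" using E(1) by simp
  obtain e' U' w where w: "e' > 0" "ball t0 e' \<subseteq> ?T" "open U'" "closure \<Omega> \<subseteq> U'"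
    "smooth_on (ball t0 e' \<times> U') (\<lambda>p. w (fst p) (snd p))"
    "\<And>t x. t \<in> ball t0 e' \<Longrightarrow> x \<in> closure \<Omega> \<Longrightarrow> w t x = V t (Y t x)"
    by (rule smooth_upto_tube[OF D(5) open_ball t0T smV]) (rule that, (assumption | simp)+)
  show ?thesis
  proof (rule that[OF w(1) _ w(3-5)])
    show "ball t0 e' \<subseteq> I" using w(2) E(2) by blast
    show "w t x = eulerian \<Omega> (X t) (V t) x" if "t \<in> ball t0 e'" "x \<in> closure \<Omega>" for t x
    proof -
      have "t \<in> ?T" using w(2) that(1) by blast
      from E(10)[OF this that(2)] show ?thesis
        unfolding w(6)[OF that] by (simp add: eulerian_def)
    qed
  qed
qed

lemma smooth_curve_fields:
  assumes dom: "smooth_bounded_domain \<Omega>" and \<rho>0: "smooth_upto (closure \<Omega>) \<rho>0" "\<forall>x\<in>closure \<Omega>. \<rho>0 x > 0"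
    and b: "smooth_upto (closure \<Omega>) b"
    and X: "smooth_curve \<Omega> I X" and t0: "t0 \<in> I" and V: "smooth_upto (I \<times> closure \<Omega>) (\<lambda>(t, x). V t x)"
  obtains e U \<beta> R w where "e > 0" "ball t0 e \<subseteq> I" "open U" "closure \<Omega> \<subseteq> U" "smooth_on U \<beta>"
    "smooth_on (ball t0 e \<times> U) (\<lambda>p. R (fst p) (snd p))"
    "smooth_on (ball t0 e \<times> U) (\<lambda>p. w (fst p) (snd p))"
    "\<And>x. x \<in> closure \<Omega> \<Longrightarrow> \<beta> x = b x"
    "\<And>t x. t \<in> ball t0 e \<Longrightarrow> x \<in> U \<Longrightarrow> R t x \<noteq> 0"
    "\<And>t x. t \<in> ball t0 e \<Longrightarrow> x \<in> \<Omega> \<Longrightarrow> R t x = mass_density \<Omega> \<rho>0 (X t) x"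
    "\<And>t x. t \<in> ball t0 e \<Longrightarrow> x \<in> closure \<Omega> \<Longrightarrow> w t x = eulerian \<Omega> (X t) (V t) x"
proof -
  obtain e1 U1 R where R: "e1 > 0" "ball t0 e1 \<subseteq> I" "open U1" "closure \<Omega> \<subseteq> U1"
    "smooth_on (ball t0 e1 \<times> U1) (\<lambda>p. R (fst p) (snd p))"
    "\<And>t x. t \<in> ball t0 e1 \<Longrightarrow> x \<in> U1 \<Longrightarrow> R t x \<noteq> 0"
    "\<And>t x. t \<in> ball t0 e1 \<Longrightarrow> x \<in> \<Omega> \<Longrightarrow> R t x = mass_density \<Omega> \<rho>0 (X t) x"
    by (rule smooth_curve_density[OF dom \<rho>0 X t0]) (rule that; (assumption | simp))
  obtain e2 U2 w where w: "e2 > 0" "ball t0 e2 \<subseteq> I" "open U2" "closure \<Omega> \<subseteq> U2"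
    "smooth_on (ball t0 e2 \<times> U2) (\<lambda>p. w (fst p) (snd p))"
    "\<And>t x. t \<in> ball t0 e2 \<Longrightarrow> x \<in> closure \<Omega> \<Longrightarrow> w t x = eulerian \<Omega> (X t) (V t) x"
    by (rule smooth_curve_eulerian[OF dom X t0 V]) (rule that; (assumption | simp))
  obtain U3 \<beta> where \<beta>: "open U3" "closure \<Omega> \<subseteq> U3" "smooth_on U3 \<beta>" "\<And>x. x \<in> closure \<Omega> \<Longrightarrow> \<beta> x = b x"
    using b unfolding smooth_upto_def by blast
  let ?U = "U1 \<inter> U2 \<inter> U3" and ?e = "min e1 e2"
  have sub: "ball t0 ?e \<times> ?U \<subseteq> ball t0 e1 \<times> U1" "ball t0 ?e \<times> ?U \<subseteq> ball t0 e2 \<times> U2" "?U \<subseteq> U3" by auto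
  show ?thesis
    by (rule that[of ?e ?U \<beta> R w, OF _ _ _ _ smooth_on_subset[OF \<beta>(3) sub(3)]
          smooth_on_subset[OF R(5) sub(1)] smooth_on_subset[OF w(5) sub(2)]])
      (use R w \<beta> in auto)
qed

lemma smooth_curveD:
  assumes "smooth_curve \<Omega> I X"
  shows "open I" "\<And>t. t \<in> I \<Longrightarrow> X t \<in> Diff \<Omega>" "smooth_upto (I \<times> closure \<Omega>) (\<lambda>(t, x). X t x)"
  using assms by (auto simp: smooth_curve_def open_interval_def)

text \<open>Times range over the open set \<open>I\<close>, so the time derivative at a point of
  \<open>K\<close> only involves values where the extension \<open>g\<close> agrees with the given
  map. The velocity is thus the restriction of a partial derivative of \<open>g\<close>.\<close>

lemma smooth_upto_has_vector_derivative:
  assumes I: "open I" and X: "smooth_upto (I \<times> K) (\<lambda>(t, x). X t x)"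
  shows "smooth_upto (I \<times> K) (\<lambda>(t, x). velocity X t x)"
    and "\<And>t x. t \<in> I \<Longrightarrow> x \<in> K \<Longrightarrow> ((\<lambda>s. X s x) has_vector_derivative velocity X t x) (at t)"
proof -
  obtain W g where W: "open W" "I \<times> K \<subseteq> W" "smooth_on W g" "\<And>p. p \<in> I \<times> K \<Longrightarrow> g p = (\<lambda>(t, x). X t x) p"
    using X unfolding smooth_upto_def by blast
  have d: "((\<lambda>s. X s x) has_vector_derivative frechet_derivative g (at (t, x)) (1, 0)) (at t)"
    if t: "t \<in> I" and x: "x \<in> K" for t x
  proof (rule has_vector_derivative_transform_within_open[OF _ I t])
    show "((\<lambda>s. g (s, x)) has_vector_derivative frechet_derivative g (at (t, x)) (1, 0)) (at t)"
      by (rule smooth_on_has_vector_derivative_slice[OF W(3)]) (use W(2) t x in blast)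
    show "g (s, x) = X s x" if "s \<in> I" for s
      using W(4)[of "(s, x)"] that x by simp
  qed
  have v: "velocity X t x = frechet_derivative g (at (t, x)) (1, 0)" if "t \<in> I" "x \<in> K" for t x
    unfolding velocity_def by (rule vector_derivative_at[OF d[OF that]])
  show "((\<lambda>s. X s x) has_vector_derivative velocity X t x) (at t)" if "t \<in> I" "x \<in> K" for t x
    unfolding v[OF that] by (rule d[OF that])
  have "smooth_upto (I \<times> K) (\<lambda>p. frechet_derivative g (at p) (1, 0))"
    by (rule smooth_upto_on[OF W(1,2) smooth_on_frechet_derivative[OF W(3)]])
  then show "smooth_upto (I \<times> K) (\<lambda>(t, x). velocity X t x)"
    by (rule smooth_upto_cong) (auto simp: v)
qed

lemmas velocity_smooth_upto = smooth_upto_has_vector_derivative(1)[OF smooth_curveD(1,3)]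
lemmas velocity_has_vector_derivative = smooth_upto_has_vector_derivative(2)[OF smooth_curveD(1,3)]

lemma smooth_upto_slice:
  assumes "smooth_upto (I \<times> K) (\<lambda>(t, x). V t x)" and "t \<in> I"
  shows "smooth_upto K (V t)"
proof -
  have "smooth_upto K (\<lambda>x. (t, x))"
    by (intro smooth_upto_Pair smooth_upto_const smooth_upto_UNIV smooth_on_ident)
  from smooth_upto_compose[OF assms(1) this] assms(2) show ?thesis by auto
qed

lemma smooth_upto_eulerian:
  assumes dom: "smooth_bounded_domain \<Omega>" and X: "X \<in> Diff \<Omega>" and V: "smooth_upto (closure \<Omega>) V"
  shows "smooth_upto (closure \<Omega>) (eulerian \<Omega> X V)"
proof -
  have "smooth_upto (closure \<Omega>) (inverse_map \<Omega> X)" using X by (simp add: Diff_def)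
  moreover have "inverse_map \<Omega> X ` closure \<Omega> \<subseteq> closure \<Omega>"
    using inverse_map_Diff(3)[OF dom X] by blast
  ultimately show ?thesis
    unfolding eulerian_def[abs_def] by (rule smooth_upto_compose[OF V])
qed

lemma eulerian_compose:
  assumes dom: "smooth_bounded_domain \<Omega>" and X: "X \<in> Diff \<Omega>" and V: "\<And>x. x \<in> closure \<Omega> \<Longrightarrow> V x = \<zeta> (X x)"
    and x: "x \<in> closure \<Omega>"
  shows "eulerian \<Omega> X V x = \<zeta> x"
  using V[OF inverse_map_Diff(3)[OF dom X x]] inverse_map_Diff(2)[OF dom X x] by (simp add: eulerian_def)

text \<open>Particles starting on the frontier remain there, so \<open>d\<close> is zero along their
  paths. The time derivative of this constant is the inner product of the velocity with
  \<open>grad d\<close>.\<close>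

lemma tangent_field_velocity:
  assumes dom: "smooth_bounded_domain \<Omega>" and X: "smooth_curve \<Omega> I X" and t: "t \<in> I"
  shows "tangent_field \<Omega> (eulerian \<Omega> (X t) (velocity X t))"
  unfolding tangent_field_def
proof (intro conjI allI impI ballI)
  note D = smooth_bounded_domainD[OF dom] and C = smooth_curveD[OF X]
  show "smooth_upto (closure \<Omega>) (eulerian \<Omega> (X t) (velocity X t))"
    by (rule smooth_upto_eulerian[OF dom C(2)[OF t] smooth_upto_slice[OF velocity_smooth_upto[OF X X] t]])
  fix d x assume d: "defining_function \<Omega> d" and x: "x \<in> frontier \<Omega>"
  have sd: "smooth_on UNIV d" using d by (simp add: defining_function_def)
  note fr = frontier_defining_function(1)[OF d]
  define y where "y = inverse_map \<Omega> (X t) x"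
  have xK: "x \<in> closure \<Omega>" using x D(9) by blast
  have y: "y \<in> frontier \<Omega>" "y \<in> closure \<Omega>" "X t y = x"
    using inverse_map_Diff[OF dom C(2)[OF t]] x xK by (auto simp: y_def)
  have zero: "d (X s y) = 0" if "s \<in> I" for s
  proof -
    have "X s y \<in> frontier \<Omega>" using C(2)[OF that] y(1) by (auto simp: Diff_def)
    then show ?thesis by (simp add: fr)
  qed
  have "((\<lambda>s. X s y) has_derivative (\<lambda>h. h *\<^sub>R velocity X t y)) (at t)"
    using velocity_has_vector_derivative[OF X X t y(2)] by (simp add: has_vector_derivative_def)
  from has_derivative_imp_has_vector_derivative[OF has_derivative_compose[OF this
      has_derivative_grad[OF smooth_on_differentiable[OF sd UNIV_I]]]]
  have 1: "((\<lambda>s. d (X s y)) has_vector_derivative grad d x \<bullet> velocity X t y) (at t)"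
    by (simp add: y(3))
  have 2: "((\<lambda>s. d (X s y)) has_vector_derivative 0) (at t)"
    by (rule has_vector_derivative_transform_within_open[OF has_vector_derivative_const C(1) t]) (simp add: zero)
  have "grad d x \<bullet> velocity X t y = 0"
    using vector_derivative_at[OF 1] vector_derivative_at[OF 2] by simp
  then show "eulerian \<Omega> (X t) (velocity X t) x \<bullet> grad d x = 0"
    by (simp add: eulerian_def y_def inner_commute)
qed

lemma field_along_velocity:
  assumes dom: "smooth_bounded_domain \<Omega>" and X: "smooth_curve \<Omega> I X"
  shows "field_along \<Omega> I X (velocity X)"
  unfolding field_along_def
proof (intro conjI ballI)
  show "smooth_upto (I \<times> closure \<Omega>) (\<lambda>(t, x). velocity X t x)" by (rule velocity_smooth_upto[OF X X])
  fix t assume t: "t \<in> I"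
  have "velocity X t x = eulerian \<Omega> (X t) (velocity X t) (X t x)" if "x \<in> closure \<Omega>" for x
    using inverse_map_Diff(1)[OF dom smooth_curveD(2)[OF X t] that] by (simp add: eulerian_def)
  then show "velocity X t \<in> tangent_space \<Omega> (X t)"
    unfolding tangent_space_def using tangent_field_velocity[OF dom X t] by blast
qed

lemma gn_metric_cong:
  assumes dom: "smooth_bounded_domain \<Omega>" and X: "X \<in> Diff \<Omega>"
    and "\<And>x. x \<in> closure \<Omega> \<Longrightarrow> V x = V' x" "\<And>x. x \<in> closure \<Omega> \<Longrightarrow> W x = W' x"
  shows "gn_metric \<Omega> b \<rho>0 X V W = gn_metric \<Omega> b \<rho>0 X V' W'"
proof -
  note D = smooth_bounded_domainD[OF dom]
  have "eulerian \<Omega> X V x = eulerian \<Omega> X V' x" "eulerian \<Omega> X W x = eulerian \<Omega> X W' x" if "x \<in> \<Omega>" for x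
    using inverse_map_Diff(4)[OF dom X that] assms(3,4) D(8) by (auto simp: eulerian_def)
  then show ?thesis
    unfolding gn_metric_eq
    by (intro set_lebesgue_integral_cong) (use D(1) in \<open>auto intro!: gn_density_cong_open[OF D(1)]\<close>)
qed

lemma gn_metric_commute: "gn_metric \<Omega> b \<rho>0 X V W = gn_metric \<Omega> b \<rho>0 X W V"
proof -
  have "gn_density b (mass_density \<Omega> \<rho>0 X) (eulerian \<Omega> X V) (eulerian \<Omega> X W) =
      gn_density b (mass_density \<Omega> \<rho>0 X) (eulerian \<Omega> X W) (eulerian \<Omega> X V)"
    by (rule ext) (rule gn_density_commute)
  then show ?thesis by (simp only: gn_metric_eq)
qed

section \<open>Conservation of mass and the differential of the potential\<close>

lemma continuity_equation:
  assumes dom: "smooth_bounded_domain \<Omega>" and X: "smooth_curve \<Omega> I X" and \<rho>0: "\<forall>x\<in>closure \<Omega>. \<rho>0 x > 0"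
    and e: "e > 0" and U: "open U" "closure \<Omega> \<subseteq> U" and sub: "ball t0 e \<subseteq> I"
    and R: "smooth_on (ball t0 e \<times> U) (\<lambda>p. R (fst p) (snd p))"
    and RX: "\<And>t x. t \<in> ball t0 e \<Longrightarrow> x \<in> \<Omega> \<Longrightarrow> R t x = mass_density \<Omega> \<rho>0 (X t) x"
    and w: "smooth_on U w" and wX: "\<And>x. x \<in> \<Omega> \<Longrightarrow> w x = eulerian \<Omega> (X t0) (velocity X t0) x"
    and x: "x \<in> \<Omega>"
  shows "vector_derivative (\<lambda>s. R s x) (at t0) + divg (\<lambda>y. R t0 y *\<^sub>R w y) x = 0"
proof -
  note D = smooth_bounded_domainD[OF dom] and Diff = smooth_curveD(2)[OF X]
  have t0: "t0 \<in> ball t0 e" "t0 \<in> I" using e sub by auto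
  obtain e' U' V F Y where E: "e' > 0" "ball t0 e' \<subseteq> I" "open U'" "closure \<Omega> \<subseteq> U'" "open V" "closure \<Omega> \<subseteq> V"
    "smooth_on (ball t0 e' \<times> V) (\<lambda>p. F (fst p) (snd p))"
    "smooth_on (ball t0 e' \<times> U') (\<lambda>p. Y (fst p) (snd p))"
    "\<And>t x. t \<in> ball t0 e' \<Longrightarrow> x \<in> closure \<Omega> \<Longrightarrow> F t x = X t x"
    "\<And>t x. t \<in> ball t0 e' \<Longrightarrow> x \<in> closure \<Omega> \<Longrightarrow> Y t x = inverse_map \<Omega> (X t) x"
    "\<And>t x. t \<in> ball t0 e' \<Longrightarrow> x \<in> closure \<Omega> \<Longrightarrow> det (jacobian (F t) (at x)) \<noteq> 0"
    by (rule smooth_curve_extension[OF dom X t0(2)]) (rule that; (assumption | simp))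
  have t0': "t0 \<in> ball t0 e'" using E(1) by simp
  note I0 = inverse_map_Diff[OF dom Diff[OF t0(2)]]
  define y where "y = inverse_map \<Omega> (X t0) x"
  have xK: "x \<in> closure \<Omega>" and xU: "x \<in> U" using x D(8) U(2) by auto
  have y: "y \<in> \<Omega>" using I0(4)[OF x] by (simp add: y_def)
  then have yK: "y \<in> closure \<Omega>" and yV: "y \<in> V" using D(8) E(6) by auto
  have Fy: "F t0 y = x" using E(9)[OF t0' yK] I0(2)[OF xK] by (simp add: y_def)
  define a where "a t = frechet_derivative (F t) (at y) (axis 1 1)" for t
  define c where "c t = frechet_derivative (F t) (at y) (axis 2 1)" for t
  define J where "J t = a t $ 1 * c t $ 2 - c t $ 1 * a t $ 2" for t
  have J: "J t = det (jacobian (F t) (at y))" for t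
    by (simp add: J_def a_def c_def det_jacobian)
  have J0: "J t0 \<noteq> 0" using E(11)[OF t0' yK] by (simp add: J)
  \<comment> \<open>Mass conservation along a particle path: density times Jacobian determinant does
    not change in time. The equation is the derivative of this product at \<open>t0\<close>.\<close>
  have prod: "R t (F t y) * J t = \<rho>0 y" if t: "t \<in> ball t0 (min e e')" for t
  proof -
    have te: "t \<in> ball t0 e" "t \<in> ball t0 e'" using t by auto
    then have XD: "X t \<in> Diff \<Omega>" using sub Diff by blast
    note It = inverse_map_Diff[OF dom XD]
    have FX: "F t y = X t y" by (rule E(9)[OF te(2) yK])
    have "mass_density \<Omega> \<rho>0 (X t) (X t y) = \<rho>0 (inverse_map \<Omega> (X t) (X t y)) / det (jacobian (F t) (at (inverse_map \<Omega> (X t) (X t y))))"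
      by (rule mass_density_eq[OF dom XD _ It(5)[OF y]]) (rule E(9)[OF te(2)])
    then have "R t (F t y) = \<rho>0 y / J t"
      using RX[OF te(1) It(5)[OF y]] FX It(1)[OF yK] by (simp add: J)
    moreover have "J t \<noteq> 0" using E(11)[OF te(2) yK] by (simp add: J)
    ultimately show ?thesis by simp
  qed
  have vel: "vector_derivative (\<lambda>s. F s z) (at t0) = w (F t0 z)" if z: "z \<in> \<Omega>" for z
  proof -
    have zK: "z \<in> closure \<Omega>" using z D(8) by blast
    have "vector_derivative (\<lambda>s. F s z) (at t0) = velocity X t0 z"
      unfolding velocity_def by (rule vector_derivative_cong_open[OF open_ball t0']) (rule E(9)[OF _ zK])
    also have "\<dots> = eulerian \<Omega> (X t0) (velocity X t0) (X t0 z)"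
      by (simp add: eulerian_def I0(1)[OF zK])
    also have "\<dots> = w (F t0 z)"
      using wX[OF I0(5)[OF z]] E(9)[OF t0' zK] by simp
    finally show ?thesis .
  qed
  have F0: "smooth_on V (F t0)" by (rule smooth_on_slice[OF E(7) t0' E(5)])
  have wd: "(w has_derivative frechet_derivative w (at x)) (at x)" by (rule smooth_on_has_derivative[OF w xU])
  have Dv: "frechet_derivative (\<lambda>z. vector_derivative (\<lambda>s. F s z) (at t0)) (at y) v =
      frechet_derivative w (at x) (frechet_derivative (F t0) (at y) v)" for v
  proof -
    have "frechet_derivative (\<lambda>z. vector_derivative (\<lambda>s. F s z) (at t0)) (at y) = frechet_derivative (\<lambda>z. w (F t0 z)) (at y)"
      by (rule frechet_derivative_cong_open[OF D(1) y]) (rule vel)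
    moreover have "((\<lambda>z. w (F t0 z)) has_derivative (\<lambda>v. frechet_derivative w (at x) (frechet_derivative (F t0) (at y) v))) (at y)"
      by (rule has_derivative_compose[OF smooth_on_has_derivative[OF F0 yV]]) (simp only: Fy wd)
    ultimately show ?thesis using frechet_derivative_at by metis
  qed
  define p where "p = frechet_derivative w (at x) (axis 1 1)"
  define q where "q = frechet_derivative w (at x) (axis 2 1)"
  have Dw: "frechet_derivative w (at x) v = v $ 1 *\<^sub>R p + v $ 2 *\<^sub>R q" for v
    unfolding p_def q_def by (rule linear_plane[OF has_derivative_linear[OF wd]])
  have da: "((\<lambda>t. frechet_derivative (F t) (at y) v $ i) has_real_derivative
      frechet_derivative (F t0) (at y) v $ 1 * p $ i + frechet_derivative (F t0) (at y) v $ 2 * q $ i) (at t0)" for v i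
    using bounded_linear.has_vector_derivative[OF bounded_linear_vec_nth
        frechet_derivative_time_derivative[OF open_ball E(5,7) t0' yV, of v], of i]
    unfolding Dv Dw by (simp add: has_real_derivative_iff_has_vector_derivative)
  \<comment> \<open>Jacobi's formula: the columns of the Jacobian evolve by the matrix with columns
    \<open>p\<close> and \<open>q\<close>, so the determinant changes at the rate of its trace, the
    divergence of \<open>w\<close>.\<close>
  have dJ: "(J has_real_derivative (p $ 1 + q $ 2) * J t0) (at t0)"
  proof -
    have "(J has_real_derivative
        ((a t0 $ 1 * p $ 1 + a t0 $ 2 * q $ 1) * c t0 $ 2 + (c t0 $ 1 * p $ 2 + c t0 $ 2 * q $ 2) * a t0 $ 1) -
        ((c t0 $ 1 * p $ 1 + c t0 $ 2 * q $ 1) * a t0 $ 2 + (a t0 $ 1 * p $ 2 + a t0 $ 2 * q $ 2) * c t0 $ 1)) (at t0)"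
      unfolding J_def[abs_def] a_def c_def by (intro DERIV_diff DERIV_mult da)
    moreover have "((a t0 $ 1 * p $ 1 + a t0 $ 2 * q $ 1) * c t0 $ 2 + (c t0 $ 1 * p $ 2 + c t0 $ 2 * q $ 2) * a t0 $ 1) -
        ((c t0 $ 1 * p $ 1 + c t0 $ 2 * q $ 1) * a t0 $ 2 + (a t0 $ 1 * p $ 2 + a t0 $ 2 * q $ 2) * c t0 $ 1) = (p $ 1 + q $ 2) * J t0"
      by (simp add: J_def algebra_simps)
    ultimately show ?thesis by simp
  qed
  have dR: "((\<lambda>t. R t (F t y)) has_real_derivative vector_derivative (\<lambda>s. R s x) (at t0) + grad (R t0) x \<bullet> w x) (at t0)"
  proof -
    let ?R = "\<lambda>p. R (fst p) (snd p)"
    have px: "(t0, x) \<in> ball t0 e \<times> U" using t0 xU by auto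
    have R0: "smooth_on U (R t0)" by (rule smooth_on_slice[OF R t0(1) U(1)])
    have Rd: "(?R has_derivative frechet_derivative ?R (at (t0, x))) (at (t0, F t0 y))"
      unfolding Fy by (rule smooth_on_has_derivative[OF R px])
    have "((\<lambda>t. F t y) has_vector_derivative w x) (at t0)"
      using smooth_on_has_vector_derivative[OF E(7), of t0 y] vel[OF y] t0' yV by (simp add: Fy)
    then have "((\<lambda>t. (t, F t y)) has_derivative (\<lambda>h. (h, h *\<^sub>R w x))) (at t0)"
      unfolding has_vector_derivative_def by (intro has_derivative_Pair has_derivative_ident)
    from has_derivative_imp_has_vector_derivative[OF has_derivative_compose[OF this Rd]]
    have "((\<lambda>t. R t (F t y)) has_real_derivative frechet_derivative ?R (at (t0, x)) (1, w x)) (at t0)"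
      by (simp add: has_real_derivative_iff_has_vector_derivative)
    moreover have "frechet_derivative ?R (at (t0, x)) (1, w x) =
        frechet_derivative ?R (at (t0, x)) (1, 0) + frechet_derivative ?R (at (t0, x)) (0, w x)"
      using linear_add[OF has_derivative_linear[OF smooth_on_has_derivative[OF R px]], of "(1, 0)" "(0, w x)"] by simp
    ultimately show ?thesis
      unfolding smooth_on_vector_derivative_slice[OF R px, symmetric] smooth_on_frechet_slice[OF R px, symmetric]
        frechet_derivative_eq_grad[OF smooth_on_differentiable[OF R0 xU]] by simp
  qed
  have "((\<lambda>t. R t (F t y) * J t) has_real_derivative 0) (at t0)"
    by (rule has_field_derivative_transform_within_open[OF DERIV_const[of "\<rho>0 y"] open_ball[of t0 "min e e'"]])
      (use e E(1) prod in auto)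
  then have "(vector_derivative (\<lambda>s. R s x) (at t0) + grad (R t0) x \<bullet> w x) * J t0 + (p $ 1 + q $ 2) * J t0 * R t0 x = 0"
    using DERIV_unique[OF DERIV_mult[OF dR dJ]] by (simp add: Fy)
  then have "J t0 * (vector_derivative (\<lambda>s. R s x) (at t0) + grad (R t0) x \<bullet> w x + (p $ 1 + q $ 2) * R t0 x) = 0"
    by (simp add: algebra_simps)
  then have "vector_derivative (\<lambda>s. R s x) (at t0) + grad (R t0) x \<bullet> w x + (p $ 1 + q $ 2) * R t0 x = 0"
    using J0 by simp
  moreover have "divg (\<lambda>y. R t0 y *\<^sub>R w y) x = R t0 x * (p $ 1 + q $ 2) + grad (R t0) x \<bullet> w x"
    using divg_scaleR[OF smooth_on_differentiable[OF smooth_on_slice[OF R t0(1) U(1)] xU] smooth_on_differentiable[OF w xU]]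
    by (simp add: divg_eq p_def q_def)
  ultimately show ?thesis by (simp add: algebra_simps)
qed

text \<open>The integrand changes at the rate \<open>\<rho> - b\<close> times the time derivative of
  the density. The latter is minus the divergence of the mass flux, and integration by parts moves
  the derivative onto \<open>\<rho> - b\<close>.\<close>

lemma potential_energy_derivative:
  assumes dom: "smooth_bounded_domain \<Omega>" and b: "smooth_upto (closure \<Omega>) b"
    and \<rho>0: "smooth_upto (closure \<Omega>) \<rho>0" "\<forall>x\<in>closure \<Omega>. \<rho>0 x > 0"
    and X: "smooth_curve \<Omega> I X" and t: "t \<in> I"
  shows "((\<lambda>r. potential_energy \<Omega> b \<rho>0 (X r)) has_real_derivative
    (LINT x:\<Omega>|lborel. mass_density \<Omega> \<rho>0 (X t) x *
      (grad (\<lambda>y. mass_density \<Omega> \<rho>0 (X t) y - b y) x \<bullet> eulerian \<Omega> (X t) (velocity X t) x))) (at t)"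
proof -
  note D = smooth_bounded_domainD[OF dom]
  obtain d where d: "defining_function \<Omega> d" using dom by (auto simp: smooth_bounded_domain_def)
  obtain e U \<beta> R w where E: "e > 0" "ball t e \<subseteq> I" "open U" "closure \<Omega> \<subseteq> U" "smooth_on U \<beta>"
    "smooth_on (ball t e \<times> U) (\<lambda>p. R (fst p) (snd p))"
    "smooth_on (ball t e \<times> U) (\<lambda>p. w (fst p) (snd p))"
    "\<And>x. x \<in> closure \<Omega> \<Longrightarrow> \<beta> x = b x"
    "\<And>s x. s \<in> ball t e \<Longrightarrow> x \<in> U \<Longrightarrow> R s x \<noteq> 0"
    "\<And>s x. s \<in> ball t e \<Longrightarrow> x \<in> \<Omega> \<Longrightarrow> R s x = mass_density \<Omega> \<rho>0 (X s) x"
    "\<And>s x. s \<in> ball t e \<Longrightarrow> x \<in> closure \<Omega> \<Longrightarrow> w s x = eulerian \<Omega> (X s) (velocity X s) x"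
    by (rule smooth_curve_fields[OF dom \<rho>0 b X t velocity_smooth_upto[OF X X]]) (rule that, (assumption | simp)+)
  have tb: "t \<in> ball t e" using E(1) by simp
  have sub: "\<Omega> \<subseteq> U" using D(8) E(4) by blast
  have R0: "smooth_on U (R t)" and w0: "smooth_on U (w t)"
    using smooth_on_slice[OF E(6) tb E(3)] smooth_on_slice[OF E(7) tb E(3)] by auto
  let ?f = "\<lambda>y. R t y - \<beta> y" and ?\<xi> = "\<lambda>y. R t y *\<^sub>R w t y"
  have smf: "smooth_on U ?f" and sm\<xi>: "smooth_on U ?\<xi>"
    by (intro smooth_intros E R0 w0)+
  have cont: "vector_derivative (\<lambda>s. R s x) (at t) + divg ?\<xi> x = 0" if "x \<in> \<Omega>" for x
    by (rule continuity_equation[OF dom X \<rho>0(2) E(1,3,4,2,6,10) w0 _ that]) (use E(11)[OF tb] D(8) in auto)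
  have sm: "smooth_on (ball t e \<times> U) (\<lambda>p. R (fst p) (snd p) ^ 2 / 2 - R (fst p) (snd p) * \<beta> (snd p))"
    unfolding divide_inverse
    by (intro smooth_intros open_Times open_ball E(3,6) smooth_on_space[OF open_ball E(3,5)])
  have der: "vector_derivative (\<lambda>s. R s x ^ 2 / 2 - R s x * \<beta> x) (at t) =
      R t x * (grad ?f x \<bullet> w t x) - divg (\<lambda>y. ?f y *\<^sub>R ?\<xi> y) x" if x: "x \<in> \<Omega>" for x
  proof -
    have xU: "x \<in> U" and px: "(t, x) \<in> ball t e \<times> U" using x sub tb by auto
    have "((\<lambda>s. R s x) has_real_derivative - divg ?\<xi> x) (at t)"
      using smooth_on_has_vector_derivative[OF E(6) px] cont[OF x]
      by (simp add: has_real_derivative_iff_has_vector_derivative add_eq_0_iff)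
    then have "((\<lambda>s. R s x ^ 2 / 2 - R s x * \<beta> x) has_real_derivative (R t x - \<beta> x) * - divg ?\<xi> x) (at t)"
      by (auto intro!: derivative_eq_intros simp: algebra_simps)
    then have "vector_derivative (\<lambda>s. R s x ^ 2 / 2 - R s x * \<beta> x) (at t) = (R t x - \<beta> x) * - divg ?\<xi> x"
      unfolding has_real_derivative_iff_has_vector_derivative by (rule vector_derivative_at)
    moreover have "divg (\<lambda>y. ?f y *\<^sub>R ?\<xi> y) x = ?f x * divg ?\<xi> x + grad ?f x \<bullet> ?\<xi> x"
      by (rule divg_scaleR[OF smooth_on_differentiable[OF smf xU] smooth_on_differentiable[OF sm\<xi> xU]])
    ultimately show ?thesis by simp
  qed
  have int: "set_integrable lborel \<Omega> g" if "smooth_on U g" for g :: "plane \<Rightarrow> real"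
    by (rule set_integrable_continuous_closure[OF D(1,4) continuous_on_subset[OF smooth_on_continuous[OF that] E(4)]])
  have tang: "?\<xi> x \<bullet> grad d x = 0" if "x \<in> frontier \<Omega>" for x
    using tangent_field_velocity[OF dom X t] d that E(11)[OF tb] D(9) by (auto simp: tangent_field_def)
  have 0: "(LINT x:\<Omega>|lborel. divg (\<lambda>y. ?f y *\<^sub>R ?\<xi> y) x) = 0"
    by (rule integral_divg_scaleR[OF d D(4) E(3,4) smf sm\<xi> tang])
  have "(LINT x:\<Omega>|lborel. vector_derivative (\<lambda>s. R s x ^ 2 / 2 - R s x * \<beta> x) (at t)) =
      (LINT x:\<Omega>|lborel. R t x * (grad ?f x \<bullet> w t x) - divg (\<lambda>y. ?f y *\<^sub>R ?\<xi> y) x)"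
    by (rule set_lebesgue_integral_cong) (use D(1) der in auto)
  also have "\<dots> = (LINT x:\<Omega>|lborel. R t x * (grad ?f x \<bullet> w t x)) - (LINT x:\<Omega>|lborel. divg (\<lambda>y. ?f y *\<^sub>R ?\<xi> y) x)"
    by (rule set_integral_diff(2); rule int; intro smooth_intros E(3) R0 w0 smooth_on_grad smooth_on_divg smf sm\<xi>)
  also have "\<dots> = (LINT x:\<Omega>|lborel. R t x * (grad ?f x \<bullet> w t x))"
    by (simp only: 0 diff_0_right)
  also have "\<dots> = (LINT x:\<Omega>|lborel. mass_density \<Omega> \<rho>0 (X t) x *
      (grad (\<lambda>y. mass_density \<Omega> \<rho>0 (X t) y - b y) x \<bullet> eulerian \<Omega> (X t) (velocity X t) x))"
  proof (rule set_lebesgue_integral_cong)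
    have g: "grad ?f x = grad (\<lambda>y. mass_density \<Omega> \<rho>0 (X t) y - b y) x" if "x \<in> \<Omega>" for x
      by (rule grad_cong_open[OF D(1) that]) (use E(8) E(10)[OF tb] D(8) in auto)
    show "\<forall>x. x \<in> \<Omega> \<longrightarrow> R t x * (grad ?f x \<bullet> w t x) = mass_density \<Omega> \<rho>0 (X t) x *
      (grad (\<lambda>y. mass_density \<Omega> \<rho>0 (X t) y - b y) x \<bullet> eulerian \<Omega> (X t) (velocity X t) x)"
      using g E(10)[OF tb] E(11)[OF tb] D(8) by auto
  qed (use D(1) in simp)
  finally have eq: "(LINT x:\<Omega>|lborel. vector_derivative (\<lambda>s. R s x ^ 2 / 2 - R s x * \<beta> x) (at t)) = \<dots>" .
  have "((\<lambda>s. LINT x:\<Omega>|lborel. R s x ^ 2 / 2 - R s x * \<beta> x) has_real_derivative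
    (LINT x:\<Omega>|lborel. vector_derivative (\<lambda>s. R s x ^ 2 / 2 - R s x * \<beta> x) (at t))) (at t)"
    by (rule leibniz_integral_smooth[OF D(1,4) E(1,3,4) sm])
  then show ?thesis
    unfolding eq
  proof (rule has_field_derivative_transform_within_open[OF _ open_ball tb])
    fix s assume s: "s \<in> ball t e"
    show "(LINT x:\<Omega>|lborel. R s x ^ 2 / 2 - R s x * \<beta> x) = potential_energy \<Omega> b \<rho>0 (X s)"
      unfolding potential_energy_def Let_def
      by (rule set_lebesgue_integral_cong) (use D(1,8) E(8) E(10)[OF s] in auto)
  qed
qed

section \<open>Variations of diffeomorphisms\<close>

lemma smooth_on_lipschitz_cball:
  fixes f :: "'a::euclidean_space \<Rightarrow> real"
  assumes f: "smooth_on UNIV f"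
  obtains L where "L \<ge> 0" "\<And>x y. x \<in> cball 0 r \<Longrightarrow> y \<in> cball 0 r \<Longrightarrow> \<bar>f x - f y\<bar> \<le> L * norm (x - y)"
proof -
  let ?h = "\<lambda>x. \<Sum>b\<in>Basis. norm (frechet_derivative f (at x) b)"
  have cpt: "compact (?h ` cball 0 r)"
    by (intro compact_continuous_image continuous_intros compact_cball
        continuous_on_subset[OF smooth_on_continuous[OF smooth_on_frechet_derivative[OF f]] subset_UNIV])
  obtain L where L: "\<forall>y\<in>?h ` cball 0 r. norm y \<le> L"
    using compact_imp_bounded[OF cpt] unfolding bounded_iff by blast
  have on: "onorm (frechet_derivative f (at x)) \<le> \<bar>L\<bar>" if "x \<in> cball 0 r" for x
  proof -
    have "onorm (frechet_derivative f (at x)) \<le> ?h x"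
      by (rule onorm_le_sum_Basis[OF linear_frechet_derivative[OF smooth_on_differentiable[OF f UNIV_I]]])
    moreover have "norm (?h x) \<le> L" using L that by blast
    ultimately show ?thesis by simp
  qed
  have der: "(f has_derivative frechet_derivative f (at x)) (at x within cball 0 r)" for x
    by (rule has_derivative_at_withinI[OF smooth_on_has_derivative[OF f UNIV_I]])
  have "\<bar>f x - f y\<bar> \<le> \<bar>L\<bar> * norm (x - y)" if "x \<in> cball 0 r" "y \<in> cball 0 r" for x y
    using differentiable_bound[OF convex_cball der on that] by simp
  then show ?thesis by (intro that[of "\<bar>L\<bar>"]) simp_all
qed

lemma det_jacobian_id: "det (jacobian (\<lambda>x. x) (at (x :: plane))) = 1"
  by (simp add: det_jacobian axis_def)

text \<open>The map fixes the zero set of \<open>d\<close>. At interior points it changes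
  \<open>d\<close> by at most a small multiple of \<open>\<bar>d x\<bar>\<close>, because both the
  displacement carries the factor \<open>d\<close> and \<open>d\<close> is Lipschitz; so
  \<open>d\<close> stays negative. Injectivity and nonvanishing Jacobian persist from
  \<open>s = 0\<close> by the parametric inverse theorem, and surjectivity comes from
  connectedness.\<close>

lemma variation_Diff:
  assumes dom: "smooth_bounded_domain \<Omega>" and d: "defining_function \<Omega> d"
    and U: "open U" "closure \<Omega> \<subseteq> U" and \<psi>: "smooth_on U \<psi>"
  obtains \<delta> where "\<delta> > 0" "\<And>s. s \<in> ball 0 \<delta> \<Longrightarrow> (\<lambda>x. x + s *\<^sub>R (d x *\<^sub>R \<psi> x)) \<in> Diff \<Omega>"
proof -
  note D = smooth_bounded_domainD[OF dom]
  have sd: "smooth_on UNIV d" and \<Omega>d: "\<Omega> = {x. d x < 0}" using d by (auto simp: defining_function_def)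
  have fr: "frontier \<Omega> = {x. d x = 0}" by (rule frontier_defining_function(1)[OF d])
  define F where "F s x = x + s *\<^sub>R (d x *\<^sub>R \<psi> x)" for s x
  have sdU: "smooth_on U d" by (rule smooth_on_subset[OF sd]) simp
  have W: "open ((UNIV :: real set) \<times> U)" by (intro open_Times U open_UNIV)
  have smF: "smooth_on (UNIV \<times> U) (\<lambda>p. F (fst p) (snd p))"
    unfolding F_def by (intro smooth_intros W smooth_on_space[OF open_UNIV U(1)] sdU \<psi>)
  have F0: "F 0 = (\<lambda>x. x)" by (simp add: F_def fun_eq_iff)
  have sub: "{s} \<times> closure \<Omega> \<subseteq> UNIV \<times> U" for s :: real using U(2) by auto
  have inj0: "inj_on (F 0) (closure \<Omega>)" by (simp add: F0 inj_on_def)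
  have det0: "det (jacobian (F 0) (at x)) \<noteq> 0" for x by (simp add: F0 det_jacobian_id)
  obtain e N g where N: "e > 0" "ball 0 e \<times> closure \<Omega> \<subseteq> N"
    "\<And>s x. (s, x) \<in> N \<Longrightarrow> det (jacobian (F s) (at x)) \<noteq> 0" "\<And>s x. (s, x) \<in> N \<Longrightarrow> g s (F s x) = x"
    by (rule smooth_parametric_inverse[OF W smF D(5) sub inj0 det0]) (rule that, (assumption | simp)+)
  obtain B where B: "\<forall>x\<in>closure \<Omega>. norm x \<le> B"
    using compact_imp_bounded[OF D(5)] unfolding bounded_iff by blast
  have c\<psi>: "compact ((\<lambda>x. norm (\<psi> x)) ` closure \<Omega>)" "compact ((\<lambda>x. norm (d x *\<^sub>R \<psi> x)) ` closure \<Omega>)"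
    by (intro compact_continuous_image continuous_intros D(5) continuous_on_subset[OF smooth_on_continuous[OF \<psi>] U(2)]
        continuous_on_subset[OF smooth_on_continuous[OF sd] subset_UNIV])+
  obtain M where M: "\<forall>y\<in>(\<lambda>x. norm (\<psi> x)) ` closure \<Omega>. norm y \<le> M"
    using compact_imp_bounded[OF c\<psi>(1)] unfolding bounded_iff by blast
  obtain M' where M': "\<forall>y\<in>(\<lambda>x. norm (d x *\<^sub>R \<psi> x)) ` closure \<Omega>. norm y \<le> M'"
    using compact_imp_bounded[OF c\<psi>(2)] unfolding bounded_iff by blast
  obtain L where L: "L \<ge> 0" "\<And>x y. x \<in> cball 0 (B + M') \<Longrightarrow> y \<in> cball 0 (B + M') \<Longrightarrow> \<bar>d x - d y\<bar> \<le> L * norm (x - y)"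
    using smooth_on_lipschitz_cball[OF sd] by blast
  \<comment> \<open>The bound 1 keeps images within the ball of radius \<open>B + M'\<close>, on
    which \<open>L\<close> is a Lipschitz constant of \<open>d\<close>. The last bound yields
    \<open>\<bar>s\<bar> * (L * \<bar>M\<bar>) < 1\<close>, the added 1 excluding a zero
    denominator.\<close>
  define \<delta> where "\<delta> = min e (min 1 (1 / (L * \<bar>M\<bar> + 1)))"
  have LM: "L * \<bar>M\<bar> + 1 > 0" using L(1) by (intro add_nonneg_pos) auto
  have \<delta>: "\<delta> > 0" using N(1) LM by (simp add: \<delta>_def)
  have "F s \<in> Diff \<Omega>" if s: "s \<in> ball 0 \<delta>" for s
  proof -
    have se: "s \<in> ball 0 e" and s1: "\<bar>s\<bar> \<le> 1" and sL: "\<bar>s\<bar> < 1 / (L * \<bar>M\<bar> + 1)"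
      using s by (auto simp: \<delta>_def)
    have inN: "(s, x) \<in> N" if "x \<in> closure \<Omega>" for x using N(2) se that by blast
    have injF: "inj_on (F s) (closure \<Omega>)"
      by (rule inj_on_inverseI[of _ "g s"]) (rule N(4)[OF inN])
    have detF: "det (jacobian (F s) (at x)) \<noteq> 0" if "x \<in> closure \<Omega>" for x
      by (rule N(3)[OF inN[OF that]])
    have Ffr: "F s x = x" if "x \<in> frontier \<Omega>" for x using that fr by (simp add: F_def)
    have F\<Omega>: "F s x \<in> \<Omega>" if x: "x \<in> \<Omega>" for x
    proof -
      have xK: "x \<in> closure \<Omega>" using x D(8) by blast
      have dx: "d x < 0" using x \<Omega>d by blast
      have nx: "norm x \<le> B" using B xK by blast
      have np: "norm (d x *\<^sub>R \<psi> x) \<le> M'" using M' xK by fastforce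
      have n\<psi>: "norm (\<psi> x) \<le> \<bar>M\<bar>" using M xK by fastforce
      have "norm (F s x) \<le> norm x + \<bar>s\<bar> * norm (d x *\<^sub>R \<psi> x)"
        unfolding F_def using norm_triangle_ineq[of x "s *\<^sub>R (d x *\<^sub>R \<psi> x)"] by (simp only: norm_scaleR)
      also have "\<dots> \<le> B + 1 * M'"
        by (intro add_mono mult_mono nx np s1) auto
      finally have 1: "F s x \<in> cball 0 (B + M')" by simp
      have "0 \<le> M'" using np norm_ge_zero order_trans by blast
      then have 2: "x \<in> cball 0 (B + M')" using nx by simp
      have "\<bar>d (F s x) - d x\<bar> \<le> L * norm (F s x - x)" by (rule L(2)[OF 1 2])
      also have "norm (F s x - x) = \<bar>s\<bar> * \<bar>d x\<bar> * norm (\<psi> x)" by (simp add: F_def abs_mult)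
      also have "L * (\<bar>s\<bar> * \<bar>d x\<bar> * norm (\<psi> x)) \<le> L * (\<bar>s\<bar> * \<bar>d x\<bar> * \<bar>M\<bar>)"
        by (intro mult_left_mono n\<psi> L(1)) auto
      also have "\<dots> = \<bar>s\<bar> * (L * \<bar>M\<bar>) * \<bar>d x\<bar>" by simp
      also have "\<dots> < 1 * \<bar>d x\<bar>"
      proof (rule mult_strict_right_mono)
        have "\<bar>s\<bar> * (L * \<bar>M\<bar>) \<le> \<bar>s\<bar> * (L * \<bar>M\<bar> + 1)" by (intro mult_left_mono) auto
        also have "\<dots> < 1" using sL LM by (simp add: pos_less_divide_eq)
        finally show "\<bar>s\<bar> * (L * \<bar>M\<bar>) < 1" .
        show "0 < \<bar>d x\<bar>" using dx by simp
      qed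
      finally have "d (F s x) < 0" using dx by linarith
      then show ?thesis by (simp add: \<Omega>d)
    qed
    have smFs: "smooth_on U (F s)" by (rule smooth_on_slice[OF smF UNIV_I U(1)])
    have contK: "continuous_on (closure \<Omega>) (F s)"
      by (rule continuous_on_subset[OF smooth_on_continuous[OF smFs] U(2)])
    \<comment> \<open>The image of \<open>\<Omega>\<close> is open by invariance of domain. It is
      also closed in \<open>\<Omega>\<close>, since the compact image of the closure exceeds it by
      frontier points only. A nonempty such subset of a connected set is the whole set.\<close>
    have op: "open (F s ` \<Omega>)"
      by (rule invariance_of_domain[OF continuous_on_subset[OF contK D(8)] D(1) inj_on_subset[OF injF D(8)]])
    have im_fr: "F s ` frontier \<Omega> = frontier \<Omega>" using Ffr by simp
    have "F s ` closure \<Omega> = F s ` \<Omega> \<union> frontier \<Omega>"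
      by (simp only: D(6) image_Un im_fr)
    moreover have "closed (F s ` closure \<Omega>)"
      by (rule compact_imp_closed[OF compact_continuous_image[OF contK D(5)]])
    moreover have sub\<Omega>: "F s ` \<Omega> \<subseteq> \<Omega>" using F\<Omega> by blast
    ultimately have "closedin (top_of_set \<Omega>) (F s ` \<Omega>)"
      unfolding closedin_closed using D(7) by (intro exI[of _ "F s ` closure \<Omega>"]) blast
    moreover have "openin (top_of_set \<Omega>) (F s ` \<Omega>)"
      using op sub\<Omega> by (simp add: openin_open_eq D(1))
    ultimately have "F s ` \<Omega> = \<Omega>"
      using D(2,3) unfolding connected_clopen by blast
    then have surj: "F s ` closure \<Omega> = closure \<Omega>"
      using \<open>F s ` closure \<Omega> = F s ` \<Omega> \<union> frontier \<Omega>\<close> D(6) by simp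
    obtain r U' Y where Y: "r > 0" "open U'" "closure \<Omega> \<subseteq> U'"
      "smooth_on (ball s r \<times> U') (\<lambda>p. Y (fst p) (snd p))"
      "\<And>t x. t \<in> ball s r \<Longrightarrow> x \<in> closure \<Omega> \<Longrightarrow> Y t (F t x) = x"
      by (rule smooth_parametric_inverse_surj[OF W smF D(5) sub injF detF surj], assumption)
        (rule that, (assumption | simp)+)
    have sr: "s \<in> ball s r" using Y(1) by simp
    have inv: "inverse_map \<Omega> (F s) x = Y s x" if x: "x \<in> closure \<Omega>" for x
    proof -
      obtain z where z: "z \<in> closure \<Omega>" "x = F s z" using surj x by blast
      then have "inverse_map \<Omega> (F s) x = z" using injF by (simp add: inverse_map_def)
      then show ?thesis using Y(5)[OF sr z(1)] z(2) by simp
    qed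
    have "smooth_upto (closure \<Omega>) (inverse_map \<Omega> (F s))"
      by (rule smooth_upto_cong[OF smooth_upto_on[OF Y(2,3) smooth_on_slice[OF Y(4) sr Y(2)]]]) (simp add: inv)
    moreover have "smooth_upto (closure \<Omega>) (F s)" by (rule smooth_upto_on[OF U smFs])
    ultimately show ?thesis
      using injF surj im_fr by (simp add: Diff_def bij_betw_def)
  qed
  then show ?thesis using that \<delta> unfolding F_def[abs_def] by blast
qed

lemma Diff_compose:
  assumes dom: "smooth_bounded_domain \<Omega>" and P: "P \<in> Diff \<Omega>" and X: "X \<in> Diff \<Omega>"
  shows "(\<lambda>x. P (X x)) \<in> Diff \<Omega>"
proof -
  note IP = inverse_map_Diff[OF dom P] and IX = inverse_map_Diff[OF dom X]
  have bij: "bij_betw (\<lambda>x. P (X x)) (closure \<Omega>) (closure \<Omega>)"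
    using bij_betw_trans[of X "closure \<Omega>" "closure \<Omega>" P "closure \<Omega>"] P X by (auto simp: Diff_def o_def)
  have inv: "inverse_map \<Omega> (\<lambda>x. P (X x)) x = inverse_map \<Omega> X (inverse_map \<Omega> P x)" if x: "x \<in> closure \<Omega>" for x
  proof -
    let ?y = "inverse_map \<Omega> X (inverse_map \<Omega> P x)"
    have y: "?y \<in> closure \<Omega>" "P (X ?y) = x" using IP IX x by auto
    then show ?thesis
      using inv_into_f_f[OF bij_betw_imp_inj_on[OF bij] y(1)] by (simp add: inverse_map_def)
  qed
  have sm: "smooth_upto (closure \<Omega>) P" "smooth_upto (closure \<Omega>) X"
    "smooth_upto (closure \<Omega>) (inverse_map \<Omega> P)" "smooth_upto (closure \<Omega>) (inverse_map \<Omega> X)"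
    "P ` frontier \<Omega> = frontier \<Omega>" "X ` frontier \<Omega> = frontier \<Omega>"
    using P X by (auto simp: Diff_def)
  have "smooth_upto (closure \<Omega>) (inverse_map \<Omega> (\<lambda>x. P (X x)))"
    by (rule smooth_upto_cong[OF smooth_upto_compose[OF sm(4,3)]]) (use IP(3) inv in auto)
  moreover have "smooth_upto (closure \<Omega>) (\<lambda>x. P (X x))"
    by (rule smooth_upto_compose[OF sm(1,2)]) (use IX(7) in auto)
  moreover have "(\<lambda>x. P (X x)) ` frontier \<Omega> = frontier \<Omega>"
    using sm(5,6) by (metis image_image)
  ultimately show ?thesis using bij by (simp add: Diff_def)
qed

text \<open>The variation composes every \<open>X t\<close> with diffeomorphisms that do not depend
  on the curve. Hence \<open>\<delta>\<close> is chosen before \<open>I\<close> and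
  \<open>X\<close>, and the range of \<open>s\<close> is uniform in time.\<close>

lemma smooth_surface_variation:
  assumes dom: "smooth_bounded_domain \<Omega>" and d: "defining_function \<Omega> d"
    and U: "open U" "closure \<Omega> \<subseteq> U" and \<psi>: "smooth_on U \<psi>"
  obtains \<delta> where "\<delta> > 0"
    "\<And>I X. smooth_curve \<Omega> I X \<Longrightarrow> smooth_surface \<Omega> (ball 0 \<delta>) I (\<lambda>s t x. X t x + s *\<^sub>R (d (X t x) *\<^sub>R \<psi> (X t x)))"
proof -
  obtain \<delta> where \<delta>: "\<delta> > 0" "\<And>s. s \<in> ball 0 \<delta> \<Longrightarrow> (\<lambda>x. x + s *\<^sub>R (d x *\<^sub>R \<psi> x)) \<in> Diff \<Omega>"
    using variation_Diff[OF dom d U \<psi>] by blast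
  have "smooth_surface \<Omega> (ball 0 \<delta>) I (\<lambda>s t x. X t x + s *\<^sub>R (d (X t x) *\<^sub>R \<psi> (X t x)))"
    if X: "smooth_curve \<Omega> I X" for I X
    unfolding smooth_surface_def
  proof (intro conjI ballI)
    note C = smooth_curveD[OF X]
    show "open_interval (ball 0 \<delta>)" by (simp add: open_interval_def is_interval_ball_real)
    show "open_interval I" using X by (simp add: smooth_curve_def)
    let ?S = "ball 0 \<delta> \<times> I \<times> closure \<Omega>"
    have sX: "smooth_upto ?S (\<lambda>p. (\<lambda>(t, x). X t x) (snd p))"
      by (rule smooth_upto_compose[OF C(3) smooth_upto_snd]) auto
    have "smooth_upto (closure \<Omega>) (\<lambda>x. d x *\<^sub>R \<psi> x)"
    proof (rule smooth_upto_on[OF U])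
      have "smooth_on U d"
        using d by (intro smooth_on_subset[of UNIV d U]) (simp_all add: defining_function_def)
      then show "smooth_on U (\<lambda>x. d x *\<^sub>R \<psi> x)" by (intro smooth_on_scaleR U(1) \<psi>)
    qed
    then have s\<phi>: "smooth_upto ?S (\<lambda>p. d ((\<lambda>(t, x). X t x) (snd p)) *\<^sub>R \<psi> ((\<lambda>(t, x). X t x) (snd p)))"
      by (rule smooth_upto_compose[OF _ sX]) (use C(2) inverse_map_Diff(7)[OF dom] in auto)
    have "smooth_upto ?S (\<lambda>p. (\<lambda>(t, x). X t x) (snd p) + fst p *\<^sub>R
        (d ((\<lambda>(t, x). X t x) (snd p)) *\<^sub>R \<psi> ((\<lambda>(t, x). X t x) (snd p))))"
      by (rule smooth_upto_add[OF sX smooth_upto_scaleR[OF smooth_upto_fst s\<phi>]])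
    then show "smooth_upto ?S (\<lambda>(s, t, x). X t x + s *\<^sub>R (d (X t x) *\<^sub>R \<psi> (X t x)))"
      by (rule smooth_upto_cong) auto
    fix s t :: real assume "s \<in> ball 0 \<delta>" "t \<in> I"
    from Diff_compose[OF dom \<delta>(2)[OF this(1)] C(2)[OF this(2)]]
    show "(\<lambda>x. X t x + s *\<^sub>R (d (X t x) *\<^sub>R \<psi> (X t x))) \<in> Diff \<Omega>" .
  qed
  then show ?thesis using that \<delta>(1) by blast
qed

lemma smooth_surfaceD:
  assumes X: "smooth_surface \<Omega> J I X"
  shows "s \<in> J \<Longrightarrow> smooth_curve \<Omega> I (X s)" and "t \<in> I \<Longrightarrow> smooth_curve \<Omega> J (\<lambda>s. X s t)"
proof -
  have sm: "smooth_upto (J \<times> I \<times> closure \<Omega>) (\<lambda>(s, t, x). X s t x)"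
    and JI: "open_interval J" "open_interval I" and D: "\<And>s t. s \<in> J \<Longrightarrow> t \<in> I \<Longrightarrow> X s t \<in> Diff \<Omega>"
    using X by (auto simp: smooth_surface_def)
  show "smooth_curve \<Omega> I (X s)" if s: "s \<in> J"
  proof -
    have "smooth_upto (I \<times> closure \<Omega>) (\<lambda>p. (s, p))"
      by (intro smooth_upto_Pair smooth_upto_const smooth_upto_UNIV smooth_on_ident)
    from smooth_upto_compose[OF sm this] s
    have "smooth_upto (I \<times> closure \<Omega>) (\<lambda>p. (\<lambda>(s, t, x). X s t x) (s, p))" by auto
    then show ?thesis
      unfolding smooth_curve_def using JI(2) D[OF s] by (simp add: case_prod_unfold)
  qed
  show "smooth_curve \<Omega> J (\<lambda>s. X s t)" if t: "t \<in> I"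
  proof -
    have "smooth_upto (J \<times> closure \<Omega>) (\<lambda>p. (fst p, t, snd p))"
      by (intro smooth_upto_Pair smooth_upto_const smooth_upto_fst smooth_upto_snd)
    moreover have "(\<lambda>p. (fst p, t, snd p)) ` (J \<times> closure \<Omega>) \<subseteq> J \<times> I \<times> closure \<Omega>" using t by auto
    ultimately have "smooth_upto (J \<times> closure \<Omega>) (\<lambda>p. (\<lambda>(s, t, x). X s t x) (fst p, t, snd p))"
      by (rule smooth_upto_compose[OF sm])
    then show ?thesis
      unfolding smooth_curve_def using JI(1) D[OF _ t] by (simp add: case_prod_unfold)
  qed
qed

lemma smooth_curve_const:
  assumes "X \<in> Diff \<Omega>"
  shows "smooth_curve \<Omega> UNIV (\<lambda>_. X)"
proof -
  have "smooth_upto (UNIV \<times> closure \<Omega>) (\<lambda>p :: real \<times> plane. X (snd p))"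
    by (rule smooth_upto_compose[OF _ smooth_upto_snd]) (use assms in \<open>auto simp: Diff_def\<close>)
  then show ?thesis
    using assms by (simp add: smooth_curve_def open_interval_def case_prod_unfold)
qed

lemma integral_zero_imp_zero:
  fixes f :: "'a::euclidean_space \<Rightarrow> real"
  assumes \<Omega>: "open \<Omega>" "bounded \<Omega>" and f: "continuous_on (closure \<Omega>) f"
    and nonneg: "\<And>x. x \<in> \<Omega> \<Longrightarrow> f x \<ge> 0" and int: "(LINT x:\<Omega>|lborel. f x) = 0" and x: "x \<in> \<Omega>"
  shows "f x = 0"
proof (rule ccontr)
  assume "f x \<noteq> 0"
  define N where "N = \<Omega> \<inter> f -` {0<..}"
  have "open N"
    unfolding N_def by (rule continuous_open_preimage[OF continuous_on_subset[OF f closure_subset] \<Omega>(1)]) simp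
  moreover have "x \<in> N" using nonneg[OF x] x \<open>f x \<noteq> 0\<close> by (simp add: N_def)
  ultimately have not_negl: "\<not> negligible N" using open_not_negligible by blast
  have "integrable lborel (\<lambda>x. indicator \<Omega> x *\<^sub>R f x)"
    using set_integrable_continuous_closure[OF \<Omega> f] by (simp add: set_integrable_def)
  then have "AE x in lborel. indicator \<Omega> x *\<^sub>R f x = 0"
    using integral_nonneg_eq_0_iff_AE[of lborel "\<lambda>x. indicator \<Omega> x *\<^sub>R f x"] int nonneg
    by (auto simp: set_lebesgue_integral_def indicator_def)
  then have "AE x in lborel. x \<notin> N"
    by eventually_elim (auto simp: N_def)
  then have "N \<in> null_sets lborel"
    using AE_iff_null_sets[of N lborel] \<open>open N\<close> by simp
  then have "negligible N"
    using null_sets_completionI negligible_iff_null_sets by blast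
  then show False using not_negl by contradiction
qed

lemma tangent_fieldD:
  assumes "tangent_field \<Omega> \<zeta>"
  obtains U z where "open U" "closure \<Omega> \<subseteq> U" "smooth_on U z" "\<And>x. x \<in> closure \<Omega> \<Longrightarrow> z x = \<zeta> x"
    "\<And>d x. defining_function \<Omega> d \<Longrightarrow> x \<in> frontier \<Omega> \<Longrightarrow> z x \<bullet> grad d x = 0"
proof -
  obtain U z where U: "open U" "closure \<Omega> \<subseteq> U" "smooth_on U z" "\<And>x. x \<in> closure \<Omega> \<Longrightarrow> z x = \<zeta> x"
    using assms unfolding tangent_field_def smooth_upto_def by blast
  moreover have "z x \<bullet> grad d x = 0" if "defining_function \<Omega> d" "x \<in> frontier \<Omega>" for d x
  proof -
    have "x \<in> closure \<Omega>" using that(2) by (simp add: frontier_def)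
    then show ?thesis using U(4) assms that by (simp add: tangent_field_def)
  qed
  ultimately show ?thesis using that by blast
qed

section \<open>Extended fields and the metric at a fixed diffeomorphism\<close>

lemma static_fields:
  assumes dom: "smooth_bounded_domain \<Omega>" and b: "smooth_upto (closure \<Omega>) b"
    and \<rho>0: "smooth_upto (closure \<Omega>) \<rho>0" "\<forall>x\<in>closure \<Omega>. \<rho>0 x > 0" and X: "X \<in> Diff \<Omega>"
  obtains U \<beta> R where "open U" "closure \<Omega> \<subseteq> U" "smooth_on U \<beta>" "smooth_on U R"
    "\<And>x. x \<in> closure \<Omega> \<Longrightarrow> \<beta> x = b x" "\<And>x. x \<in> U \<Longrightarrow> R x \<noteq> 0"
    "\<And>x. x \<in> \<Omega> \<Longrightarrow> R x = mass_density \<Omega> \<rho>0 X x"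
proof -
  \<comment> \<open>A single diffeomorphism is treated as a constant curve, whose extended density
    is read off at time 0.\<close>
  obtain e U1 R where R: "e > 0" "ball (0 :: real) e \<subseteq> UNIV" "open U1" "closure \<Omega> \<subseteq> U1"
    "smooth_on (ball (0 :: real) e \<times> U1) (\<lambda>p. R (fst p) (snd p))"
    "\<And>t x. t \<in> ball (0 :: real) e \<Longrightarrow> x \<in> U1 \<Longrightarrow> R t x \<noteq> 0"
    "\<And>t x. t \<in> ball (0 :: real) e \<Longrightarrow> x \<in> \<Omega> \<Longrightarrow> R t x = mass_density \<Omega> \<rho>0 X x"
    by (rule smooth_curve_density[OF dom \<rho>0 smooth_curve_const[OF X] UNIV_I[of 0]]) (rule that, (assumption | simp)+)
  obtain U2 \<beta> where \<beta>: "open U2" "closure \<Omega> \<subseteq> U2" "smooth_on U2 \<beta>" "\<And>x. x \<in> closure \<Omega> \<Longrightarrow> \<beta> x = b x"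
    using b unfolding smooth_upto_def by blast
  have 0: "0 \<in> ball 0 e" using R(1) by simp
  have sR: "smooth_on U1 (R 0)" by (rule smooth_on_slice[OF R(5) 0 R(3)])
  show ?thesis
    by (rule that[of "U1 \<inter> U2" \<beta> "R 0", OF _ _ smooth_on_subset[OF \<beta>(3)] smooth_on_subset[OF sR]])
      (use R(3,4) R(6,7)[OF 0] \<beta> in auto)
qed

lemma gn_metric_eq_operator:
  assumes dom: "smooth_bounded_domain \<Omega>" and b: "smooth_upto (closure \<Omega>) b"
    and \<rho>0: "smooth_upto (closure \<Omega>) \<rho>0" "\<forall>x\<in>closure \<Omega>. \<rho>0 x > 0" and X: "X \<in> Diff \<Omega>"
    and \<zeta>: "tangent_field \<Omega> \<zeta>" and V: "\<And>x. x \<in> closure \<Omega> \<Longrightarrow> V x = \<zeta> (X x)"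
    and \<eta>: "smooth_upto (closure \<Omega>) \<eta>" and W: "\<And>x. x \<in> closure \<Omega> \<Longrightarrow> W x = \<eta> (X x)"
  shows "gn_metric \<Omega> b \<rho>0 X V W = (LINT x:\<Omega>|lborel. mass_density \<Omega> \<rho>0 X x *
    (\<zeta> x \<bullet> gn_operator b (mass_density \<Omega> \<rho>0 X) \<eta> x))"
proof -
  note D = smooth_bounded_domainD[OF dom]
  obtain d where d: "defining_function \<Omega> d" using dom by (auto simp: smooth_bounded_domain_def)
  obtain U1 \<beta> R where S: "open U1" "closure \<Omega> \<subseteq> U1" "smooth_on U1 \<beta>" "smooth_on U1 R"
    "\<And>x. x \<in> closure \<Omega> \<Longrightarrow> \<beta> x = b x" "\<And>x. x \<in> U1 \<Longrightarrow> R x \<noteq> 0"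
    "\<And>x. x \<in> \<Omega> \<Longrightarrow> R x = mass_density \<Omega> \<rho>0 X x"
    by (rule static_fields[OF dom b \<rho>0 X]) (rule that, (assumption | simp)+)
  obtain U2 z where z: "open U2" "closure \<Omega> \<subseteq> U2" "smooth_on U2 z" "\<And>x. x \<in> closure \<Omega> \<Longrightarrow> z x = \<zeta> x"
    "\<And>d x. defining_function \<Omega> d \<Longrightarrow> x \<in> frontier \<Omega> \<Longrightarrow> z x \<bullet> grad d x = 0"
    by (rule tangent_fieldD[OF \<zeta>]) (rule that, (assumption | simp)+)
  obtain U3 h where h: "open U3" "closure \<Omega> \<subseteq> U3" "smooth_on U3 h" "\<And>x. x \<in> closure \<Omega> \<Longrightarrow> h x = \<eta> x"
    using \<eta> unfolding smooth_upto_def by blast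
  let ?U = "U1 \<inter> U2 \<inter> U3"
  have U: "open ?U" "closure \<Omega> \<subseteq> ?U" using S z h by auto
  have sm: "smooth_on ?U \<beta>" "smooth_on ?U R" "smooth_on ?U h" "smooth_on ?U z"
    using S(3,4) z(3) h(3) by (auto intro: smooth_on_subset)
  have nz: "R x \<noteq> 0" if "x \<in> ?U" for x using S(6) that by blast
  have ev: "eulerian \<Omega> X V x = z x" "eulerian \<Omega> X W x = h x" if "x \<in> \<Omega>" for x
    using eulerian_compose[OF dom X, of V \<zeta> x] eulerian_compose[OF dom X, of W \<eta> x] V W that D(8) z(4) h(4) by auto
  have "gn_metric \<Omega> b \<rho>0 X V W = (LINT x:\<Omega>|lborel. gn_density \<beta> R z h x)"
    unfolding gn_metric_eq
  proof (rule set_lebesgue_integral_cong)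
    have "gn_density b (mass_density \<Omega> \<rho>0 X) (eulerian \<Omega> X V) (eulerian \<Omega> X W) x = gn_density \<beta> R z h x" if x: "x \<in> \<Omega>" for x
      by (rule gn_density_cong_open[OF D(1) x]) (use S(5,7) ev D(8) in auto)
    then show "\<forall>x. x \<in> \<Omega> \<longrightarrow> gn_density b (mass_density \<Omega> \<rho>0 X) (eulerian \<Omega> X V) (eulerian \<Omega> X W) x = gn_density \<beta> R z h x"
      by blast
  qed (use D(1) in simp)
  also have "\<dots> = (LINT x:\<Omega>|lborel. R x * (z x \<bullet> gn_operator \<beta> R h x))"
    by (rule integral_gn_density[OF d D(4) U sm nz z(5)[OF d]])
  also have "\<dots> = (LINT x:\<Omega>|lborel. mass_density \<Omega> \<rho>0 X x * (\<zeta> x \<bullet> gn_operator b (mass_density \<Omega> \<rho>0 X) \<eta> x))"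
  proof (rule set_lebesgue_integral_cong)
    have "gn_operator \<beta> R h x = gn_operator b (mass_density \<Omega> \<rho>0 X) \<eta> x" if x: "x \<in> \<Omega>" for x
      by (rule gn_operator_cong_open[OF D(1) x]) (use S(5,7) h(4) D(8) in auto)
    then show "\<forall>x. x \<in> \<Omega> \<longrightarrow> R x * (z x \<bullet> gn_operator \<beta> R h x) =
        mass_density \<Omega> \<rho>0 X x * (\<zeta> x \<bullet> gn_operator b (mass_density \<Omega> \<rho>0 X) \<eta> x)"
      using S(7) z(4) D(8) by auto
  qed (use D(1) in simp)
  finally show ?thesis .
qed

text \<open>Homogeneity of the divergence is proved for differentiable fields; differentiability is
  taken from a smooth extension of the Eulerian field of \<open>V\<close>.\<close>

lemma gn_metric_scaleR:
  assumes dom: "smooth_bounded_domain \<Omega>" and X: "X \<in> Diff \<Omega>"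
    and \<zeta>: "tangent_field \<Omega> \<zeta>" and V: "\<And>x. x \<in> closure \<Omega> \<Longrightarrow> V x = \<zeta> (X x)"
  shows "gn_metric \<Omega> b \<rho>0 X (\<lambda>x. c *\<^sub>R V x) W = c * gn_metric \<Omega> b \<rho>0 X V W"
proof -
  note D = smooth_bounded_domainD[OF dom]
  obtain U z where z: "open U" "closure \<Omega> \<subseteq> U" "smooth_on U z" "\<And>x. x \<in> closure \<Omega> \<Longrightarrow> z x = \<zeta> x"
    "\<And>d x. defining_function \<Omega> d \<Longrightarrow> x \<in> frontier \<Omega> \<Longrightarrow> z x \<bullet> grad d x = 0"
    by (rule tangent_fieldD[OF \<zeta>]) (rule that, (assumption | simp)+)
  let ?\<rho> = "mass_density \<Omega> \<rho>0 X"
  have "gn_density b ?\<rho> (eulerian \<Omega> X (\<lambda>x. c *\<^sub>R V x)) (eulerian \<Omega> X W) x =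
      c * gn_density b ?\<rho> (eulerian \<Omega> X V) (eulerian \<Omega> X W) x" if x: "x \<in> \<Omega>" for x
  proof -
    have ev: "eulerian \<Omega> X V y = z y" if "y \<in> \<Omega>" for y
      using eulerian_compose[OF dom X, of V \<zeta> y] V that D(8) z(4) by auto
    have ec: "eulerian \<Omega> X (\<lambda>x. c *\<^sub>R V x) y = c *\<^sub>R eulerian \<Omega> X V y" for y by (simp add: eulerian_def)
    have xU: "x \<in> U" using x D(8) z(2) by blast
    have "divg (eulerian \<Omega> X (\<lambda>x. c *\<^sub>R V x)) x = divg (\<lambda>y. c *\<^sub>R z y) x"
      by (rule divg_cong_open[OF D(1) x]) (simp add: ec ev)
    also have "\<dots> = c * divg z x"
      unfolding divg_eqI[OF has_derivative_scaleR_right[OF smooth_on_has_derivative[OF z(3) xU]]]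
      by (simp add: divg_eq algebra_simps)
    also have "divg z x = divg (eulerian \<Omega> X V) x"
      by (rule divg_cong_open[OF D(1) x]) (simp add: ev)
    finally have dv: "divg (eulerian \<Omega> X (\<lambda>x. c *\<^sub>R V x)) x = c * divg (eulerian \<Omega> X V) x" .
    show ?thesis
      by (simp add: gn_density_def ec dv algebra_simps)
  qed
  then have "gn_metric \<Omega> b \<rho>0 X (\<lambda>x. c *\<^sub>R V x) W =
      (LINT x:\<Omega>|lborel. c * gn_density b ?\<rho> (eulerian \<Omega> X V) (eulerian \<Omega> X W) x)"
    unfolding gn_metric_eq by (intro set_lebesgue_integral_cong) (use D(1) in auto)
  then show ?thesis by (simp add: gn_metric_eq)
qed

section \<open>The gradient of the potential energy\<close>

text \<open>\<open>inv_into\<close> chooses from a set that depends on the values on the closure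
  only, so the two functions coincide everywhere.\<close>

lemma inverse_map_cong: "(\<And>x. x \<in> closure \<Omega> \<Longrightarrow> X x = X' x) \<Longrightarrow> inverse_map \<Omega> X = inverse_map \<Omega> X'"
  unfolding inverse_map_def inv_into_def by (intro ext arg_cong[where f = Eps]) auto

lemma mass_density_cong:
  assumes dom: "smooth_bounded_domain \<Omega>" and X: "X \<in> Diff \<Omega>"
    and XX': "\<And>x. x \<in> closure \<Omega> \<Longrightarrow> X x = X' x" and x: "x \<in> \<Omega>"
  shows "mass_density \<Omega> \<rho>0 X x = mass_density \<Omega> \<rho>0 X' x"
  using mass_density_eq[OF dom X _ x, of X'] XX' inverse_map_cong[of \<Omega> X X']
  by (simp add: mass_density_def Let_def)

lemma tangent_field_scaleR:
  assumes "tangent_field \<Omega> \<zeta>"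
  shows "tangent_field \<Omega> (\<lambda>x. c *\<^sub>R \<zeta> x)"
  using assms smooth_upto_scaleR[OF smooth_upto_const, of _ \<zeta> c] by (auto simp: tangent_field_def)

text \<open>Integration by parts turns the metric product with \<open>\<eta>\<close> into a weighted
  integral of the operator applied to \<open>\<eta>\<close>. The equation for \<open>\<eta>\<close>
  makes this the differential of the potential along any curve through \<open>X\<close>. The
  constant \<open>c\<close> is carried along as a common factor.\<close>

lemma gradient_potential_energy:
  assumes dom: "smooth_bounded_domain \<Omega>" and b: "smooth_upto (closure \<Omega>) b"
    and \<rho>0: "smooth_upto (closure \<Omega>) \<rho>0" "\<forall>x\<in>closure \<Omega>. \<rho>0 x > 0" and X: "X \<in> Diff \<Omega>"
    and \<eta>: "tangent_field \<Omega> \<eta>"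
    and A: "\<forall>x\<in>\<Omega>. gn_operator b (mass_density \<Omega> \<rho>0 X) \<eta> x = grad (\<lambda>y. mass_density \<Omega> \<rho>0 X y - b y) x"
  shows "has_gradient \<Omega> (gn_metric \<Omega> b \<rho>0) (\<lambda>Y. c * potential_energy \<Omega> b \<rho>0 Y) X (\<lambda>x. c *\<^sub>R \<eta> (X x))"
  unfolding has_gradient_def
proof (intro conjI allI ballI impI)
  note D = smooth_bounded_domainD[OF dom]
  show "(\<lambda>x. c *\<^sub>R \<eta> (X x)) \<in> tangent_space \<Omega> X"
    unfolding tangent_space_def using tangent_field_scaleR[OF \<eta>, of c] by blast
  fix J C t assume t: "t \<in> J" and C: "smooth_curve \<Omega> J C \<and> (\<forall>x\<in>closure \<Omega>. C t x = X x)"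
  then have SC: "smooth_curve \<Omega> J C" and CX: "\<And>x. x \<in> closure \<Omega> \<Longrightarrow> C t x = X x" by auto
  have CD: "C t \<in> Diff \<Omega>" by (rule smooth_curveD(2)[OF SC t])
  define \<zeta> where "\<zeta> = eulerian \<Omega> (C t) (velocity C t)"
  have \<zeta>: "tangent_field \<Omega> \<zeta>" unfolding \<zeta>_def by (rule tangent_field_velocity[OF dom SC t])
  have V\<zeta>: "velocity C t x = \<zeta> (X x)" if "x \<in> closure \<Omega>" for x
    using inverse_map_Diff(1)[OF dom CD that] CX[OF that] by (simp add: \<zeta>_def eulerian_def)
  have \<rho>: "mass_density \<Omega> \<rho>0 (C t) x = mass_density \<Omega> \<rho>0 X x" if "x \<in> \<Omega>" for x
    by (rule mass_density_cong[OF dom CD CX that])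
  have "(LINT x:\<Omega>|lborel. mass_density \<Omega> \<rho>0 (C t) x * (grad (\<lambda>y. mass_density \<Omega> \<rho>0 (C t) y - b y) x \<bullet> \<zeta> x)) =
      (LINT x:\<Omega>|lborel. mass_density \<Omega> \<rho>0 X x * (\<zeta> x \<bullet> gn_operator b (mass_density \<Omega> \<rho>0 X) \<eta> x))"
  proof (rule set_lebesgue_integral_cong)
    have "grad (\<lambda>y. mass_density \<Omega> \<rho>0 (C t) y - b y) x = grad (\<lambda>y. mass_density \<Omega> \<rho>0 X y - b y) x" if "x \<in> \<Omega>" for x
      by (rule grad_cong_open[OF D(1) that]) (simp add: \<rho>)
    then show "\<forall>x. x \<in> \<Omega> \<longrightarrow> mass_density \<Omega> \<rho>0 (C t) x * (grad (\<lambda>y. mass_density \<Omega> \<rho>0 (C t) y - b y) x \<bullet> \<zeta> x) =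
      mass_density \<Omega> \<rho>0 X x * (\<zeta> x \<bullet> gn_operator b (mass_density \<Omega> \<rho>0 X) \<eta> x)"
      using A \<rho> by (simp add: inner_commute)
  qed (use D(1) in simp)
  also have "\<dots> = gn_metric \<Omega> b \<rho>0 X (velocity C t) (\<lambda>x. \<eta> (X x))"
    using gn_metric_eq_operator[OF dom b \<rho>0 X \<zeta> V\<zeta>, of \<eta> "\<lambda>x. \<eta> (X x)"] \<eta> by (simp add: tangent_field_def)
  also have "\<dots> = gn_metric \<Omega> b \<rho>0 X (\<lambda>x. \<eta> (X x)) (velocity C t)" by (rule gn_metric_commute)
  finally have eq: "(LINT x:\<Omega>|lborel. mass_density \<Omega> \<rho>0 (C t) x *
      (grad (\<lambda>y. mass_density \<Omega> \<rho>0 (C t) y - b y) x \<bullet> \<zeta> x)) = \<dots>" .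
  have "((\<lambda>r. c * potential_energy \<Omega> b \<rho>0 (C r)) has_real_derivative
      c * gn_metric \<Omega> b \<rho>0 X (\<lambda>x. \<eta> (X x)) (velocity C t)) (at t)"
    using DERIV_cmult[OF potential_energy_derivative[OF dom b \<rho>0 SC t], of c] unfolding \<zeta>_def[symmetric] eq .
  then show "((\<lambda>r. c * potential_energy \<Omega> b \<rho>0 (C r)) has_real_derivative
      gn_metric \<Omega> b \<rho>0 X (\<lambda>x. c *\<^sub>R \<eta> (X x)) (velocity C t)) (at t)"
    by (simp only: gn_metric_scaleR[OF dom X \<eta> refl])
qed

section \<open>Test fields and the equation satisfied by every gradient\<close>

lemma tangent_field_variation:
  assumes d: "defining_function \<Omega> d"
    and U: "open U" "closure \<Omega> \<subseteq> U" and \<psi>: "smooth_on U \<psi>"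
  shows "tangent_field \<Omega> (\<lambda>x. d x *\<^sub>R \<psi> x)" "smooth_on U (\<lambda>x. d x *\<^sub>R \<psi> x)"
proof -
  have "smooth_on U d" using d by (intro smooth_on_subset[of UNIV d U]) (simp_all add: defining_function_def)
  then show sm: "smooth_on U (\<lambda>x. d x *\<^sub>R \<psi> x)" by (intro smooth_on_scaleR U(1) \<psi>)
  have "d x = 0" if "x \<in> frontier \<Omega>" for x using that frontier_defining_function(1)[OF d] by auto
  then show "tangent_field \<Omega> (\<lambda>x. d x *\<^sub>R \<psi> x)"
    using smooth_upto_on[OF U sm] by (simp add: tangent_field_def)
qed

lemma velocity_variation: "velocity (\<lambda>s x. X x + s *\<^sub>R \<phi> (X x)) s x = \<phi> (X x)"
  unfolding velocity_def
  by (rule vector_derivative_at) (auto intro!: derivative_eq_intros)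

text \<open>The integrand is \<open>d\<close> times the squares of \<open>R\<close> and of the norm
  of \<open>E\<close>, hence of one sign. Since the test field carries \<open>R\<close> too, the
  weight is a square and \<open>R \<noteq> 0\<close> is enough, which is what the extended density
  provides.\<close>

lemma integral_test_field_imp_zero:
  assumes dom: "smooth_bounded_domain \<Omega>" and d: "defining_function \<Omega> d"
    and U: "open U" "closure \<Omega> \<subseteq> U" and R: "smooth_on U R" "\<And>x. x \<in> U \<Longrightarrow> R x \<noteq> 0" and E: "smooth_on U E"
    and int: "(LINT x:\<Omega>|lborel. R x * (E x \<bullet> (d x *\<^sub>R (R x *\<^sub>R E x)))) = 0" and x: "x \<in> \<Omega>"
  shows "E x = 0"
proof -
  note D = smooth_bounded_domainD[OF dom]
  have sd: "smooth_on U d" using d by (intro smooth_on_subset[of UNIV d U]) (simp_all add: defining_function_def)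
  have \<Omega>d: "\<Omega> = {x. d x < 0}" using d by (simp add: defining_function_def)
  let ?f = "\<lambda>x. - (R x * (E x \<bullet> (d x *\<^sub>R (R x *\<^sub>R E x))))"
  have smf: "smooth_on U ?f" by (intro smooth_intros U(1) R(1) E sd)
  have "?f x = 0"
  proof (rule integral_zero_imp_zero[OF D(1,4) _ _ _ x])
    show "continuous_on (closure \<Omega>) ?f" by (rule continuous_on_subset[OF smooth_on_continuous[OF smf] U(2)])
    show "?f x \<ge> 0" if "x \<in> \<Omega>" for x
    proof -
      have eq: "?f x = - d x * ((R x)\<^sup>2 * (E x \<bullet> E x))" by (simp add: power2_eq_square)
      have "0 \<le> - d x * ((R x)\<^sup>2 * (E x \<bullet> E x))"
        using that by (intro mult_nonneg_nonneg) (auto simp: \<Omega>d)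
      then show ?thesis by (simp only: eq)
    qed
    have "(LINT x:\<Omega>|lborel. ?f x) = (LINT x:\<Omega>|lborel. - 1 * (R x * (E x \<bullet> (d x *\<^sub>R (R x *\<^sub>R E x)))))"
      by simp
    also have "\<dots> = - 1 * (LINT x:\<Omega>|lborel. R x * (E x \<bullet> (d x *\<^sub>R (R x *\<^sub>R E x))))"
      by (rule set_integral_mult_right)
    finally show "(LINT x:\<Omega>|lborel. ?f x) = 0" using int by simp
  qed
  moreover have "d x \<noteq> 0" "R x \<noteq> 0" using x R(2) D(8) U(2) by (auto simp: \<Omega>d)
  ultimately show ?thesis by auto
qed

text \<open>A gradient represents the differential along all curves through \<open>X\<close>, in
  particular along those generated by a test field. With \<open>E\<close> the residual of the
  equation for \<open>\<eta>\<close>, comparing the two expressions for this differential shows that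
  \<open>E\<close> is orthogonal to every such field in the weighted sense, and the field built from
  \<open>E\<close> itself forces \<open>E = 0\<close>.\<close>

lemma gradient_potential_energy_unique:
  assumes dom: "smooth_bounded_domain \<Omega>" and b: "smooth_upto (closure \<Omega>) b"
    and \<rho>0: "smooth_upto (closure \<Omega>) \<rho>0" "\<forall>x\<in>closure \<Omega>. \<rho>0 x > 0" and X: "X \<in> Diff \<Omega>" and c: "c \<noteq> 0"
    and G: "has_gradient \<Omega> (gn_metric \<Omega> b \<rho>0) (\<lambda>Y. c * potential_energy \<Omega> b \<rho>0 Y) X G"
  shows "\<exists>\<eta>. tangent_field \<Omega> \<eta> \<and> (\<forall>x\<in>closure \<Omega>. G x = c *\<^sub>R \<eta> (X x)) \<and>
    (\<forall>x\<in>\<Omega>. gn_operator b (mass_density \<Omega> \<rho>0 X) \<eta> x = grad (\<lambda>y. mass_density \<Omega> \<rho>0 X y - b y) x)"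
proof -
  note D = smooth_bounded_domainD[OF dom]
  obtain d where d: "defining_function \<Omega> d" using dom by (auto simp: smooth_bounded_domain_def)
  obtain \<zeta> where \<zeta>: "tangent_field \<Omega> \<zeta>" "\<And>x. x \<in> closure \<Omega> \<Longrightarrow> G x = \<zeta> (X x)"
    using G unfolding has_gradient_def tangent_space_def by blast
  define \<eta> where "\<eta> x = inverse c *\<^sub>R \<zeta> x" for x
  have \<eta>: "tangent_field \<Omega> \<eta>" unfolding \<eta>_def[abs_def] by (rule tangent_field_scaleR[OF \<zeta>(1)])
  have G\<eta>: "G x = c *\<^sub>R \<eta> (X x)" if "x \<in> closure \<Omega>" for x using \<zeta>(2)[OF that] c by (simp add: \<eta>_def)
  obtain U1 \<beta> R where S: "open U1" "closure \<Omega> \<subseteq> U1" "smooth_on U1 \<beta>" "smooth_on U1 R"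
    "\<And>x. x \<in> closure \<Omega> \<Longrightarrow> \<beta> x = b x" "\<And>x. x \<in> U1 \<Longrightarrow> R x \<noteq> 0"
    "\<And>x. x \<in> \<Omega> \<Longrightarrow> R x = mass_density \<Omega> \<rho>0 X x"
    by (rule static_fields[OF dom b \<rho>0 X]) (rule that, (assumption | simp)+)
  obtain U2 h where h: "open U2" "closure \<Omega> \<subseteq> U2" "smooth_on U2 h" "\<And>x. x \<in> closure \<Omega> \<Longrightarrow> h x = \<eta> x"
    using \<eta> unfolding smooth_upto_def tangent_field_def by blast
  let ?U = "U1 \<inter> U2"
  have U: "open ?U" "closure \<Omega> \<subseteq> ?U" using S h by auto
  have sm: "smooth_on ?U \<beta>" "smooth_on ?U R" "smooth_on ?U h"
    using S(3,4) h(3) by (auto intro: smooth_on_subset)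
  have nz: "R x \<noteq> 0" if "x \<in> ?U" for x using S(6) that by blast
  define E where "E x = gn_operator \<beta> R h x - grad (\<lambda>y. R y - \<beta> y) x" for x
  have smE: "smooth_on ?U E"
    unfolding E_def by (intro smooth_on_diff smooth_on_gn_operator smooth_on_grad U(1) sm nz)
  have E\<Omega>: "E x = gn_operator b (mass_density \<Omega> \<rho>0 X) \<eta> x - grad (\<lambda>y. mass_density \<Omega> \<rho>0 X y - b y) x" if x: "x \<in> \<Omega>" for x
  proof -
    have "gn_operator \<beta> R h x = gn_operator b (mass_density \<Omega> \<rho>0 X) \<eta> x"
      by (rule gn_operator_cong_open[OF D(1) x]) (use S(5,7) h(4) D(8) in auto)
    moreover have "grad (\<lambda>y. R y - \<beta> y) x = grad (\<lambda>y. mass_density \<Omega> \<rho>0 X y - b y) x"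
      by (rule grad_cong_open[OF D(1) x]) (use S(5,7) D(8) in auto)
    ultimately show ?thesis by (simp add: E_def)
  qed
  define \<psi> where "\<psi> x = R x *\<^sub>R E x" for x
  have sm\<psi>: "smooth_on ?U \<psi>" unfolding \<psi>_def by (intro smooth_on_scaleR U(1) sm smE)
  define \<phi> where "\<phi> x = d x *\<^sub>R \<psi> x" for x
  have \<phi>: "tangent_field \<Omega> \<phi>" unfolding \<phi>_def[abs_def] by (rule tangent_field_variation(1)[OF d U sm\<psi>])
  obtain \<delta> where \<delta>: "\<delta> > 0"
    "\<And>I X. smooth_curve \<Omega> I X \<Longrightarrow> smooth_surface \<Omega> (ball 0 \<delta>) I (\<lambda>s t x. X t x + s *\<^sub>R (d (X t x) *\<^sub>R \<psi> (X t x)))"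
    by (rule smooth_surface_variation[OF dom d U sm\<psi>]) (rule that, (assumption | simp)+)
  define C where "C s x = X x + s *\<^sub>R \<phi> (X x)" for s x
  have C: "smooth_curve \<Omega> (ball 0 \<delta>) C"
    using smooth_surfaceD(2)[OF \<delta>(2)[OF smooth_curve_const[OF X]], of 0] by (simp add: C_def[abs_def] \<phi>_def)
  have C0: "C 0 = X" by (simp add: C_def fun_eq_iff)
  have vel: "velocity C 0 x = \<phi> (X x)" for x
    unfolding C_def[abs_def] by (rule velocity_variation)
  have 0: "0 \<in> ball 0 \<delta>" using \<delta>(1) by simp
  have d1: "((\<lambda>r. c * potential_energy \<Omega> b \<rho>0 (C r)) has_real_derivative gn_metric \<Omega> b \<rho>0 X G (velocity C 0)) (at 0)"
    using G 0 C C0 unfolding has_gradient_def by metis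
  have ev: "eulerian \<Omega> X (velocity C 0) x = \<phi> x" if "x \<in> closure \<Omega>" for x
    by (rule eulerian_compose[OF dom X, of _ \<phi>]) (rule vel, rule that)
  have "gn_metric \<Omega> b \<rho>0 X G (velocity C 0) = c * (LINT x:\<Omega>|lborel. mass_density \<Omega> \<rho>0 X x *
      (grad (\<lambda>y. mass_density \<Omega> \<rho>0 X y - b y) x \<bullet> eulerian \<Omega> X (velocity C 0) x))"
    using DERIV_unique[OF d1 DERIV_cmult[OF potential_energy_derivative[OF dom b \<rho>0 C 0]]] by (simp only: C0)
  also have "\<dots> = c * (LINT x:\<Omega>|lborel. R x * (grad (\<lambda>y. mass_density \<Omega> \<rho>0 X y - b y) x \<bullet> \<phi> x))"
    by (intro arg_cong[where f = "\<lambda>z. c * z"] set_lebesgue_integral_cong) (use D(1,8) S(7) ev in auto)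
  finally have 1: "gn_metric \<Omega> b \<rho>0 X G (velocity C 0) = \<dots>" .
  have "gn_metric \<Omega> b \<rho>0 X G (velocity C 0) = gn_metric \<Omega> b \<rho>0 X (\<lambda>x. c *\<^sub>R \<eta> (X x)) (velocity C 0)"
    by (rule gn_metric_cong[OF dom X G\<eta> refl])
  also have "\<dots> = c * gn_metric \<Omega> b \<rho>0 X (velocity C 0) (\<lambda>x. \<eta> (X x))"
    by (simp only: gn_metric_scaleR[OF dom X \<eta> refl] gn_metric_commute[of _ _ _ _ "\<lambda>x. \<eta> (X x)"])
  also have "gn_metric \<Omega> b \<rho>0 X (velocity C 0) (\<lambda>x. \<eta> (X x)) =
      (LINT x:\<Omega>|lborel. mass_density \<Omega> \<rho>0 X x * (\<phi> x \<bullet> gn_operator b (mass_density \<Omega> \<rho>0 X) \<eta> x))"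
    by (rule gn_metric_eq_operator[OF dom b \<rho>0 X \<phi> vel]) (use \<eta> in \<open>simp_all add: tangent_field_def\<close>)
  finally have 2: "gn_metric \<Omega> b \<rho>0 X G (velocity C 0) =
      c * (LINT x:\<Omega>|lborel. mass_density \<Omega> \<rho>0 X x * (\<phi> x \<bullet> gn_operator b (mass_density \<Omega> \<rho>0 X) \<eta> x))" .
  have int: "set_integrable lborel \<Omega> g" if "smooth_on ?U g" for g :: "plane \<Rightarrow> real"
    by (rule set_integrable_continuous_closure[OF D(1,4) continuous_on_subset[OF smooth_on_continuous[OF that] U(2)]])
  have sm\<phi>: "smooth_on ?U \<phi>" unfolding \<phi>_def[abs_def] by (rule tangent_field_variation(2)[OF d U sm\<psi>])
  have gR: "grad (\<lambda>y. R y - \<beta> y) x = grad (\<lambda>y. mass_density \<Omega> \<rho>0 X y - b y) x" if "x \<in> \<Omega>" for x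
    by (rule grad_cong_open[OF D(1) that]) (use S(5,7) D(8) in auto)
  have "(LINT x:\<Omega>|lborel. R x * (E x \<bullet> \<phi> x)) =
      (LINT x:\<Omega>|lborel. R x * (gn_operator \<beta> R h x \<bullet> \<phi> x) - R x * (grad (\<lambda>y. R y - \<beta> y) x \<bullet> \<phi> x))"
    by (simp add: E_def inner_diff_left right_diff_distrib)
  also have "\<dots> = (LINT x:\<Omega>|lborel. R x * (gn_operator \<beta> R h x \<bullet> \<phi> x)) - (LINT x:\<Omega>|lborel. R x * (grad (\<lambda>y. R y - \<beta> y) x \<bullet> \<phi> x))"
    by (rule set_integral_diff(2); rule int; intro smooth_on_mult smooth_on_inner smooth_on_diff smooth_on_gn_operator smooth_on_grad U(1) sm nz sm\<phi>)
  also have "(LINT x:\<Omega>|lborel. R x * (gn_operator \<beta> R h x \<bullet> \<phi> x)) =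
      (LINT x:\<Omega>|lborel. mass_density \<Omega> \<rho>0 X x * (\<phi> x \<bullet> gn_operator b (mass_density \<Omega> \<rho>0 X) \<eta> x))"
  proof (rule set_lebesgue_integral_cong)
    show "\<forall>x. x \<in> \<Omega> \<longrightarrow> R x * (gn_operator \<beta> R h x \<bullet> \<phi> x) =
        mass_density \<Omega> \<rho>0 X x * (\<phi> x \<bullet> gn_operator b (mass_density \<Omega> \<rho>0 X) \<eta> x)"
    proof (intro allI impI)
      fix x assume x: "x \<in> \<Omega>"
      have "gn_operator \<beta> R h x = gn_operator b (mass_density \<Omega> \<rho>0 X) \<eta> x"
        by (rule gn_operator_cong_open[OF D(1) x]) (use S(5,7) h(4) D(8) in auto)
      then show "R x * (gn_operator \<beta> R h x \<bullet> \<phi> x) =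
          mass_density \<Omega> \<rho>0 X x * (\<phi> x \<bullet> gn_operator b (mass_density \<Omega> \<rho>0 X) \<eta> x)"
        using S(7)[OF x] by (simp add: inner_commute)
    qed
  qed (use D(1) in simp)
  also have "(LINT x:\<Omega>|lborel. R x * (grad (\<lambda>y. R y - \<beta> y) x \<bullet> \<phi> x)) =
      (LINT x:\<Omega>|lborel. R x * (grad (\<lambda>y. mass_density \<Omega> \<rho>0 X y - b y) x \<bullet> \<phi> x))"
    by (rule set_lebesgue_integral_cong) (use D(1) gR in auto)
  finally have "(LINT x:\<Omega>|lborel. R x * (E x \<bullet> \<phi> x)) = 0"
    using 1 2 c by simp
  then have int0: "(LINT x:\<Omega>|lborel. R x * (E x \<bullet> (d x *\<^sub>R (R x *\<^sub>R E x)))) = 0"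
    unfolding \<phi>_def \<psi>_def .
  have "E x = 0" if "x \<in> \<Omega>" for x
    by (rule integral_test_field_imp_zero[OF dom d U sm(2) nz smE int0 that])
  then show ?thesis using \<eta> G\<eta> E\<Omega> by (intro exI[of _ \<eta>]) auto
qed

section \<open>Newton's equation\<close>

text \<open>By \<open>tr\<close> the velocity is affine in \<open>s\<close> along the moving point
  \<open>x + s *\<^sub>R p\<close>. Its derivative there is the derivative at the fixed point
  \<open>x\<close> plus the transport term with direction \<open>p\<close>.\<close>

lemma eulerian_variation_derivative:
  assumes e: "e > 0" and U: "open U" "closure \<Omega> \<subseteq> U"
    and u: "smooth_on (ball 0 e \<times> U) (\<lambda>p. u (fst p) (snd p))" and x: "x \<in> \<Omega>"
    and tr: "\<And>s. s \<in> ball 0 e \<Longrightarrow> u s (x + s *\<^sub>R p) = v + s *\<^sub>R c"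
  shows "vector_derivative (\<lambda>s. u s x) (at 0) = c - frechet_derivative (u 0) (at x) p"
proof -
  let ?u = "\<lambda>p. u (fst p) (snd p)"
  have "x \<in> U" using x U(2) closure_subset by blast
  then have px: "(0, x) \<in> ball 0 e \<times> U" using e by auto
  have ud: "(?u has_derivative frechet_derivative ?u (at (0, x))) (at (0, x + 0 *\<^sub>R p))"
    using smooth_on_has_derivative[OF u px] by simp
  have "((\<lambda>s. (s, x + s *\<^sub>R p)) has_derivative (\<lambda>h. (h, h *\<^sub>R p))) (at 0)"
    by (auto intro!: derivative_eq_intros)
  from has_derivative_imp_has_vector_derivative[OF has_derivative_compose[OF this ud]]
  have 1: "((\<lambda>s. u s (x + s *\<^sub>R p)) has_vector_derivative frechet_derivative ?u (at (0, x)) (1, p)) (at 0)"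
    by simp
  have "((\<lambda>s. v + s *\<^sub>R c) has_vector_derivative c) (at 0)"
    by (auto intro!: derivative_eq_intros)
  then have 2: "((\<lambda>s. u s (x + s *\<^sub>R p)) has_vector_derivative c) (at 0)"
    by (rule has_vector_derivative_transform_within_open[OF _ open_ball[of 0 e]]) (use e tr in auto)
  have "frechet_derivative ?u (at (0, x)) (1, p) = frechet_derivative ?u (at (0, x)) (1, 0) + frechet_derivative ?u (at (0, x)) (0, p)"
    using linear_add[OF has_derivative_linear[OF smooth_on_has_derivative[OF u px]], of "(1, 0)" "(0, p)"] by simp
  then have "c = vector_derivative (\<lambda>s. u s x) (at 0) + frechet_derivative (u 0) (at x) p"
    using vector_derivative_at[OF 1] vector_derivative_at[OF 2]
    unfolding smooth_on_vector_derivative_slice[OF u px, symmetric] smooth_on_frechet_slice[OF u px, symmetric] by simp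
  then show ?thesis by simp
qed

lemma velocity_variation_curve:
  assumes U: "open U" "closure \<Omega> \<subseteq> U" and X: "smooth_curve \<Omega> I X" and t: "t \<in> I" and x: "x \<in> closure \<Omega>"
    and dom: "smooth_bounded_domain \<Omega>" and \<phi>: "smooth_on U \<phi>"
  shows "velocity (\<lambda>t x. X t x + s *\<^sub>R \<phi> (X t x)) t x =
    velocity X t x + s *\<^sub>R frechet_derivative \<phi> (at (X t x)) (velocity X t x)"
proof -
  have "X t x \<in> U" using inverse_map_Diff(7)[OF dom smooth_curveD(2)[OF X t] x] U(2) by blast
  then have \<phi>d: "(\<phi> has_derivative frechet_derivative \<phi> (at (X t x))) (at (X t x))"
    by (rule smooth_on_has_derivative[OF \<phi>])
  have X': "((\<lambda>t. X t x) has_vector_derivative velocity X t x) (at t)"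
    by (rule velocity_has_vector_derivative[OF X X t x])
  then have "((\<lambda>t. X t x) has_derivative (\<lambda>h. h *\<^sub>R velocity X t x)) (at t)"
    by (simp add: has_vector_derivative_def)
  from has_derivative_imp_has_vector_derivative[OF has_derivative_compose[OF this \<phi>d]]
  have "((\<lambda>t. \<phi> (X t x)) has_vector_derivative frechet_derivative \<phi> (at (X t x)) (velocity X t x)) (at t)" by simp
  then have "((\<lambda>t. X t x + s *\<^sub>R \<phi> (X t x)) has_vector_derivative
      velocity X t x + s *\<^sub>R frechet_derivative \<phi> (at (X t x)) (velocity X t x)) (at t)"
    using bounded_linear.has_vector_derivative[OF bounded_linear_scaleR_right, of _ _ _ s]
    by (intro has_vector_derivative_add X') blast
  then show ?thesis
    unfolding velocity_def[of "\<lambda>t x. X t x + s *\<^sub>R \<phi> (X t x)"] by (rule vector_derivative_at)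
qed

text \<open>Koszul's formula for the variation \<open>(id + s \<phi>) \<circ> X\<close>: vanishing torsion exchanges the two
  covariant derivatives, so that metric compatibility only leaves derivatives of the metric.\<close>

lemma levi_civita_variation:
  assumes dom: "smooth_bounded_domain \<Omega>" and LC: "levi_civita \<Omega> (gn_metric \<Omega> b \<rho>0) D"
    and X: "smooth_curve \<Omega> I X" and t: "t \<in> I"
    and Z: "smooth_surface \<Omega> (ball 0 \<delta>) I (\<lambda>s t x. X t x + s *\<^sub>R \<phi> (X t x))" and \<delta>: "\<delta> > 0"
    and \<phi>: "tangent_field \<Omega> \<phi>"
    and K: "((\<lambda>s. gn_metric \<Omega> b \<rho>0 (\<lambda>x. X t x + s *\<^sub>R \<phi> (X t x))
      (velocity (\<lambda>t x. X t x + s *\<^sub>R \<phi> (X t x)) t) (velocity (\<lambda>t x. X t x + s *\<^sub>R \<phi> (X t x)) t))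
      has_real_derivative 2 * A) (at 0)"
  shows "((\<lambda>t. gn_metric \<Omega> b \<rho>0 (X t) (velocity X t) (\<lambda>x. \<phi> (X t x))) has_real_derivative
    gn_metric \<Omega> b \<rho>0 (X t) (D I X (velocity X) t) (\<lambda>x. \<phi> (X t x)) + A) (at t)"
proof -
  let ?g = "gn_metric \<Omega> b \<rho>0" and ?J = "ball (0 :: real) \<delta>"
  define Y where "Y s t x = X t x + s *\<^sub>R \<phi> (X t x)" for s t x
  have Y: "smooth_surface \<Omega> ?J I Y" using Z unfolding Y_def[abs_def] .
  have 0: "0 \<in> ?J" using \<delta> by simp
  have Y0: "Y 0 = X" by (simp add: Y_def fun_eq_iff)
  have W: "(\<lambda>t'. velocity (\<lambda>s'. Y s' t') 0) = (\<lambda>t x. \<phi> (X t x))"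
    unfolding Y_def[abs_def] by (intro ext velocity_variation)
  have tf: "torsion_free \<Omega> D" and mc: "metric_compatible \<Omega> ?g D"
    using LC by (auto simp: levi_civita_def)
  have C: "smooth_curve \<Omega> ?J (\<lambda>s. Y s t)" by (rule smooth_surfaceD(2)[OF Y t])
  have XD: "X t \<in> Diff \<Omega>" by (rule smooth_curveD(2)[OF X t])
  have tor: "D I X (\<lambda>t x. \<phi> (X t x)) t x = D ?J (\<lambda>s. Y s t) (\<lambda>s. velocity (Y s) t) 0 x" if "x \<in> closure \<Omega>" for x
    using tf[unfolded torsion_free_def, rule_format, OF Y 0 t that] unfolding W Y0 .
  have V: "field_along \<Omega> I X (velocity X)" by (rule field_along_velocity[OF dom X])
  have fW: "field_along \<Omega> I X (\<lambda>t x. \<phi> (X t x))"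
    unfolding field_along_def
  proof (intro conjI ballI)
    have "smooth_upto (I \<times> closure \<Omega>) (\<lambda>p. \<phi> ((\<lambda>(t, x). X t x) p))"
      by (rule smooth_upto_compose[OF _ smooth_curveD(3)[OF X], of "closure \<Omega>"])
        (use \<phi> inverse_map_Diff(7)[OF dom smooth_curveD(2)[OF X]] in \<open>auto simp: tangent_field_def\<close>)
    then show "smooth_upto (I \<times> closure \<Omega>) (\<lambda>(t, x). \<phi> (X t x))" by (simp add: case_prod_unfold)
    show "(\<lambda>x. \<phi> (X s x)) \<in> tangent_space \<Omega> (X s)" if "s \<in> I" for s
      unfolding tangent_space_def using \<phi> by blast
  qed
  \<comment> \<open>Metric compatibility is also applied along the curve in \<open>s\<close>, to the
    velocity in time. For this the velocity must be smooth in \<open>s\<close> up to the boundary,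
    which is read off from a joint extension \<open>q\<close> of the surface.\<close>
  have fV: "field_along \<Omega> ?J (\<lambda>s. Y s t) (\<lambda>s. velocity (Y s) t)"
    unfolding field_along_def
  proof (intro conjI ballI)
    show "velocity (Y s) t \<in> tangent_space \<Omega> (Y s t)" if "s \<in> ?J" for s
      using field_along_velocity[OF dom smooth_surfaceD(1)[OF Y that]] t by (simp add: field_along_def)
    have I: "open I" by (rule smooth_curveD(1)[OF X])
    obtain Q q where q: "open Q" "?J \<times> I \<times> closure \<Omega> \<subseteq> Q" "smooth_on Q q"
      "\<And>p. p \<in> ?J \<times> I \<times> closure \<Omega> \<Longrightarrow> q p = (\<lambda>(s, t, x). Y s t x) p"
      using Y unfolding smooth_surface_def smooth_upto_def by blast
    have "smooth_upto (?J \<times> I \<times> closure \<Omega>) (\<lambda>p. frechet_derivative q (at p) (0, 1, 0))"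
      by (rule smooth_upto_on[OF q(1,2) smooth_on_frechet_derivative[OF q(3)]])
    moreover have "smooth_upto (?J \<times> closure \<Omega>) (\<lambda>p. (fst p, t, snd p))"
      by (intro smooth_upto_Pair smooth_upto_const smooth_upto_fst smooth_upto_snd)
    moreover have "(\<lambda>p. (fst p, t, snd p)) ` (?J \<times> closure \<Omega>) \<subseteq> ?J \<times> I \<times> closure \<Omega>" using t by auto
    ultimately have smq: "smooth_upto (?J \<times> closure \<Omega>) (\<lambda>p. frechet_derivative q (at (fst p, t, snd p)) (0, 1, 0))"
      by (rule smooth_upto_compose)
    have velq: "frechet_derivative q (at (s, t, x)) (0, 1, 0) = velocity (Y s) t x"
      if s: "s \<in> ?J" and x: "x \<in> closure \<Omega>" for s x
    proof -
      have "((\<lambda>r. (s, r, x)) has_derivative (\<lambda>h. (0, h, 0))) (at t)"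
        by (auto intro!: derivative_eq_intros)
      moreover have "(q has_derivative frechet_derivative q (at (s, t, x))) (at (s, t, x))"
        by (rule smooth_on_has_derivative[OF q(3)]) (use q(2) s t x in blast)
      ultimately have "((\<lambda>r. q (s, r, x)) has_derivative (\<lambda>h. frechet_derivative q (at (s, t, x)) (0, h, 0))) (at t)"
        by (rule has_derivative_compose)
      from has_derivative_imp_has_vector_derivative[OF this]
      have "((\<lambda>r. Y s r x) has_vector_derivative frechet_derivative q (at (s, t, x)) (0, 1, 0)) (at t)"
        by (rule has_vector_derivative_transform_within_open[OF _ I t]) (use q(4) s x in auto)
      then show ?thesis unfolding velocity_def by (rule vector_derivative_at[symmetric])
    qed
    show "smooth_upto (?J \<times> closure \<Omega>) (\<lambda>(s, x). velocity (Y s) t x)"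
      by (rule smooth_upto_cong[OF smq]) (use velq in auto)
  qed
  have "((\<lambda>s. ?g (Y s t) (velocity (Y s) t) (velocity (Y s) t)) has_real_derivative
      ?g (X t) (D ?J (\<lambda>s. Y s t) (\<lambda>s. velocity (Y s) t) 0) (velocity X t) +
      ?g (X t) (velocity X t) (D ?J (\<lambda>s. Y s t) (\<lambda>s. velocity (Y s) t) 0)) (at 0)"
    using mc[unfolded metric_compatible_def, rule_format, OF conjI[OF C conjI[OF fV fV]] 0] unfolding Y0 .
  then have "2 * A = ?g (X t) (D ?J (\<lambda>s. Y s t) (\<lambda>s. velocity (Y s) t) 0) (velocity X t) +
      ?g (X t) (velocity X t) (D ?J (\<lambda>s. Y s t) (\<lambda>s. velocity (Y s) t) 0)"
    using DERIV_unique[OF K] by (simp add: Y_def[abs_def])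
  \<comment> \<open>By symmetry of the metric the two summands are equal, which absorbs the factor 2
    in \<open>K\<close>.\<close>
  then have A: "A = ?g (X t) (velocity X t) (D ?J (\<lambda>s. Y s t) (\<lambda>s. velocity (Y s) t) 0)"
    by (simp add: gn_metric_commute[of _ _ _ _ "D ?J (\<lambda>s. Y s t) (\<lambda>s. velocity (Y s) t) 0"])
  also have "\<dots> = ?g (X t) (velocity X t) (D I X (\<lambda>t x. \<phi> (X t x)) t)"
    by (rule gn_metric_cong[OF dom XD refl tor[symmetric]])
  finally show ?thesis
    using mc[unfolded metric_compatible_def, rule_format, OF conjI[OF X conjI[OF V fW]] t] by simp
qed

section \<open>The momentum equation, tested and then pointwise\<close>

lemma newton_imp_momentum_equation:
  assumes dom: "smooth_bounded_domain \<Omega>" and b: "smooth_upto (closure \<Omega>) b"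
    and \<rho>0: "smooth_upto (closure \<Omega>) \<rho>0" "\<forall>x\<in>closure \<Omega>. \<rho>0 x > 0"
    and LC: "levi_civita \<Omega> (gn_metric \<Omega> b \<rho>0) D"
    and X: "smooth_curve \<Omega> I X" and t: "t \<in> I"
    and newton: "newton_equation \<Omega> (gn_metric \<Omega> b \<rho>0) D (\<lambda>Y. c * potential_energy \<Omega> b \<rho>0 Y) I X"
    and e: "e > 0" and sub: "ball t e \<subseteq> I" and U: "open U" "closure \<Omega> \<subseteq> U" and \<beta>: "smooth_on U \<beta>"
    and R: "smooth_on (ball t e \<times> U) (\<lambda>p. R (fst p) (snd p))"
    and w: "smooth_on (ball t e \<times> U) (\<lambda>p. w (fst p) (snd p))"
    and \<beta>b: "\<And>x. x \<in> closure \<Omega> \<Longrightarrow> \<beta> x = b x"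
    and nz: "\<And>s x. s \<in> ball t e \<Longrightarrow> x \<in> U \<Longrightarrow> R s x \<noteq> 0"
    and RX: "\<And>s x. s \<in> ball t e \<Longrightarrow> x \<in> \<Omega> \<Longrightarrow> R s x = mass_density \<Omega> \<rho>0 (X s) x"
    and wX: "\<And>s x. s \<in> ball t e \<Longrightarrow> x \<in> closure \<Omega> \<Longrightarrow> w s x = eulerian \<Omega> (X s) (velocity X s) x"
    and x: "x \<in> \<Omega>"
  defines "v \<equiv> \<lambda>s. gn_operator \<beta> (R s) (w s)"
  shows "vector_derivative (\<lambda>s. v s x) (at t) + jacobian (v t) (at x) *v w t x +
    transpose (jacobian (w t) (at x)) *v v t x +
    grad (\<lambda>y. c * (R t y - \<beta> y) - gn_bernoulli \<beta> (R t) (w t) y) x = 0"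
proof -
  note D = smooth_bounded_domainD[OF dom]
  obtain d where d: "defining_function \<Omega> d" using dom by (auto simp: smooth_bounded_domain_def)
  have sdU: "smooth_on U d" using d by (intro smooth_on_subset[of UNIV d U]) (simp_all add: defining_function_def)
  have tb: "t \<in> ball t e" using e by simp
  have subU: "\<Omega> \<subseteq> U" using D(8) U(2) by blast
  have XD: "X t \<in> Diff \<Omega>" by (rule smooth_curveD(2)[OF X t])
  have v: "smooth_on (ball t e \<times> U) (\<lambda>p. v (fst p) (snd p))"
    unfolding v_def by (rule smooth_on_gn_operator_param[OF open_ball U(1) \<beta> R w nz])
  have R0: "smooth_on U (R t)" and w0: "smooth_on U (w t)" and v0: "smooth_on U (v t)"
    using smooth_on_slice[OF R tb U(1)] smooth_on_slice[OF w tb U(1)] smooth_on_slice[OF v tb U(1)] by auto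
  let ?H = "gn_bernoulli \<beta> (R t) (w t)"
  have smH: "smooth_on U ?H" by (rule smooth_on_gn_bernoulli[OF U(1) \<beta> R0 w0])
  define v' where "v' x = vector_derivative (\<lambda>s. v s x) (at t)" for x
  have smv': "smooth_on U v'"
    unfolding v'_def[abs_def]
    by (rule smooth_on_slice[where f = "\<lambda>t x. vector_derivative (\<lambda>s. v s x) (at t)", OF smooth_on_time_derivative[OF open_ball U(1) v] tb U(1)])
  define E where "E x = v' x + jacobian (v t) (at x) *v w t x + transpose (jacobian (w t) (at x)) *v v t x +
    grad (\<lambda>y. c * (R t y - \<beta> y) - ?H y) x" for x
  have smE: "smooth_on U E"
  proof -
    have nth: "smooth_on U (\<lambda>x. jacobian F (at x) $ i $ j)" if "smooth_on U F" for F :: "plane \<Rightarrow> plane" and i j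
      unfolding jacobian_nth by (intro smooth_on_vec_nth U(1) smooth_on_frechet_derivative that)
    show ?thesis
      unfolding E_def matrix_vector_mult_def transpose_def
      by (simp, intro smooth_intros smooth_on_grad U(1) smv' nth v0 w0 R0 \<beta> smH)
  qed
  \<comment> \<open>Tested against \<open>h\<close>, the transposed Jacobian becomes a derivative of
    \<open>w t\<close> in direction \<open>h\<close>. In this form the term will emerge from the
    energy variation.\<close>
  have E_inner: "E x \<bullet> h = (v' x + frechet_derivative (v t) (at x) (w t x)) \<bullet> h
      + v t x \<bullet> frechet_derivative (w t) (at x) h + c * (grad (\<lambda>y. R t y - \<beta> y) x \<bullet> h) - grad ?H x \<bullet> h"
    if x: "x \<in> U" for x h
  proof -
    have dRb: "(\<lambda>y. R t y - \<beta> y) differentiable (at x)" "(\<lambda>y. c * (R t y - \<beta> y)) differentiable (at x)" "?H differentiable (at x)"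
      by (rule smooth_on_differentiable[OF _ x], intro smooth_intros U(1) R0 \<beta> smH)+
    have g: "grad (\<lambda>y. c * (R t y - \<beta> y) - ?H y) x = c *\<^sub>R grad (\<lambda>y. R t y - \<beta> y) x - grad ?H x"
      by (simp only: grad_diff[OF dRb(2,3)] grad_cmult[OF dRb(1)])
    show ?thesis
      unfolding E_def g jacobian_mult[OF smooth_on_differentiable[OF v0 x]] inner_add_left inner_diff_left
        inner_transpose_jacobian[OF smooth_on_differentiable[OF w0 x]] inner_scaleR_left by simp
  qed
  \<comment> \<open>Frozen at time \<open>t\<close>: \<open>\<psi>\<close> and \<open>\<phi>\<close>
    are fixed fields on the domain, so no time derivative of \<open>E\<close> arises.\<close>
  define \<psi> where "\<psi> x = R t x *\<^sub>R E x" for x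
  have sm\<psi>: "smooth_on U \<psi>" unfolding \<psi>_def by (intro smooth_on_scaleR U(1) R0 smE)
  define \<phi> where "\<phi> x = d x *\<^sub>R \<psi> x" for x
  have \<phi>: "tangent_field \<Omega> \<phi>" and sm\<phi>: "smooth_on U \<phi>"
    unfolding \<phi>_def[abs_def] by (rule tangent_field_variation[OF d U sm\<psi>])+
  have d0: "d x = 0" if "x \<in> frontier \<Omega>" for x using that frontier_defining_function(1)[OF d] by auto
  have \<phi>0: "\<phi> x = 0" if "x \<in> frontier \<Omega>" for x using d0[OF that] by (simp add: \<phi>_def)
  have w_tang: "w t x \<bullet> grad d x = 0" if "x \<in> frontier \<Omega>" for x
    using tangent_field_velocity[OF dom X t] d that wX[OF tb] D(9) by (auto simp: tangent_field_def)
  \<comment> \<open>Product rule on the frontier: one term carries the factor \<open>d\<close>, the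
    other the inner product of the velocity with \<open>grad d\<close>; both vanish.\<close>
  have D\<phi>w: "frechet_derivative \<phi> (at x) (w t x) = 0" if x: "x \<in> frontier \<Omega>" for x
  proof -
    have xU: "x \<in> U" using x D(9) U(2) by blast
    have "(\<phi> has_derivative (\<lambda>h. d x *\<^sub>R frechet_derivative \<psi> (at x) h + (grad d x \<bullet> h) *\<^sub>R \<psi> x)) (at x)"
      unfolding \<phi>_def[abs_def]
      by (intro has_derivative_scaleR has_derivative_grad smooth_on_has_derivative[OF sm\<psi> xU] smooth_on_differentiable[OF sdU xU])
    from fun_cong[OF frechet_derivative_at[OF this], of "w t x"] show ?thesis
      using d0[OF x] w_tang[OF x] by (simp add: inner_commute)
  qed
  obtain \<delta> where \<delta>: "\<delta> > 0"
    "\<And>I X. smooth_curve \<Omega> I X \<Longrightarrow> smooth_surface \<Omega> (ball 0 \<delta>) I (\<lambda>s t x. X t x + s *\<^sub>R (d (X t x) *\<^sub>R \<psi> (X t x)))"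
    by (rule smooth_surface_variation[OF dom d U sm\<psi>]) (rule that, (assumption | simp)+)
  have Z: "smooth_surface \<Omega> (ball 0 \<delta>) I (\<lambda>s t x. X t x + s *\<^sub>R \<phi> (X t x))"
    using \<delta>(2)[OF X] by (simp add: \<phi>_def)
  define C where "C s x = X t x + s *\<^sub>R \<phi> (X t x)" for s x
  have C: "smooth_curve \<Omega> (ball 0 \<delta>) C"
    using smooth_surfaceD(2)[OF Z t] by (simp add: C_def[abs_def])
  have C0: "C 0 = X t" by (simp add: C_def fun_eq_iff)
  have 0: "0 \<in> ball 0 \<delta>" using \<delta>(1) by simp
  have velC: "velocity C s x = \<phi> (X t x)" for s x
    unfolding C_def[abs_def] by (rule velocity_variation)
  define V where "V s = velocity (\<lambda>t x. X t x + s *\<^sub>R \<phi> (X t x)) t" for s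
  define q where "q x = frechet_derivative \<phi> (at x) (w t x)" for x
  have smq: "smooth_on U q" unfolding q_def[abs_def] by (rule smooth_on_frechet_apply[OF U(1) sm\<phi> w0])
  have wXt: "w t (X t x) = velocity X t x" if "x \<in> closure \<Omega>" for x
    using wX[OF tb inverse_map_Diff(7)[OF dom XD that]] inverse_map_Diff(1)[OF dom XD that] by (simp add: eulerian_def)
  have V_eq: "V s x = w t (X t x) + s *\<^sub>R q (X t x)" if x: "x \<in> closure \<Omega>" for s x
    unfolding V_def velocity_variation_curve[OF U X t x dom sm\<phi>] q_def wXt[OF x] ..
  have Xsm: "smooth_upto (closure \<Omega>) (X t)" and Xim: "X t ` closure \<Omega> \<subseteq> closure \<Omega>"
    using XD inverse_map_Diff(7)[OF dom XD] by (auto simp: Diff_def)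
  have smV: "smooth_upto (ball 0 \<delta> \<times> closure \<Omega>) (\<lambda>(s, x). V s x)"
  proof (rule smooth_upto_cong)
    have comp: "smooth_upto (ball 0 \<delta> \<times> closure \<Omega>) (\<lambda>p. f (X t (snd p)))" if "smooth_on U f" for f :: "plane \<Rightarrow> plane"
    proof (rule smooth_upto_compose[OF smooth_upto_on[OF U that]])
      show "smooth_upto (ball 0 \<delta> \<times> closure \<Omega>) (\<lambda>p. X t (snd p))"
        by (rule smooth_upto_compose[OF Xsm smooth_upto_snd]) auto
      show "(\<lambda>p. X t (snd p)) ` (ball 0 \<delta> \<times> closure \<Omega>) \<subseteq> closure \<Omega>" using Xim by auto
    qed
    show "smooth_upto (ball 0 \<delta> \<times> closure \<Omega>) (\<lambda>p. w t (X t (snd p)) + fst p *\<^sub>R q (X t (snd p)))"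
      by (intro smooth_upto_add smooth_upto_scaleR smooth_upto_fst comp w0 smq)
  qed (auto simp: V_eq)
  \<comment> \<open>A second family of extensions, in the variation parameter at the fixed time
    \<open>t\<close>. At parameter 0 its density is only known to agree with the first on
    \<open>\<Omega>\<close>, so the two families are compared through derivatives on that open
    set.\<close>
  obtain e' U' \<beta>' R' w' where F: "e' > 0" "ball (0 :: real) e' \<subseteq> ball 0 \<delta>" "open U'" "closure \<Omega> \<subseteq> U'" "smooth_on U' \<beta>'"
    "smooth_on (ball 0 e' \<times> U') (\<lambda>p. R' (fst p) (snd p))"
    "smooth_on (ball 0 e' \<times> U') (\<lambda>p. w' (fst p) (snd p))"
    "\<And>x. x \<in> closure \<Omega> \<Longrightarrow> \<beta>' x = b x"
    "\<And>s x. s \<in> ball 0 e' \<Longrightarrow> x \<in> U' \<Longrightarrow> R' s x \<noteq> 0"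
    "\<And>s x. s \<in> ball 0 e' \<Longrightarrow> x \<in> \<Omega> \<Longrightarrow> R' s x = mass_density \<Omega> \<rho>0 (C s) x"
    "\<And>s x. s \<in> ball 0 e' \<Longrightarrow> x \<in> closure \<Omega> \<Longrightarrow> w' s x = eulerian \<Omega> (C s) (V s) x"
    by (rule smooth_curve_fields[OF dom \<rho>0 b C 0 smV]) (rule that, (assumption | simp)+)
  have z0: "0 \<in> ball 0 e'" using F(1) by simp
  let ?U = "U \<inter> U'"
  have U2: "open ?U" "closure \<Omega> \<subseteq> ?U" using U F(3,4) by auto
  have prod_sub: "ball 0 e' \<times> ?U \<subseteq> ball 0 e' \<times> U'" by auto
  have sm2: "smooth_on ?U \<beta>'" "smooth_on ?U \<phi>" "smooth_on (ball 0 e' \<times> ?U) (\<lambda>p. R' (fst p) (snd p))"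
    "smooth_on (ball 0 e' \<times> ?U) (\<lambda>p. w' (fst p) (snd p))"
    using smooth_on_subset[OF F(5), of ?U] smooth_on_subset[OF sm\<phi>, of ?U] smooth_on_subset[OF F(6) prod_sub]
      smooth_on_subset[OF F(7) prod_sub] by auto
  have CD: "C s \<in> Diff \<Omega>" if "s \<in> ball 0 e'" for s
    using smooth_curveD(2)[OF C] F(2) that by blast
  have w'C: "w' s (C s y) = w t (X t y) + s *\<^sub>R q (X t y)" if s: "s \<in> ball 0 e'" and y: "y \<in> closure \<Omega>" for s y
    using F(11)[OF s inverse_map_Diff(7)[OF dom CD[OF s] y]] inverse_map_Diff(1)[OF dom CD[OF s] y] V_eq[OF y]
    by (simp add: eulerian_def)
  have w'0: "w' 0 x = w t x" if x: "x \<in> closure \<Omega>" for x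
    using w'C[OF z0 inverse_map_Diff(3)[OF dom XD x]] inverse_map_Diff(2)[OF dom XD x] by (simp add: C0)
  have R'0: "R' 0 x = R t x" if x: "x \<in> \<Omega>" for x
    using F(10)[OF z0 x] RX[OF tb x] by (simp add: C0)
  have \<beta>': "\<beta>' x = \<beta> x" if "x \<in> closure \<Omega>" for x using F(8) \<beta>b that by simp
  let ?A = "LINT x:\<Omega>|lborel. R t x * (grad ?H x \<bullet> \<phi> x + v t x \<bullet> (q x - frechet_derivative (w t) (at x) (\<phi> x)))"
  have kin: "((\<lambda>s. LINT x:\<Omega>|lborel. gn_density \<beta>' (R' s) (w' s) (w' s) x) has_real_derivative
    2 * (LINT x:\<Omega>|lborel. R' 0 x * (grad (gn_bernoulli \<beta>' (R' 0) (w' 0)) x \<bullet> \<phi> x +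
      gn_operator \<beta>' (R' 0) (w' 0) x \<bullet> (frechet_derivative \<phi> (at x) (w' 0 x) - frechet_derivative (w' 0) (at x) (\<phi> x))))) (at 0)"
  proof (rule kinetic_term_variation[OF d D(4) F(1) U2 sm2(1,2) \<phi>0 sm2(3,4)])
    show "R' 0 x \<noteq> 0" if "x \<in> ?U" for x using F(9)[OF z0] that by blast
    show "frechet_derivative \<phi> (at x) (w' 0 x) = 0" if "x \<in> frontier \<Omega>" for x
      using D\<phi>w[OF that] w'0 D(9) that by auto
    show "vector_derivative (\<lambda>s. R' s x) (at 0) = - divg (\<lambda>y. R' 0 y *\<^sub>R \<phi> y) x" if x: "x \<in> \<Omega>" for x
    proof -
      have "vector_derivative (\<lambda>s. R' s x) (at 0) + divg (\<lambda>y. R' 0 y *\<^sub>R \<phi> y) x = 0"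
      proof (rule continuity_equation[OF dom C \<rho>0(2) F(1) U2 F(2) sm2(3) F(10) sm2(2) _ x])
        fix x assume "x \<in> \<Omega>"
        then have "x \<in> closure \<Omega>" using D(8) by blast
        then show "\<phi> x = eulerian \<Omega> (C 0) (velocity C 0) x"
          using inverse_map_Diff(2)[OF dom XD] by (simp add: eulerian_def velC C0)
      qed
      then show ?thesis by (simp add: add_eq_0_iff)
    qed
    show "vector_derivative (\<lambda>s. w' s x) (at 0) =
      frechet_derivative \<phi> (at x) (w' 0 x) - frechet_derivative (w' 0) (at x) (\<phi> x)" if x: "x \<in> \<Omega>" for x
    proof -
      have xK: "x \<in> closure \<Omega>" using x D(8) by blast
      let ?y = "inverse_map \<Omega> (X t) x"
      have y: "?y \<in> closure \<Omega>" "X t ?y = x" using inverse_map_Diff(2,3)[OF dom XD xK] by auto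
      have "w' s (x + s *\<^sub>R \<phi> x) = w t x + s *\<^sub>R q x" if "s \<in> ball 0 e'" for s
        using w'C[OF that y(1)] by (simp add: C_def y(2))
      from eulerian_variation_derivative[OF F(1) U2 sm2(4) x this]
      show ?thesis by (simp add: q_def w'0[OF xK])
    qed
  qed
  have "(LINT x:\<Omega>|lborel. R' 0 x * (grad (gn_bernoulli \<beta>' (R' 0) (w' 0)) x \<bullet> \<phi> x +
      gn_operator \<beta>' (R' 0) (w' 0) x \<bullet> (frechet_derivative \<phi> (at x) (w' 0 x) - frechet_derivative (w' 0) (at x) (\<phi> x)))) = ?A"
  proof (rule set_lebesgue_integral_cong)
    show "\<forall>x. x \<in> \<Omega> \<longrightarrow> R' 0 x * (grad (gn_bernoulli \<beta>' (R' 0) (w' 0)) x \<bullet> \<phi> x +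
      gn_operator \<beta>' (R' 0) (w' 0) x \<bullet> (frechet_derivative \<phi> (at x) (w' 0 x) - frechet_derivative (w' 0) (at x) (\<phi> x))) =
      R t x * (grad ?H x \<bullet> \<phi> x + v t x \<bullet> (q x - frechet_derivative (w t) (at x) (\<phi> x)))"
    proof (intro allI impI)
      fix x assume x: "x \<in> \<Omega>"
      have eqs: "\<beta>' y = \<beta> y" "R' 0 y = R t y" "w' 0 y = w t y" if "y \<in> \<Omega>" for y
        using \<beta>' R'0 w'0 D(8) that by auto
      have "gn_bernoulli \<beta>' (R' 0) (w' 0) y = ?H y" if y: "y \<in> \<Omega>" for y
        using grad_cong_open[OF D(1) y eqs(1)] divg_cong_open[OF D(1) y eqs(3)] eqs[OF y] by (simp add: gn_bernoulli_def)
      then have "grad (gn_bernoulli \<beta>' (R' 0) (w' 0)) x = grad ?H x"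
        by (rule grad_cong_open[OF D(1) x])
      moreover have "gn_operator \<beta>' (R' 0) (w' 0) x = v t x"
        unfolding v_def by (rule gn_operator_cong_open[OF D(1) x eqs])
      moreover have "frechet_derivative (w' 0) (at x) = frechet_derivative (w t) (at x)"
        by (rule frechet_derivative_cong_open[OF D(1) x eqs(3)])
      ultimately show "R' 0 x * (grad (gn_bernoulli \<beta>' (R' 0) (w' 0)) x \<bullet> \<phi> x +
          gn_operator \<beta>' (R' 0) (w' 0) x \<bullet> (frechet_derivative \<phi> (at x) (w' 0 x) - frechet_derivative (w' 0) (at x) (\<phi> x))) =
          R t x * (grad ?H x \<bullet> \<phi> x + v t x \<bullet> (q x - frechet_derivative (w t) (at x) (\<phi> x)))"
        by (simp add: eqs[OF x] q_def)
    qed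
  qed (use D(1) in simp)
  note kin' = kin[unfolded this]
  have K: "((\<lambda>s. gn_metric \<Omega> b \<rho>0 (C s) (V s) (V s)) has_real_derivative 2 * ?A) (at 0)"
  proof (rule has_field_derivative_transform_within_open[OF kin' open_ball z0])
    fix s :: real assume s: "s \<in> ball 0 e'"
    have "gn_density \<beta>' (R' s) (w' s) (w' s) x =
        gn_density b (mass_density \<Omega> \<rho>0 (C s)) (eulerian \<Omega> (C s) (V s)) (eulerian \<Omega> (C s) (V s)) x" if "x \<in> \<Omega>" for x
      by (rule gn_density_cong_open[OF D(1) that]) (use F(8) F(10,11)[OF s] D(8) in auto)
    then show "(LINT x:\<Omega>|lborel. gn_density \<beta>' (R' s) (w' s) (w' s) x) = gn_metric \<Omega> b \<rho>0 (C s) (V s) (V s)"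
      unfolding gn_metric_eq by (intro set_lebesgue_integral_cong) (use D(1) in auto)
  qed
  have LCd: "((\<lambda>t. gn_metric \<Omega> b \<rho>0 (X t) (velocity X t) (\<lambda>x. \<phi> (X t x))) has_real_derivative
    gn_metric \<Omega> b \<rho>0 (X t) (D I X (velocity X) t) (\<lambda>x. \<phi> (X t x)) + ?A) (at t)"
    by (rule levi_civita_variation[OF dom LC X t Z \<delta>(1) \<phi>]) (rule K[unfolded C_def[abs_def] V_def])
  let ?B = "LINT x:\<Omega>|lborel. R t x * ((v' x + frechet_derivative (v t) (at x) (w t x)) \<bullet> \<phi> x
      + v t x \<bullet> frechet_derivative \<phi> (at x) (w t x))"
  \<comment> \<open>A second evaluation of the time derivative of the metric product of velocity and
    test field, now in Eulerian form by transport. The previous one used the connection; uniqueness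
    of derivatives equates them.\<close>
  have mom: "((\<lambda>s. LINT x:\<Omega>|lborel. R s x * (v s x \<bullet> \<phi> x)) has_real_derivative ?B) (at t)"
    unfolding v'_def
  proof (rule momentum_time_derivative[OF d D(4) e U sm\<phi> R w0 v w_tang])
    show "vector_derivative (\<lambda>s. R s x) (at t) + divg (\<lambda>y. R t y *\<^sub>R w t y) x = 0" if "x \<in> \<Omega>" for x
      by (rule continuity_equation[OF dom X \<rho>0(2) e U sub R RX w0 _ that]) (use wX[OF tb] D(8) in auto)
  qed
  have "((\<lambda>s. gn_metric \<Omega> b \<rho>0 (X s) (velocity X s) (\<lambda>x. \<phi> (X s x))) has_real_derivative ?B) (at t)"
  proof (rule has_field_derivative_transform_within_open[OF mom open_ball tb])
    fix s :: real assume s: "s \<in> ball t e"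
    then have sI: "s \<in> I" using sub by blast
    note Ds = smooth_curveD(2)[OF X sI]
    have "gn_metric \<Omega> b \<rho>0 (X s) (velocity X s) (\<lambda>x. \<phi> (X s x)) = gn_metric \<Omega> b \<rho>0 (X s) (\<lambda>x. \<phi> (X s x)) (velocity X s)"
      by (rule gn_metric_commute)
    also have "\<dots> = (LINT x:\<Omega>|lborel. mass_density \<Omega> \<rho>0 (X s) x *
        (\<phi> x \<bullet> gn_operator b (mass_density \<Omega> \<rho>0 (X s)) (eulerian \<Omega> (X s) (velocity X s)) x))"
    proof (rule gn_metric_eq_operator[OF dom b \<rho>0 Ds \<phi> refl])
      show "smooth_upto (closure \<Omega>) (eulerian \<Omega> (X s) (velocity X s))"
        using tangent_field_velocity[OF dom X sI] by (simp add: tangent_field_def)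
      show "velocity X s x = eulerian \<Omega> (X s) (velocity X s) (X s x)" if "x \<in> closure \<Omega>" for x
        using inverse_map_Diff(1)[OF dom Ds that] by (simp add: eulerian_def)
    qed
    also have "\<dots> = (LINT x:\<Omega>|lborel. R s x * (v s x \<bullet> \<phi> x))"
    proof (rule set_lebesgue_integral_cong)
      have "v s x = gn_operator b (mass_density \<Omega> \<rho>0 (X s)) (eulerian \<Omega> (X s) (velocity X s)) x" if x: "x \<in> \<Omega>" for x
        unfolding v_def by (rule gn_operator_cong_open[OF D(1) x]) (use \<beta>b RX[OF s] wX[OF s] D(8) in auto)
      then show "\<forall>x. x \<in> \<Omega> \<longrightarrow> mass_density \<Omega> \<rho>0 (X s) x *
        (\<phi> x \<bullet> gn_operator b (mass_density \<Omega> \<rho>0 (X s)) (eulerian \<Omega> (X s) (velocity X s)) x) = R s x * (v s x \<bullet> \<phi> x)"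
        using RX[OF s] by (simp add: inner_commute)
    qed (use D(1) in simp)
    finally show "(LINT x:\<Omega>|lborel. R s x * (v s x \<bullet> \<phi> x)) = gn_metric \<Omega> b \<rho>0 (X s) (velocity X s) (\<lambda>x. \<phi> (X s x))" by simp
  qed
  from DERIV_unique[OF this LCd]
  have BA: "?B = gn_metric \<Omega> b \<rho>0 (X t) (D I X (velocity X) t) (\<lambda>x. \<phi> (X t x)) + ?A" .
  \<comment> \<open>By Newton's equation, the metric product of the acceleration with the test field
    is minus the differential of the potential along \<open>C\<close>, whose velocity at 0 is that
    field.\<close>
  obtain G where G: "has_gradient \<Omega> (gn_metric \<Omega> b \<rho>0) (\<lambda>Y. c * potential_energy \<Omega> b \<rho>0 Y) (X t) G"
    "\<And>x. x \<in> closure \<Omega> \<Longrightarrow> D I X (velocity X) t x = - G x"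
    using newton t unfolding newton_equation_def by blast
  obtain \<zeta> where \<zeta>: "tangent_field \<Omega> \<zeta>" "\<And>x. x \<in> closure \<Omega> \<Longrightarrow> G x = \<zeta> (X t x)"
    using G(1) unfolding has_gradient_def tangent_space_def by blast
  have "gn_metric \<Omega> b \<rho>0 (X t) (D I X (velocity X) t) (\<lambda>x. \<phi> (X t x)) =
      gn_metric \<Omega> b \<rho>0 (X t) (\<lambda>x. (- 1) *\<^sub>R G x) (\<lambda>x. \<phi> (X t x))"
    by (rule gn_metric_cong[OF dom XD]) (simp_all add: G(2))
  also have "\<dots> = - gn_metric \<Omega> b \<rho>0 (X t) G (\<lambda>x. \<phi> (X t x))"
    using gn_metric_scaleR[OF dom XD \<zeta>, where c = "- 1"] by simp
  also have "gn_metric \<Omega> b \<rho>0 (X t) G (\<lambda>x. \<phi> (X t x)) = gn_metric \<Omega> b \<rho>0 (X t) G (velocity C 0)"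
    by (rule gn_metric_cong[OF dom XD]) (simp_all add: velC)
  also have "\<dots> = c * (LINT x:\<Omega>|lborel. mass_density \<Omega> \<rho>0 (X t) x *
      (grad (\<lambda>y. mass_density \<Omega> \<rho>0 (X t) y - b y) x \<bullet> eulerian \<Omega> (X t) (velocity C 0) x))"
  proof -
    have "((\<lambda>r. c * potential_energy \<Omega> b \<rho>0 (C r)) has_real_derivative gn_metric \<Omega> b \<rho>0 (X t) G (velocity C 0)) (at 0)"
      using G(1) 0 C C0 unfolding has_gradient_def by metis
    from DERIV_unique[OF this DERIV_cmult[OF potential_energy_derivative[OF dom b \<rho>0 C 0]]]
    show ?thesis by (simp only: C0)
  qed
  also have "(LINT x:\<Omega>|lborel. mass_density \<Omega> \<rho>0 (X t) x *
      (grad (\<lambda>y. mass_density \<Omega> \<rho>0 (X t) y - b y) x \<bullet> eulerian \<Omega> (X t) (velocity C 0) x)) =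
      (LINT x:\<Omega>|lborel. R t x * (grad (\<lambda>y. R t y - \<beta> y) x \<bullet> \<phi> x))"
  proof (rule set_lebesgue_integral_cong)
    show "\<forall>x. x \<in> \<Omega> \<longrightarrow> mass_density \<Omega> \<rho>0 (X t) x *
      (grad (\<lambda>y. mass_density \<Omega> \<rho>0 (X t) y - b y) x \<bullet> eulerian \<Omega> (X t) (velocity C 0) x) =
      R t x * (grad (\<lambda>y. R t y - \<beta> y) x \<bullet> \<phi> x)"
    proof (intro allI impI)
      fix x assume x: "x \<in> \<Omega>"
      then have xK: "x \<in> closure \<Omega>" using D(8) by blast
      have "grad (\<lambda>y. mass_density \<Omega> \<rho>0 (X t) y - b y) x = grad (\<lambda>y. R t y - \<beta> y) x"
        by (rule grad_cong_open[OF D(1) x]) (use \<beta>b RX[OF tb] D(8) in auto)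
      moreover have "eulerian \<Omega> (X t) (velocity C 0) x = \<phi> x"
        using inverse_map_Diff(2)[OF dom XD xK] by (simp add: eulerian_def velC)
      ultimately show "mass_density \<Omega> \<rho>0 (X t) x *
        (grad (\<lambda>y. mass_density \<Omega> \<rho>0 (X t) y - b y) x \<bullet> eulerian \<Omega> (X t) (velocity C 0) x) =
        R t x * (grad (\<lambda>y. R t y - \<beta> y) x \<bullet> \<phi> x)"
        using RX[OF tb x] by simp
    qed
  qed (use D(1) in simp)
  finally have GP: "gn_metric \<Omega> b \<rho>0 (X t) (D I X (velocity X) t) (\<lambda>x. \<phi> (X t x)) =
      - (c * (LINT x:\<Omega>|lborel. R t x * (grad (\<lambda>y. R t y - \<beta> y) x \<bullet> \<phi> x)))" .
  have int: "set_integrable lborel \<Omega> g" if "smooth_on U g" for g :: "plane \<Rightarrow> real"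
    by (rule set_integrable_continuous_closure[OF D(1,4) continuous_on_subset[OF smooth_on_continuous[OF that] U(2)]])
  have iB: "set_integrable lborel \<Omega> (\<lambda>x. R t x * ((v' x + frechet_derivative (v t) (at x) (w t x)) \<bullet> \<phi> x
      + v t x \<bullet> frechet_derivative \<phi> (at x) (w t x)))"
    by (rule int) (intro smooth_on_mult smooth_on_add smooth_on_inner U(1) R0 smv' smooth_on_frechet_apply v0 w0 sm\<phi>)
  have iA: "set_integrable lborel \<Omega> (\<lambda>x. R t x * (grad ?H x \<bullet> \<phi> x + v t x \<bullet> (q x - frechet_derivative (w t) (at x) (\<phi> x))))"
    by (rule int) (intro smooth_on_mult smooth_on_add smooth_on_diff smooth_on_inner smooth_on_grad U(1) R0 smH smooth_on_frechet_apply v0 w0 smq sm\<phi>)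
  have iP: "set_integrable lborel \<Omega> (\<lambda>x. c * (R t x * (grad (\<lambda>y. R t y - \<beta> y) x \<bullet> \<phi> x)))"
    by (rule int) (intro smooth_on_const smooth_on_mult smooth_on_diff smooth_on_inner smooth_on_grad U(1) R0 \<beta> sm\<phi>)
  \<comment> \<open>The derivative of \<open>\<phi>\<close> along \<open>w\<close> occurs both in
    the transport formula and in the energy variation, and cancels. Of the commutator only
    \<open>v t x\<close> paired with the derivative of \<open>w t\<close> along
    \<open>\<phi>\<close> survives, which is the term with the transposed Jacobian.\<close>
  have "(LINT x:\<Omega>|lborel. R t x * (E x \<bullet> \<phi> x)) =
      (LINT x:\<Omega>|lborel. (R t x * ((v' x + frechet_derivative (v t) (at x) (w t x)) \<bullet> \<phi> x
      + v t x \<bullet> frechet_derivative \<phi> (at x) (w t x)) - R t x * (grad ?H x \<bullet> \<phi> x + v t x \<bullet> (q x - frechet_derivative (w t) (at x) (\<phi> x))))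
      + c * (R t x * (grad (\<lambda>y. R t y - \<beta> y) x \<bullet> \<phi> x)))"
  proof (rule set_lebesgue_integral_cong)
    have "R t x * (E x \<bullet> \<phi> x) = (R t x * ((v' x + frechet_derivative (v t) (at x) (w t x)) \<bullet> \<phi> x
      + v t x \<bullet> frechet_derivative \<phi> (at x) (w t x)) - R t x * (grad ?H x \<bullet> \<phi> x + v t x \<bullet> (q x - frechet_derivative (w t) (at x) (\<phi> x))))
      + c * (R t x * (grad (\<lambda>y. R t y - \<beta> y) x \<bullet> \<phi> x))" if x: "x \<in> \<Omega>" for x
    proof -
      have "x \<in> U" using subU x by blast
      then show ?thesis
        unfolding E_inner[OF \<open>x \<in> U\<close>] q_def inner_diff_right by (simp add: algebra_simps)
    qed
    then show "\<forall>x. x \<in> \<Omega> \<longrightarrow> R t x * (E x \<bullet> \<phi> x) = (R t x * ((v' x + frechet_derivative (v t) (at x) (w t x)) \<bullet> \<phi> x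
      + v t x \<bullet> frechet_derivative \<phi> (at x) (w t x)) - R t x * (grad ?H x \<bullet> \<phi> x + v t x \<bullet> (q x - frechet_derivative (w t) (at x) (\<phi> x))))
      + c * (R t x * (grad (\<lambda>y. R t y - \<beta> y) x \<bullet> \<phi> x))" by blast
  qed (use D(1) in simp)
  also have "\<dots> = (?B - ?A) + c * (LINT x:\<Omega>|lborel. R t x * (grad (\<lambda>y. R t y - \<beta> y) x \<bullet> \<phi> x))"
    by (simp only: set_integral_add(2)[OF set_integral_diff(1)[OF iB iA] iP] set_integral_diff(2)[OF iB iA] set_integral_mult_right)
  also have "\<dots> = 0" using BA GP by linarith
  finally have int0: "(LINT x:\<Omega>|lborel. R t x * (E x \<bullet> (d x *\<^sub>R (R t x *\<^sub>R E x)))) = 0"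
    unfolding \<phi>_def \<psi>_def .
  have "E x = 0"
    by (rule integral_test_field_imp_zero[OF dom d U R0 nz[OF tb] smE int0 x])
  then show ?thesis unfolding E_def v'_def .
qed

theorem proposition6p5:
  fixes \<Omega> :: "(real ^ 2) set" and b \<rho>0 :: "real ^ 2 \<Rightarrow> real" and \<epsilon> :: real
    and D :: connection
  assumes dom: "smooth_bounded_domain \<Omega>"
    and b: "smooth_upto (closure \<Omega>) b" "\<forall>x\<in>closure \<Omega>. b x > 0"
    and \<rho>0: "smooth_upto (closure \<Omega>) \<rho>0" "\<forall>x\<in>closure \<Omega>. \<rho>0 x > 0"
    and eps: "\<epsilon> \<noteq> 0"
    and inv: "\<forall>X\<in>Diff \<Omega>. gn_operator_invertible \<Omega> b (mass_density \<Omega> \<rho>0 X)"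
    and LC: "levi_civita \<Omega> (gn_metric \<Omega> b \<rho>0) D"
  shows
    "(\<forall>X\<in>Diff \<Omega>. \<exists>\<eta>. tangent_field \<Omega> \<eta> \<and>
        (\<forall>x\<in>\<Omega>. gn_operator b (mass_density \<Omega> \<rho>0 X) \<eta> x
                 = grad (\<lambda>y. mass_density \<Omega> \<rho>0 X y - b y) x) \<and>
        has_gradient \<Omega> (gn_metric \<Omega> b \<rho>0) (\<lambda>Y. 1 / \<epsilon>\<^sup>2 * potential_energy \<Omega> b \<rho>0 Y) X
          (\<lambda>x. (1 / \<epsilon>\<^sup>2) *\<^sub>R \<eta> (X x)))
     \<and>
     (\<forall>I X. smooth_curve \<Omega> I X \<longrightarrow>
        (newton_equation \<Omega> (gn_metric \<Omega> b \<rho>0) D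
            (\<lambda>Y. 1 / \<epsilon>\<^sup>2 * potential_energy \<Omega> b \<rho>0 Y) I X
         \<longleftrightarrow>
         (\<forall>t\<in>I. \<exists>\<eta>. tangent_field \<Omega> \<eta> \<and>
            (\<forall>x\<in>closure \<Omega>. D I X (velocity X) t x = - ((1 / \<epsilon>\<^sup>2) *\<^sub>R \<eta> (X t x))) \<and>
            (\<forall>x\<in>\<Omega>. gn_operator b (mass_density \<Omega> \<rho>0 (X t)) \<eta> x =
                     grad (\<lambda>y. mass_density \<Omega> \<rho>0 (X t) y - b y) x))))
     \<and>
     (\<forall>I X. smooth_curve \<Omega> I X \<and>
        newton_equation \<Omega> (gn_metric \<Omega> b \<rho>0) D
            (\<lambda>Y. 1 / \<epsilon>\<^sup>2 * potential_energy \<Omega> b \<rho>0 Y) I X \<longrightarrow>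
        (let u = (\<lambda>t. eulerian \<Omega> (X t) (velocity X t));
             \<rho> = (\<lambda>t. mass_density \<Omega> \<rho>0 (X t));
             v = (\<lambda>t. gn_operator b (\<rho> t) (u t))
         in green_naghdi \<epsilon> b \<Omega> I u v \<rho>))"
proof -
  note D = smooth_bounded_domainD[OF dom]
  let ?c = "1 / \<epsilon>\<^sup>2"
  have c: "?c \<noteq> 0" using eps by simp
  have grad_energy: "has_gradient \<Omega> (gn_metric \<Omega> b \<rho>0) (\<lambda>Y. ?c * potential_energy \<Omega> b \<rho>0 Y) X (\<lambda>x. ?c *\<^sub>R \<eta> (X x))"
    if "X \<in> Diff \<Omega>" "tangent_field \<Omega> \<eta>"
      "\<forall>x\<in>\<Omega>. gn_operator b (mass_density \<Omega> \<rho>0 X) \<eta> x = grad (\<lambda>y. mass_density \<Omega> \<rho>0 X y - b y) x" for X \<eta>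
    by (rule gradient_potential_energy[OF dom b(1) \<rho>0 that])
  have part1: "\<exists>\<eta>. tangent_field \<Omega> \<eta> \<and>
        (\<forall>x\<in>\<Omega>. gn_operator b (mass_density \<Omega> \<rho>0 X) \<eta> x = grad (\<lambda>y. mass_density \<Omega> \<rho>0 X y - b y) x) \<and>
        has_gradient \<Omega> (gn_metric \<Omega> b \<rho>0) (\<lambda>Y. ?c * potential_energy \<Omega> b \<rho>0 Y) X (\<lambda>x. ?c *\<^sub>R \<eta> (X x))"
    if X: "X \<in> Diff \<Omega>" for X
  proof -
    obtain U \<beta> R where S: "open U" "closure \<Omega> \<subseteq> U" "smooth_on U \<beta>" "smooth_on U R"
      "\<And>x. x \<in> closure \<Omega> \<Longrightarrow> \<beta> x = b x" "\<And>x. x \<in> U \<Longrightarrow> R x \<noteq> 0"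
      "\<And>x. x \<in> \<Omega> \<Longrightarrow> R x = mass_density \<Omega> \<rho>0 X x"
      by (rule static_fields[OF dom b(1) \<rho>0 X]) (rule that, (assumption | simp)+)
    \<comment> \<open>Invertibility applies to right-hand sides that are smooth up to the boundary.
      The gradient is therefore formed from the extended density and identified with the given one
      on \<open>\<Omega>\<close> afterwards.\<close>
    have "smooth_upto (closure \<Omega>) (grad (\<lambda>y. R y - \<beta> y))"
      by (intro smooth_upto_on[OF S(1,2)] smooth_on_grad smooth_on_diff S)
    then obtain \<eta> where \<eta>: "tangent_field \<Omega> \<eta>"
      "\<forall>x\<in>\<Omega>. gn_operator b (mass_density \<Omega> \<rho>0 X) \<eta> x = grad (\<lambda>y. R y - \<beta> y) x"
      using inv X unfolding gn_operator_invertible_def by blast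
    have "grad (\<lambda>y. R y - \<beta> y) x = grad (\<lambda>y. mass_density \<Omega> \<rho>0 X y - b y) x" if "x \<in> \<Omega>" for x
      by (rule grad_cong_open[OF D(1) that]) (use S(5,7) D(8) in auto)
    then have A: "\<forall>x\<in>\<Omega>. gn_operator b (mass_density \<Omega> \<rho>0 X) \<eta> x = grad (\<lambda>y. mass_density \<Omega> \<rho>0 X y - b y) x"
      using \<eta>(2) by simp
    show ?thesis using \<eta>(1) A grad_energy[OF X \<eta>(1) A] by blast
  qed
  \<comment> \<open>Forward, every gradient has the required form; backward, every field of that
    form is a gradient.\<close>
  have part2: "newton_equation \<Omega> (gn_metric \<Omega> b \<rho>0) D (\<lambda>Y. ?c * potential_energy \<Omega> b \<rho>0 Y) I X \<longleftrightarrow>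
      (\<forall>t\<in>I. \<exists>\<eta>. tangent_field \<Omega> \<eta> \<and>
        (\<forall>x\<in>closure \<Omega>. D I X (velocity X) t x = - (?c *\<^sub>R \<eta> (X t x))) \<and>
        (\<forall>x\<in>\<Omega>. gn_operator b (mass_density \<Omega> \<rho>0 (X t)) \<eta> x = grad (\<lambda>y. mass_density \<Omega> \<rho>0 (X t) y - b y) x))"
    if X: "smooth_curve \<Omega> I X" for I X
  proof
    assume N: "newton_equation \<Omega> (gn_metric \<Omega> b \<rho>0) D (\<lambda>Y. ?c * potential_energy \<Omega> b \<rho>0 Y) I X"
    show "\<forall>t\<in>I. \<exists>\<eta>. tangent_field \<Omega> \<eta> \<and>
        (\<forall>x\<in>closure \<Omega>. D I X (velocity X) t x = - (?c *\<^sub>R \<eta> (X t x))) \<and>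
        (\<forall>x\<in>\<Omega>. gn_operator b (mass_density \<Omega> \<rho>0 (X t)) \<eta> x = grad (\<lambda>y. mass_density \<Omega> \<rho>0 (X t) y - b y) x)"
    proof
      fix t assume t: "t \<in> I"
      obtain G where G: "has_gradient \<Omega> (gn_metric \<Omega> b \<rho>0) (\<lambda>Y. ?c * potential_energy \<Omega> b \<rho>0 Y) (X t) G"
        "\<forall>x\<in>closure \<Omega>. D I X (velocity X) t x = - G x"
        using N t unfolding newton_equation_def by blast
      from gradient_potential_energy_unique[OF dom b(1) \<rho>0 smooth_curveD(2)[OF X t] c G(1)] G(2)
      show "\<exists>\<eta>. tangent_field \<Omega> \<eta> \<and>
        (\<forall>x\<in>closure \<Omega>. D I X (velocity X) t x = - (?c *\<^sub>R \<eta> (X t x))) \<and>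
        (\<forall>x\<in>\<Omega>. gn_operator b (mass_density \<Omega> \<rho>0 (X t)) \<eta> x = grad (\<lambda>y. mass_density \<Omega> \<rho>0 (X t) y - b y) x)"
        by auto
    qed
  next
    assume N: "\<forall>t\<in>I. \<exists>\<eta>. tangent_field \<Omega> \<eta> \<and>
        (\<forall>x\<in>closure \<Omega>. D I X (velocity X) t x = - (?c *\<^sub>R \<eta> (X t x))) \<and>
        (\<forall>x\<in>\<Omega>. gn_operator b (mass_density \<Omega> \<rho>0 (X t)) \<eta> x = grad (\<lambda>y. mass_density \<Omega> \<rho>0 (X t) y - b y) x)"
    show "newton_equation \<Omega> (gn_metric \<Omega> b \<rho>0) D (\<lambda>Y. ?c * potential_energy \<Omega> b \<rho>0 Y) I X"
      unfolding newton_equation_def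
    proof
      fix t assume t: "t \<in> I"
      obtain \<eta> where \<eta>: "tangent_field \<Omega> \<eta>"
        "\<forall>x\<in>closure \<Omega>. D I X (velocity X) t x = - (?c *\<^sub>R \<eta> (X t x))"
        "\<forall>x\<in>\<Omega>. gn_operator b (mass_density \<Omega> \<rho>0 (X t)) \<eta> x = grad (\<lambda>y. mass_density \<Omega> \<rho>0 (X t) y - b y) x"
        using N t by blast
      from grad_energy[OF smooth_curveD(2)[OF X t] \<eta>(1,3)] \<eta>(2)
      show "\<exists>G. has_gradient \<Omega> (gn_metric \<Omega> b \<rho>0) (\<lambda>Y. ?c * potential_energy \<Omega> b \<rho>0 Y) (X t) G \<and>
          (\<forall>x\<in>closure \<Omega>. D I X (velocity X) t x = - G x)" by blast
    qed
  qed
  have part3: "green_naghdi \<epsilon> b \<Omega> I u (\<lambda>t. gn_operator b (\<rho> t) (u t)) \<rho>"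
    if X: "smooth_curve \<Omega> I X"
      and N: "newton_equation \<Omega> (gn_metric \<Omega> b \<rho>0) D (\<lambda>Y. ?c * potential_energy \<Omega> b \<rho>0 Y) I X"
      and u: "u = (\<lambda>t. eulerian \<Omega> (X t) (velocity X t))" and \<rho>: "\<rho> = (\<lambda>t. mass_density \<Omega> \<rho>0 (X t))"
    for I X u \<rho>
  proof -
    \<comment> \<open>The extensions exist only for times near \<open>t\<close>. This suffices,
      because the equations are pointwise in time and smoothness on the product is a local
      property.\<close>
    have loc: "(\<exists>e>0. smooth_on (ball t e \<times> \<Omega>) (\<lambda>(t, x). u t x) \<and> smooth_on (ball t e \<times> \<Omega>) (\<lambda>(t, x). \<rho> t x)) \<and>
      (\<forall>x\<in>\<Omega>. vector_derivative (\<lambda>s. gn_operator b (\<rho> s) (u s) x) (at t)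
          + jacobian (gn_operator b (\<rho> t) (u t)) (at x) *v u t x
          + transpose (jacobian (u t) (at x)) *v gn_operator b (\<rho> t) (u t) x
          + grad (\<lambda>y. 1 / \<epsilon>\<^sup>2 * (\<rho> t y - b y) - 1/2 * (norm (u t y))\<^sup>2
                     - 1/2 * (\<rho> t y * divg (u t) y + u t y \<bullet> grad b y)\<^sup>2) x = 0
        \<and> vector_derivative (\<lambda>s. \<rho> s x) (at t) + divg (\<lambda>y. \<rho> t y *\<^sub>R u t y) x = 0)"
      if t: "t \<in> I" for t
    proof -
      obtain e U \<beta> R w where E: "e > 0" "ball t e \<subseteq> I" "open U" "closure \<Omega> \<subseteq> U" "smooth_on U \<beta>"
        "smooth_on (ball t e \<times> U) (\<lambda>p. R (fst p) (snd p))"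
        "smooth_on (ball t e \<times> U) (\<lambda>p. w (fst p) (snd p))"
        "\<And>x. x \<in> closure \<Omega> \<Longrightarrow> \<beta> x = b x"
        "\<And>s x. s \<in> ball t e \<Longrightarrow> x \<in> U \<Longrightarrow> R s x \<noteq> 0"
        "\<And>s x. s \<in> ball t e \<Longrightarrow> x \<in> \<Omega> \<Longrightarrow> R s x = mass_density \<Omega> \<rho>0 (X s) x"
        "\<And>s x. s \<in> ball t e \<Longrightarrow> x \<in> closure \<Omega> \<Longrightarrow> w s x = eulerian \<Omega> (X s) (velocity X s) x"
        by (rule smooth_curve_fields[OF dom \<rho>0 b(1) X t velocity_smooth_upto[OF X X]]) (rule that, (assumption | simp)+)
      have tb: "t \<in> ball t e" using E(1) by simp
      have sub: "ball t e \<times> \<Omega> \<subseteq> ball t e \<times> U" using D(8) E(4) by blast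
      have O: "open (ball t e \<times> \<Omega>)" by (intro open_Times open_ball D(1))
      have R\<rho>: "R s y = \<rho> s y" and wu: "w s y = u s y" if "s \<in> ball t e" "y \<in> \<Omega>" for s y
        using E(10)[OF that] E(11)[OF that(1), of y] that(2) D(8) by (auto simp: u \<rho>)
      have \<beta>b: "\<beta> y = b y" if "y \<in> \<Omega>" for y using E(8) D(8) that by blast
      have v: "gn_operator \<beta> (R s) (w s) y = gn_operator b (\<rho> s) (u s) y" if "s \<in> ball t e" "y \<in> \<Omega>" for s y
        by (rule gn_operator_cong_open[OF D(1) that(2) \<beta>b R\<rho>[OF that(1)] wu[OF that(1)]])
      have su: "smooth_on (ball t e \<times> \<Omega>) (\<lambda>(t, x). u t x)"
        by (rule smooth_on_cong[OF O smooth_on_subset[OF E(7) sub]]) (auto simp: wu)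
      have s\<rho>: "smooth_on (ball t e \<times> \<Omega>) (\<lambda>(t, x). \<rho> t x)"
        by (rule smooth_on_cong[OF O smooth_on_subset[OF E(6) sub]]) (auto simp: R\<rho>)
      have w0: "smooth_on U (w t)" by (rule smooth_on_slice[OF E(7) tb E(3)])
      have momentum: "vector_derivative (\<lambda>s. gn_operator b (\<rho> s) (u s) x) (at t)
          + jacobian (gn_operator b (\<rho> t) (u t)) (at x) *v u t x
          + transpose (jacobian (u t) (at x)) *v gn_operator b (\<rho> t) (u t) x
          + grad (\<lambda>y. 1 / \<epsilon>\<^sup>2 * (\<rho> t y - b y) - 1/2 * (norm (u t y))\<^sup>2
                     - 1/2 * (\<rho> t y * divg (u t) y + u t y \<bullet> grad b y)\<^sup>2) x = 0" if x: "x \<in> \<Omega>" for x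
      proof -
        have 1: "vector_derivative (\<lambda>s. gn_operator \<beta> (R s) (w s) x) (at t) = vector_derivative (\<lambda>s. gn_operator b (\<rho> s) (u s) x) (at t)"
          by (rule vector_derivative_cong_open[OF open_ball tb v[OF _ x]])
        have 2: "jacobian (gn_operator \<beta> (R t) (w t)) (at x) = jacobian (gn_operator b (\<rho> t) (u t)) (at x)"
          by (rule jacobian_cong_open[OF D(1) x v[OF tb]])
        have 3: "jacobian (w t) (at x) = jacobian (u t) (at x)"
          by (rule jacobian_cong_open[OF D(1) x wu[OF tb]])
        have 4: "grad (\<lambda>y. ?c * (R t y - \<beta> y) - gn_bernoulli \<beta> (R t) (w t) y) x =
            grad (\<lambda>y. 1 / \<epsilon>\<^sup>2 * (\<rho> t y - b y) - 1/2 * (norm (u t y))\<^sup>2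
                     - 1/2 * (\<rho> t y * divg (u t) y + u t y \<bullet> grad b y)\<^sup>2) x"
        proof (rule grad_cong_open[OF D(1) x])
          fix y assume y: "y \<in> \<Omega>"
          show "?c * (R t y - \<beta> y) - gn_bernoulli \<beta> (R t) (w t) y = 1 / \<epsilon>\<^sup>2 * (\<rho> t y - b y) - 1/2 * (norm (u t y))\<^sup>2
                     - 1/2 * (\<rho> t y * divg (u t) y + u t y \<bullet> grad b y)\<^sup>2"
            using grad_cong_open[OF D(1) y \<beta>b] divg_cong_open[OF D(1) y wu[OF tb]] R\<rho>[OF tb y] \<beta>b[OF y] wu[OF tb y]
            by (simp add: gn_bernoulli_def)
        qed
        from newton_imp_momentum_equation[OF dom b(1) \<rho>0 LC X t N E(1-11) x] show ?thesis
          unfolding 1 2 3 4 v[OF tb x] wu[OF tb x] .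
      qed
      have mass: "vector_derivative (\<lambda>s. \<rho> s x) (at t) + divg (\<lambda>y. \<rho> t y *\<^sub>R u t y) x = 0" if x: "x \<in> \<Omega>" for x
      proof -
        have "vector_derivative (\<lambda>s. R s x) (at t) + divg (\<lambda>y. R t y *\<^sub>R w t y) x = 0"
          by (rule continuity_equation[OF dom X \<rho>0(2) E(1,3,4,2,6,10) w0 _ x]) (use wu[OF tb] u in auto)
        moreover have "vector_derivative (\<lambda>s. R s x) (at t) = vector_derivative (\<lambda>s. \<rho> s x) (at t)"
          by (rule vector_derivative_cong_open[OF open_ball tb R\<rho>[OF _ x]])
        moreover have "divg (\<lambda>y. R t y *\<^sub>R w t y) x = divg (\<lambda>y. \<rho> t y *\<^sub>R u t y) x"
          by (rule divg_cong_open[OF D(1) x]) (simp only: R\<rho>[OF tb] wu[OF tb])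
        ultimately show ?thesis by simp
      qed
      show ?thesis
        by (rule conjI[OF _ ballI[OF conjI[OF momentum mass]]], rule exI[of _ e], rule conjI[OF E(1) conjI[OF su s\<rho>]])
    qed
    have smooth: "smooth_on (I \<times> \<Omega>) (\<lambda>(t, x). f t x)"
      if f: "\<And>t. t \<in> I \<Longrightarrow> \<exists>e>0. smooth_on (ball t e \<times> \<Omega>) (\<lambda>(t, x). f t x)"
      for f :: "real \<Rightarrow> plane \<Rightarrow> 'z::real_normed_vector"
    proof (rule smooth_on_local)
      fix p assume p: "p \<in> I \<times> \<Omega>"
      then have pI: "fst p \<in> I" and p\<Omega>: "snd p \<in> \<Omega>" by auto
      obtain e where e: "e > 0" "smooth_on (ball (fst p) e \<times> \<Omega>) (\<lambda>(t, x). f t x)"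
        using f[OF pI] by blast
      have "open (ball (fst p) e \<times> \<Omega>)" by (intro open_Times open_ball D(1))
      moreover have "p \<in> ball (fst p) e \<times> \<Omega>" using e(1) p\<Omega> by (simp add: mem_Times_iff)
      ultimately show "\<exists>T. open T \<and> p \<in> T \<and> smooth_on T (\<lambda>(t, x). f t x)"
        using e(2) by blast
    qed
    show ?thesis
      unfolding green_naghdi_def
    proof (intro conjI ballI)
      show "smooth_on (I \<times> \<Omega>) (\<lambda>(t, x). u t x)"
        by (rule smooth) (use conjunct1[OF loc] in blast)
      show "smooth_on (I \<times> \<Omega>) (\<lambda>(t, x). \<rho> t x)"
        by (rule smooth) (use conjunct1[OF loc] in blast)
      fix t x assume tx: "t \<in> I" "x \<in> \<Omega>"
      note eqs = bspec[OF conjunct2[OF loc[OF tx(1)]] tx(2)]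
      show "vector_derivative (\<lambda>s. gn_operator b (\<rho> s) (u s) x) (at t)
          + jacobian (gn_operator b (\<rho> t) (u t)) (at x) *v u t x
          + transpose (jacobian (u t) (at x)) *v gn_operator b (\<rho> t) (u t) x
          + grad (\<lambda>y. 1 / \<epsilon>\<^sup>2 * (\<rho> t y - b y) - 1/2 * (norm (u t y))\<^sup>2
                     - 1/2 * (\<rho> t y * divg (u t) y + u t y \<bullet> grad b y)\<^sup>2) x = 0"
        by (rule conjunct1[OF eqs])
      show "vector_derivative (\<lambda>s. \<rho> s x) (at t) + divg (\<lambda>y. \<rho> t y *\<^sub>R u t y) x = 0"
        by (rule conjunct2[OF eqs])
    qed (rule refl)
  qed
  show ?thesis
  proof (intro conjI ballI allI impI)
    fix I X
    assume "smooth_curve \<Omega> I X \<and>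
        newton_equation \<Omega> (gn_metric \<Omega> b \<rho>0) D (\<lambda>Y. ?c * potential_energy \<Omega> b \<rho>0 Y) I X"
    then show "let u = \<lambda>t. eulerian \<Omega> (X t) (velocity X t); \<rho> = \<lambda>t. mass_density \<Omega> \<rho>0 (X t);
          v = \<lambda>t. gn_operator b (\<rho> t) (u t)
        in green_naghdi \<epsilon> b \<Omega> I u v \<rho>"
      unfolding Let_def by (elim conjE) (rule part3[OF _ _ refl refl])
  qed (fact part1 part2)+
qed

end
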